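(* Let $N\ge1$, $k\ge1$ be integers, $1<p<\infty$, $q=p/(p-1)$, $\kappa_0>0$ and $\theta_0\in(0,1]$. Let $\Omega_h$ be a conforming simplicial mesh of $\Omega\subset\mathbb{R}^N$ with $|M_K|\,|M_K^{-1}|\le\kappa_0$ for all $K\in\Omega_h$. Let $\beta$ be an advection field that is constant on each element, $\beta|_K\equiv\beta_K\in\mathbb{R}^N\setminus\{0\}$, with continuous normal component across element interfaces. Suppose that either $k=1$, or $|\beta_K\cdot n_i|\ge\theta_0|\beta_K|$ for every $K\in\Omega_h$ and every facet $F_i$ of $K$. For $v\in W_q(\partial_\beta,K)$ let $\bar v$ be the mean value of $v$ over $K$, and set $\varPi_K^+v:=\bar v+\varPi_K(v-\bar v)$ and $(\varPi_h^+v)|_K:=\varPi_K^+(v|_K)$. Then: (a) For every $k\ge1$, $\varPi_K^+$ maps $W_q(\partial_\beta,K)$ into $V^+(K):=V(K)+P_0(K)$; it satisfies $\langle D_Kw,\varPi_K^+v-v\rangle=0$ for all $w\in P_k^\perp(K)$ and $(z,\varPi_K^+v-v)_K=0$ for all $z\in P_{k-2}(K)$; and $\varPi_K^+c=c$ for all $c\in P_0(K)$. The sum $V(K)+P_0(K)$ is direct whenever $N\ge2$. (b) If $k=1$, there is a constant $C=C(N,q,\kappa_0)$ such that for all $K\in\Omega_h$ and $v\in W_q(\partial_\beta,K)$, with $a_K:=h_K/|\beta_K|$, $$\|\varPi_K^+v\|_{L_q(K)}\le C\big(\|v\|_{L_q(K)}+a_K\|\beta\cdot\nabla v\|_{L_q(K)}\big),\qquad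 \|\beta\cdot\nabla\varPi_K^+v\|_{L_q(K)}\le C\|\beta\cdot\nabla v\|_{L_q(K)}.$$ Consequently, for every choice of per-element weights $\sigma_K\ge a_K$, $$\sigma_K^{-1}\|\varPi_K^+v\|_{L_q(K)}+\|\beta\cdot\nabla\varPi_K^+v\|_{L_q(K)}\le C\big(\sigma_K^{-1}\|v\|_{L_q(K)}+\|\beta\cdot\nabla v\|_{L_q(K)}\big).$$ (c) For every $k\ge1$ there is a constant $C=C(N,k,q,\theta_0,\kappa_0)$, independent of $\theta_0$ when $k=1$, such that $|\!|\!|\varPi_K^+v|\!|\!|_{q,K}\le C|\!|\!|v|\!|\!|_{q,K}$ for all $K\in\Omega_h$ and $v\in W_q(\partial_\beta,K)$. Consequently $|\!|\!|\varPi_h^+v|\!|\!|_{q,\Omega_h}\le C|\!|\!|v|\!|\!|_{q,\Omega_h}$ for all $v\in W_q(\partial_\beta,\Omega_h)$.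
   Context: $\Omega\subset\mathbb{R}^N$ is a Lipschitz polyhedral domain. $\hat K$ is the unit reference $N$-simplex with vertices $\hat a_0,\dots,\hat a_N$. Each element $K\in\Omega_h$, with vertices $a_0,\dots,a_N$, is the image of $\hat K$ under an affine homeomorphism $\Phi_K(\hat x)=M_K\hat x+g_K$ mapping $\hat a_i$ to $a_i$; $h_K=\operatorname{diam}K$. $|\cdot|$ is the Euclidean norm of vectors and the associated matrix norm. $\lambda_0,\dots,\lambda_N$ are the barycentric coordinates of $K$, $F_i$ is the facet of $K$ opposite $a_i$, and $n_i$ is the outward unit normal on $F_i$. All constants $C$ are independent of the mesh and of $\beta$, apart from the listed dependencies. $(\cdot,\cdot)_K$ is the $L_2(K)$ pairing $(f,g)_K=\int_K fg\,dx$. $W_r(\partial_\beta,K)=\{v\in L_r(K):\beta\cdot\nabla v\in L_r(K)\}$ and $W_r(\partial_\beta,\Omega_h)=\prod_{K\in\Omega_h}W_r(\partial_\beta,K)$. For $w\in W_p(\partial_\beta,K)$, $v\in W_q(\partial_\beta,K)$ let $\langle D_Kw,v\rangle=(\beta\cdot\nabla w,v)_K+(w,\beta\cdot\nabla v)_K$. $P_j(K)$ is the space of polynomials of degree at most $j$ on $K$ ($\{0\}$ if $j<0$). $\mathring P_j(K)=\{z\in P_j(K):z|_{\partial K}=0\}$, which is $\{0\}$ for $0\le j\le N$; $P_j^\perp(K)$ is the $L_2(K)$-orthogonal complement of $\mathring P_j(K)$ in $P_j(K)$. Bubbles: $b=\prod_{j=0}^N\lambda_j$, $b_i=\prod_{j\ne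 i}\lambda_j$. Signs: $s_i=\operatorname{sgn}(\beta_K\cdot n_i)\in\{-1,0,1\}$, $b_s=\sum_{i=0}^N s_ib_i$. Local test space: $V(K)=b_sP_k^\perp(K)+b\,P_{k-2}(K)$. Under the stated hypotheses, for every $v\in W_q(\partial_\beta,K)$ there is a unique $\varPi_Kv\in V(K)$ with $\langle D_Kw,\varPi_Kv-v\rangle=0$ for all $w\in P_k^\perp(K)$ and $(z,\varPi_Kv-v)_K=0$ for all $z\in P_{k-2}(K)$; this defines $\varPi_K$. Norms: $|\!|\!|v|\!|\!|_{q,K}=\|v\|_{L_q(K)}+\frac{h_K}{|\beta_K|}\|\beta\cdot\nabla v\|_{L_q(K)}$ and $|\!|\!|v|\!|\!|_{q,\Omega_h}^q=\sum_{K\in\Omega_h}|\!|\!|v|\!|\!|_{q,K}^q$. *)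

theory Defs
  imports "HOL-Analysis.Analysis"
begin

section \<open>Elements\<close>

text \<open>
  The space dimension is \<open>N = CARD('n)\<close>. An element \<open>K\<close> is given by its numbered vertices
  \<open>a\<^sub>0, \<dots>, a\<^sub>N\<close>: the index \<open>None\<close> stands for 0 and the indices \<open>Some j\<close> for \<open>1, \<dots>, N\<close>.
\<close>

type_synonym 'n element = "'n option \<Rightarrow> real^'n"

definition nondegenerate :: "'n::finite element \<Rightarrow> bool" where
  "nondegenerate a \<longleftrightarrow> inj a \<and> \<not> affine_dependent (range a)"

definition cell :: "'n::finite element \<Rightarrow> (real^'n) set" where
  "cell a = convex hull (range a)"

definition ref_element :: "'n::finite element" where
  "ref_element i = (case i of None \<Rightarrow> 0 | Some j \<Rightarrow> axis j 1)"

text \<open>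
  The columns of \<open>M\<^sub>K\<close> are \<open>a\<^sub>j - a\<^sub>0\<close>, so that \<open>\<Phi>\<^sub>K\<close> is the affine map sending the vertices of
  the reference simplex to those of \<open>K\<close>, with the same numbering.
\<close>

definition elem_matrix :: "'n::finite element \<Rightarrow> real^'n^'n" where
  "elem_matrix a = (\<chi> i j. (a (Some j) - a None) $ i)"

definition elem_map :: "'n::finite element \<Rightarrow> real^'n \<Rightarrow> real^'n" where
  "elem_map a x = elem_matrix a *v x + a None"

lemma elem_map_ref_element: "elem_map a (ref_element i) = a i"
  by (cases i)
     (simp_all add: elem_map_def ref_element_def elem_matrix_def matrix_vector_mul_component
        vec_eq_iff matrix_vector_mult_def axis_def if_distrib cong: if_cong)

definition matrix_norm :: "real^'n^'n \<Rightarrow> real" where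
  "matrix_norm M = onorm ((*v) M)"

definition facet :: "'n::finite element \<Rightarrow> 'n option \<Rightarrow> (real^'n) set" where
  "facet a i = convex hull (a ` (- {i}))"

definition normal :: "'n::finite element \<Rightarrow> 'n option \<Rightarrow> real^'n" where
  "normal a i = (THE n. norm n = 1 \<and> (\<forall>x\<in>facet a i. \<forall>y\<in>facet a i. n \<bullet> (x - y) = 0)
                      \<and> (\<forall>x\<in>facet a i. n \<bullet> (a i - x) < 0))"

text \<open>The barycentric coordinates are used as affine functions on the whole space.\<close>

definition bary :: "'n::finite element \<Rightarrow> 'n option \<Rightarrow> real^'n \<Rightarrow> real" where
  "bary a i x = (THE l. (\<Sum>j\<in>UNIV. l j) = 1 \<and> (\<Sum>j\<in>UNIV. l j *\<^sub>R a j) = x) i"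


section \<open>Domains, meshes and advection fields\<close>

text \<open>
  Near each boundary point, in coordinates whose last axis has direction \<open>u\<close>, the domain is the
  region above the graph of a Lipschitz function on the hyperplane orthogonal to \<open>u\<close>.
\<close>

definition lipschitz_domain :: "(real^'n) set \<Rightarrow> bool" where
  "lipschitz_domain \<Omega> \<longleftrightarrow> open \<Omega> \<and> connected \<Omega> \<and> bounded \<Omega> \<and> \<Omega> \<noteq> {} \<and>
     (\<forall>x\<in>frontier \<Omega>. \<exists>u r L. \<exists>\<gamma> :: real^'n \<Rightarrow> real.
        norm u = 1 \<and> r > 0 \<and> L-lipschitz_on {y. y \<bullet> u = 0} \<gamma> \<and>
        \<Omega> \<inter> ball x r = {y \<in> ball x r. \<gamma> (y - (y \<bullet> u) *\<^sub>R u) < y \<bullet> u})"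

definition lipschitz_polyhedral_domain :: "(real^'n) set \<Rightarrow> bool" where
  "lipschitz_polyhedral_domain \<Omega> \<longleftrightarrow> lipschitz_domain \<Omega> \<and>
     (\<exists>\<P>. finite \<P> \<and> (\<forall>P\<in>\<P>. polytope P) \<and> closure \<Omega> = \<Union>\<P>)"

text \<open>
  Injectivity of \<^const>\<open>cell\<close> says that every simplex of the mesh occurs with only one numbering
  of its vertices; \<^const>\<open>triangulation\<close> requires any two simplices to meet in a common (possibly
  empty) face.
\<close>

definition conforming_mesh :: "(real^'n) set \<Rightarrow> 'n::finite element set \<Rightarrow> bool" where
  "conforming_mesh \<Omega> \<T> \<longleftrightarrow> finite \<T> \<and> (\<forall>K\<in>\<T>. nondegenerate K) \<and> inj_on cell \<T> \<and>
     triangulation (cell ` \<T>) \<and> \<Union>(cell ` \<T>) = closure \<Omega>"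

definition shape_regular :: "real \<Rightarrow> 'n::finite element set \<Rightarrow> bool" where
  "shape_regular \<kappa> \<T> \<longleftrightarrow>
     (\<forall>K\<in>\<T>. matrix_norm (elem_matrix K) * matrix_norm (matrix_inv (elem_matrix K)) \<le> \<kappa>)"

text \<open>An elementwise constant field \<open>\<beta>\<close> is given by the family of its values \<open>\<beta>\<^sub>K\<close>.\<close>

definition advection_field :: "'n::finite element set \<Rightarrow> ('n element \<Rightarrow> real^'n) \<Rightarrow> bool" where
  "advection_field \<T> \<beta> \<longleftrightarrow> (\<forall>K\<in>\<T>. \<beta> K \<noteq> 0) \<and>
     (\<forall>K\<in>\<T>. \<forall>K'\<in>\<T>. \<forall>i j. K \<noteq> K' \<and> facet K i = facet K' j
        \<longrightarrow> \<beta> K \<bullet> normal K i = \<beta> K' \<bullet> normal K i)"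

definition nontangential :: "real \<Rightarrow> 'n::finite element set \<Rightarrow> ('n element \<Rightarrow> real^'n) \<Rightarrow> bool" where
  "nontangential \<theta> \<T> \<beta> \<longleftrightarrow> (\<forall>K\<in>\<T>. \<forall>i. \<bar>\<beta> K \<bullet> normal K i\<bar> \<ge> \<theta> * norm (\<beta> K))"

definition hypotheses ::
  "nat \<Rightarrow> real \<Rightarrow> real \<Rightarrow> real \<Rightarrow> real \<Rightarrow> (real^'n) set \<Rightarrow> 'n::finite element set
     \<Rightarrow> ('n element \<Rightarrow> real^'n) \<Rightarrow> bool" where
  "hypotheses k p q \<kappa>0 \<theta>0 \<Omega> \<T> \<beta> \<longleftrightarrow>
     k \<ge> 1 \<and> 1 < p \<and> q = p / (p - 1) \<and> 0 < \<kappa>0 \<and> 0 < \<theta>0 \<and> \<theta>0 \<le> 1 \<and>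
     lipschitz_polyhedral_domain \<Omega> \<and> conforming_mesh \<Omega> \<T> \<and> shape_regular \<kappa>0 \<T> \<and>
     advection_field \<T> \<beta> \<and> (k = 1 \<or> nontangential \<theta>0 \<T> \<beta>)"


section \<open>Function spaces\<close>

text \<open>
  Elements of function spaces on \<open>S\<close> are represented by functions on the whole space, of which only
  the values on \<open>S\<close> (up to null sets) matter.
\<close>

definition Lspace :: "real \<Rightarrow> (real^'n) set \<Rightarrow> (real^'n \<Rightarrow> real) set" where
  "Lspace r S = {f \<in> borel_measurable (lebesgue_on S).
                   integrable (lebesgue_on S) (\<lambda>x. \<bar>f x\<bar> powr r)}"

definition Lnorm :: "real \<Rightarrow> (real^'n) set \<Rightarrow> (real^'n \<Rightarrow> real) \<Rightarrow> real" where
  "Lnorm r S f = (LINT x|lebesgue_on S. \<bar>f x\<bar> powr r) powr (1 / r)"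

definition pairing :: "(real^'n) set \<Rightarrow> (real^'n \<Rightarrow> real) \<Rightarrow> (real^'n \<Rightarrow> real) \<Rightarrow> real" where
  "pairing S f g = (LINT x|lebesgue_on S. f x * g x)"

definition mean :: "(real^'n) set \<Rightarrow> (real^'n \<Rightarrow> real) \<Rightarrow> real" where
  "mean S f = (LINT x|lebesgue_on S. f x) / measure lebesgue S"

primrec Ck :: "nat \<Rightarrow> (real^'n \<Rightarrow> real) \<Rightarrow> bool" where
  "Ck 0 f = continuous_on UNIV f"
| "Ck (Suc m) f = (f differentiable_on UNIV \<and>
                   (\<forall>i. Ck m (\<lambda>x. frechet_derivative f (at x) (axis i 1))))"

definition test_function :: "(real^'n) set \<Rightarrow> (real^'n \<Rightarrow> real) \<Rightarrow> bool" where
  "test_function U \<phi> \<longleftrightarrow> (\<forall>m. Ck m \<phi>) \<and> compact (closure {x. \<phi> x \<noteq> 0}) \<and> closure {x. \<phi> x \<noteq> 0} \<subseteq> U"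

text \<open>
  \<open>\<beta> \<cdot> \<nabla>v\<close> is the distributional derivative, for a constant vector \<open>\<beta>\<close>. It is determined by \<open>v\<close> up
  to null sets. As \<open>S\<close> is bounded in all uses, integrability of \<open>g\<close> is implied by \<open>g \<in> L\<^sub>r(S)\<close>.
\<close>

definition has_dir_deriv ::
  "(real^'n) set \<Rightarrow> real^'n \<Rightarrow> (real^'n \<Rightarrow> real) \<Rightarrow> (real^'n \<Rightarrow> real) \<Rightarrow> bool" where
  "has_dir_deriv S \<beta> v g \<longleftrightarrow> integrable (lebesgue_on S) g \<and>
     (\<forall>\<phi>. test_function (interior S) \<phi> \<longrightarrow>
        (LINT x|lebesgue_on S. v x * frechet_derivative \<phi> (at x) \<beta>)
          = - (LINT x|lebesgue_on S. g x * \<phi> x))"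

definition dir_deriv :: "(real^'n) set \<Rightarrow> real^'n \<Rightarrow> (real^'n \<Rightarrow> real) \<Rightarrow> real^'n \<Rightarrow> real" where
  "dir_deriv S \<beta> v = (SOME g. has_dir_deriv S \<beta> v g)"

definition Wspace :: "real \<Rightarrow> real^'n \<Rightarrow> (real^'n) set \<Rightarrow> (real^'n \<Rightarrow> real) set" where
  "Wspace r \<beta> S = {v \<in> Lspace r S. \<exists>g\<in>Lspace r S. has_dir_deriv S \<beta> v g}"

definition Dpairing ::
  "(real^'n) set \<Rightarrow> real^'n \<Rightarrow> (real^'n \<Rightarrow> real) \<Rightarrow> (real^'n \<Rightarrow> real) \<Rightarrow> real" where
  "Dpairing S \<beta> w v = pairing S (dir_deriv S \<beta> w) v + pairing S w (dir_deriv S \<beta> v)"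

text \<open>
  A polynomial on an element is identified with the unique polynomial function on the whole space
  that extends it. For \<open>j < 0\<close> the index set is empty and the space is \<open>{0}\<close>.
\<close>

definition poly_space :: "int \<Rightarrow> (real^'n \<Rightarrow> real) set" where
  "poly_space j = {f. \<exists>c :: ('n \<Rightarrow> nat) \<Rightarrow> real.
     f = (\<lambda>x. \<Sum>\<alpha> | int (\<Sum>i\<in>UNIV. \<alpha> i) \<le> j. c \<alpha> * (\<Prod>i\<in>UNIV. (x $ i) ^ \<alpha> i))}"

definition poly_space0 :: "int \<Rightarrow> (real^'n) set \<Rightarrow> (real^'n \<Rightarrow> real) set" where
  "poly_space0 j S = {z \<in> poly_space j. \<forall>x\<in>frontier S. z x = 0}"

definition poly_space_perp :: "int \<Rightarrow> (real^'n) set \<Rightarrow> (real^'n \<Rightarrow> real) set" where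
  "poly_space_perp j S = {y \<in> poly_space j. \<forall>z\<in>poly_space0 j S. pairing S y z = 0}"

definition bubble :: "'n::finite element \<Rightarrow> real^'n \<Rightarrow> real" where
  "bubble a x = (\<Prod>j\<in>UNIV. bary a j x)"

definition facet_bubble :: "'n::finite element \<Rightarrow> 'n option \<Rightarrow> real^'n \<Rightarrow> real" where
  "facet_bubble a i x = (\<Prod>j\<in>- {i}. bary a j x)"

definition signed_bubble :: "'n::finite element \<Rightarrow> real^'n \<Rightarrow> real^'n \<Rightarrow> real" where
  "signed_bubble a \<beta> x = (\<Sum>i\<in>UNIV. sgn (\<beta> \<bullet> normal a i) * facet_bubble a i x)"

definition test_space :: "nat \<Rightarrow> 'n::finite element \<Rightarrow> real^'n \<Rightarrow> (real^'n \<Rightarrow> real) set" where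
  "test_space k a \<beta> = {\<lambda>x. signed_bubble a \<beta> x * y x + bubble a x * z x | y z.
      y \<in> poly_space_perp (int k) (cell a) \<and> z \<in> poly_space (int k - 2)}"

definition test_space_plus :: "nat \<Rightarrow> 'n::finite element \<Rightarrow> real^'n \<Rightarrow> (real^'n \<Rightarrow> real) set" where
  "test_space_plus k a \<beta> = {\<lambda>x. u x + c x | u c. u \<in> test_space k a \<beta> \<and> c \<in> poly_space 0}"


section \<open>The operators and norms\<close>

definition fortin ::
  "nat \<Rightarrow> 'n::finite element \<Rightarrow> real^'n \<Rightarrow> (real^'n \<Rightarrow> real) \<Rightarrow> real^'n \<Rightarrow> real" where
  "fortin k a \<beta> v = (THE u. u \<in> test_space k a \<beta> \<and>
      (\<forall>w\<in>poly_space_perp (int k) (cell a). Dpairing (cell a) \<beta> w (\<lambda>x. u x - v x) = 0) \<and>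
      (\<forall>z\<in>poly_space (int k - 2). pairing (cell a) z (\<lambda>x. u x - v x) = 0))"

definition fortin_plus ::
  "nat \<Rightarrow> 'n::finite element \<Rightarrow> real^'n \<Rightarrow> (real^'n \<Rightarrow> real) \<Rightarrow> real^'n \<Rightarrow> real" where
  "fortin_plus k a \<beta> v = (\<lambda>x. mean (cell a) v + fortin k a \<beta> (\<lambda>y. v y - mean (cell a) v) x)"

text \<open>Broken functions on a mesh are families of functions, one for each element.\<close>

definition fortin_plus_mesh ::
  "nat \<Rightarrow> ('n::finite element \<Rightarrow> real^'n) \<Rightarrow> ('n element \<Rightarrow> real^'n \<Rightarrow> real)
     \<Rightarrow> 'n element \<Rightarrow> real^'n \<Rightarrow> real" where
  "fortin_plus_mesh k \<beta> v K = fortin_plus k K (\<beta> K) (v K)"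

definition Wspace_mesh ::
  "real \<Rightarrow> ('n::finite element \<Rightarrow> real^'n) \<Rightarrow> 'n element set
     \<Rightarrow> ('n element \<Rightarrow> real^'n \<Rightarrow> real) set" where
  "Wspace_mesh r \<beta> \<T> = (\<Pi> K\<in>\<T>. Wspace r (\<beta> K) (cell K))"

definition crossing_time :: "'n::finite element \<Rightarrow> real^'n \<Rightarrow> real" where
  "crossing_time a \<beta> = diameter (cell a) / norm \<beta>"

definition tnorm :: "real \<Rightarrow> 'n::finite element \<Rightarrow> real^'n \<Rightarrow> (real^'n \<Rightarrow> real) \<Rightarrow> real" where
  "tnorm q a \<beta> v = Lnorm q (cell a) v
     + crossing_time a \<beta> * Lnorm q (cell a) (dir_deriv (cell a) \<beta> v)"

definition tnorm_mesh ::
  "real \<Rightarrow> ('n::finite element \<Rightarrow> real^'n) \<Rightarrow> 'n element set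
     \<Rightarrow> ('n element \<Rightarrow> real^'n \<Rightarrow> real) \<Rightarrow> real" where
  "tnorm_mesh q \<beta> \<T> v = (\<Sum>K\<in>\<T>. tnorm q K (\<beta> K) (v K) powr q) powr (1 / q)"

end

theory Submission
  imports Defs "HOL-Computational_Algebra.Polynomial"
begin

text \<open>
  Polynomials of degree \<open>k\<close> on an element are written as forms of degree \<open>k\<close> in the barycentric
  coordinates. The moments of barycentric monomials are, up to the volume, universal numbers related by
  \<open>\<delta>\<^sub>l \<integral> \<lambda>\<^bsup>\<delta> - e\<^sub>l\<^esup> = (|\<delta>| + N) \<integral> \<lambda>\<^sup>\<delta>\<close>, which is the divergence theorem for the field \<open>x - a\<^sub>l\<close>. Hence
  \<open>\<langle>D\<^sub>K w, b\<^sub>s y\<rangle>\<close> equals \<open>2 (k + N) |K| \<Sum>\<^sub>i |\<partial>\<^sub>\<beta> \<lambda>\<^sub>i| Q\<^sub>i(w, y)\<close> with positive semidefinite forms \<open>Q\<^sub>i\<close> on coefficient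
  vectors that depend only on \<open>N\<close> and \<open>k\<close>, and no boundary integral is needed. The sum of all \<open>Q\<^sub>i\<close>
  is definite on the coefficients of \<open>P\<^sub>k\<^sup>\<bottom>\<close>; for \<open>k = 1\<close> the sum of any two of them is, and two of the
  weights \<open>|\<partial>\<^sub>\<beta> \<lambda>\<^sub>i|\<close> are always of size \<open>|\<beta>| / h\<close>, which is why the angle condition is not needed there. Compactness
  gives coercivity constants that do not depend on the element, hence unisolvence and all bounds. For
  \<open>k = 1\<close> the derivative of \<open>w\<close> is constant, so \<open>\<langle>D\<^sub>K w, v - mean v\<rangle> = (w, \<beta> \<cdot> \<nabla>v)\<close>, which yields the bound by
  the derivative alone.
\<close>

section \<open>Spans of monomials\<close>

text \<open>The equations for the coefficients \<open>c\<close> of y in P_k^perp and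
  \<open>e\<close> of z in P_{k-2} are triangular: the bubble vanishes on the boundary, so the
  pairing with D_K sees only y, and z is then found from its own moments with y known. Both blocks
  are symmetric and definite: minimisation gives existence, definiteness gives uniqueness, and
  testing with the solution gives the bounds. The first block is definite because a polynomial with
  zero trace lies in the very space to which P_k^perp is orthogonal.

  The barycentric coordinates sum to 1, so multiplying by powers of their sum turns each polynomial
  of degree at most k into a form of degree exactly k, with unique coefficients. The element then
  enters only through its volume, which cancels, and through the numbers
  \<open>dlam i \<beta>\<close>, which are compared with |beta| / h; hence the factor h / |beta| in
  the estimates.

  Derivatives in \<open>Wspace\<close> are distributional and chosen only up to null sets. Their
  uniqueness almost everywhere must be secured before the pairing can be computed; the smooth bump
  functions serve this purpose.\<close>

definition lincomb :: "('j \<Rightarrow> 'x \<Rightarrow> real) \<Rightarrow> 'j set \<Rightarrow> ('j \<Rightarrow> real) \<Rightarrow> 'x \<Rightarrow> real" where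
  "lincomb m A c x = (\<Sum>\<alpha>\<in>A. c \<alpha> * m \<alpha> x)"

text \<open>\<open>\<xi>\<close> is left open because three families occur: Cartesian coordinates,
  barycentric coordinates, and the plain variables \<open>\<lambda>i t. t i\<close> of a formal
  form.\<close>

definition mon :: "('i::finite \<Rightarrow> 'x \<Rightarrow> real) \<Rightarrow> ('i \<Rightarrow> nat) \<Rightarrow> 'x \<Rightarrow> real" where
  "mon \<xi> \<alpha> x = (\<Prod>i\<in>UNIV. \<xi> i x ^ \<alpha> i)"

abbreviation mspan :: "('i::finite \<Rightarrow> 'x \<Rightarrow> real) \<Rightarrow> ('i \<Rightarrow> nat) set \<Rightarrow> ('x \<Rightarrow> real) set" where
  "mspan \<xi> A \<equiv> range (lincomb (mon \<xi>) A)"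

lemma mon_add: "mon \<xi> (\<lambda>i. \<alpha> i + \<beta> i) x = mon \<xi> \<alpha> x * mon \<xi> \<beta> x"
  by (simp add: mon_def power_add prod.distrib)

lemma lincomb_add: "lincomb m A c x + lincomb m A d x = lincomb m A (\<lambda>a. c a + d a) x"
  by (simp add: lincomb_def algebra_simps sum.distrib)

lemma lincomb_scale: "r * lincomb m A c x = lincomb m A (\<lambda>a. r * c a) x"
  by (simp add: lincomb_def algebra_simps sum_distrib_left)

lemma lincomb_single:
  assumes "finite A" "a \<in> A"
  shows "lincomb m A (\<lambda>b. if b = a then 1 else 0) x = m a x"
  using assms by (simp add: lincomb_def if_distrib if_distribR cong: if_cong)

lemma lincomb_zero_outside: "lincomb m A (\<lambda>a. if a \<in> A then c a else 0) = lincomb m A c"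
  by (simp add: lincomb_def fun_eq_iff)

lemma lincomb_mult:
  "lincomb m A c x * lincomb m' B d x = (\<Sum>\<alpha>\<in>A. \<Sum>\<gamma>\<in>B. c \<alpha> * d \<gamma> * (m \<alpha> x * m' \<gamma> x))"
  by (simp add: lincomb_def sum_product mult_ac)

lemma span_add:
  assumes "f \<in> range (lincomb m A)" "g \<in> range (lincomb m A)"
  shows "(\<lambda>x. f x + g x) \<in> range (lincomb m A)"
proof -
  obtain c d where "f = lincomb m A c" "g = lincomb m A d" using assms by auto
  then have "(\<lambda>x. f x + g x) = lincomb m A (\<lambda>a. c a + d a)" by (simp add: lincomb_add fun_eq_iff)
  then show ?thesis by simp
qed

lemma span_scale:
  assumes "f \<in> range (lincomb m A)"
  shows "(\<lambda>x. r * f x) \<in> range (lincomb m A)"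
proof -
  obtain c where "f = lincomb m A c" using assms by auto
  then have "(\<lambda>x. r * f x) = lincomb m A (\<lambda>a. r * c a)" by (simp add: lincomb_scale fun_eq_iff)
  then show ?thesis by simp
qed

lemma span_zero: "(\<lambda>x. 0) \<in> range (lincomb m A)"
  by (rule range_eqI[of _ _ "\<lambda>_. 0"]) (simp add: lincomb_def fun_eq_iff)

lemma span_sum:
  assumes "\<And>s. s \<in> S \<Longrightarrow> f s \<in> range (lincomb m A)"
  shows "(\<lambda>x. \<Sum>s\<in>S. f s x) \<in> range (lincomb m A)"
  using assms
  by (induction S rule: infinite_finite_induct) (auto intro: span_zero span_add)

lemma span_base:
  assumes "finite A" "a \<in> A"
  shows "m a \<in> range (lincomb m A)"
  using lincomb_single[OF assms, of m] by (intro range_eqI[of _ _ "\<lambda>b. if b = a then 1 else 0"]) auto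

lemma mspan_mult:
  assumes "finite C" "\<And>\<alpha> \<gamma>. \<alpha> \<in> A \<Longrightarrow> \<gamma> \<in> B \<Longrightarrow> (\<lambda>i. \<alpha> i + \<gamma> i) \<in> C"
    and "f \<in> mspan \<xi> A" "g \<in> mspan \<xi> B"
  shows "(\<lambda>x. f x * g x) \<in> mspan \<xi> C"
proof -
  obtain c d where "f = lincomb (mon \<xi>) A c" "g = lincomb (mon \<xi>) B d" using assms by auto
  then have "(\<lambda>x. f x * g x) = (\<lambda>x. \<Sum>\<alpha>\<in>A. \<Sum>\<gamma>\<in>B. c \<alpha> * d \<gamma> * mon \<xi> (\<lambda>i. \<alpha> i + \<gamma> i) x)"
    by (simp add: lincomb_mult mon_add)
  then show ?thesis
    using assms(1,2) by (auto intro!: span_sum span_scale span_base)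
qed

text \<open>Abstract in the graded family \<open>P\<close> because \<open>graded_mon\<close> serves
  both inclusions of \<open>poly_space_eq_hspan\<close>: Cartesian monomials as barycentric forms,
  and barycentric monomials as polynomials.\<close>

lemma graded_prod:
  fixes P :: "nat \<Rightarrow> ('x \<Rightarrow> real) set"
  assumes one: "(\<lambda>_. 1) \<in> P 0"
    and mult: "\<And>i j f g. f \<in> P i \<Longrightarrow> g \<in> P j \<Longrightarrow> (\<lambda>x. f x * g x) \<in> P (i + j)"
    and "finite S" "\<And>s. s \<in> S \<Longrightarrow> f s \<in> P (n s)"
  shows "(\<lambda>x. \<Prod>s\<in>S. f s x) \<in> P (\<Sum>s\<in>S. n s)"
  using assms(3,4)
proof (induction S rule: finite_induct)
  case (insert s S)
  then show ?case using mult[of "f s" "n s" "\<lambda>x. \<Prod>s\<in>S. f s x" "\<Sum>s\<in>S. n s"] by simp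
qed (simp add: one)

lemma graded_mon:
  fixes P :: "nat \<Rightarrow> ('x \<Rightarrow> real) set"
  assumes one: "(\<lambda>_. 1) \<in> P 0"
    and mult: "\<And>i j f g. f \<in> P i \<Longrightarrow> g \<in> P j \<Longrightarrow> (\<lambda>x. f x * g x) \<in> P (i + j)"
    and "\<And>i. \<xi> i \<in> P 1"
  shows "mon \<xi> \<alpha> \<in> P (\<Sum>i\<in>UNIV. \<alpha> i)"
proof -
  have "(\<lambda>x. \<xi> i x ^ n) \<in> P n" for i n
  proof (induction n)
    case (Suc n)
    then show ?case using mult[OF assms(3)[of i] Suc] by simp
  qed (simp add: one)
  then show ?thesis
    unfolding mon_def[abs_def] by (intro graded_prod[OF one mult]) auto
qed

lemma finite_bounded_degree: "finite {\<alpha> :: 'i::finite \<Rightarrow> nat. (\<Sum>i\<in>UNIV. \<alpha> i) \<le> m}"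
proof (rule finite_subset)
  show "{\<alpha> :: 'i \<Rightarrow> nat. (\<Sum>i\<in>UNIV. \<alpha> i) \<le> m} \<subseteq> (UNIV \<rightarrow>\<^sub>E {..m})"
  proof
    fix \<alpha> :: "'i \<Rightarrow> nat" assume "\<alpha> \<in> {\<alpha>. (\<Sum>i\<in>UNIV. \<alpha> i) \<le> m}"
    then have "\<alpha> i \<le> m" for i using member_le_sum[of i UNIV \<alpha>] by fastforce
    then show "\<alpha> \<in> UNIV \<rightarrow>\<^sub>E {..m}" by auto
  qed
qed (simp add: finite_PiE)

lemma finite_poly_idx: "finite {\<alpha> :: 'i::finite \<Rightarrow> nat. int (\<Sum>i\<in>UNIV. \<alpha> i) \<le> j}"
  by (rule finite_subset[OF _ finite_bounded_degree[of "nat j"]]) (auto simp del: of_nat_sum)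

text \<open>Degree exactly \<open>j\<close>. The integer index admits \<open>j = k - 2 < 0\<close>,
  where the set is empty and only the zero form remains.\<close>

definition hidx :: "int \<Rightarrow> ('i::finite \<Rightarrow> nat) set" where
  "hidx j = {\<alpha>. int (\<Sum>i\<in>UNIV. \<alpha> i) = j}"

lemma finite_hidx [simp]: "finite (hidx j)"
  unfolding hidx_def by (rule finite_subset[OF _ finite_poly_idx[of j]]) auto

lemma poly_space_eq_mspan:
  "poly_space j = mspan (\<lambda>i x. x $ i) {\<alpha>. int (\<Sum>i\<in>UNIV. \<alpha> i) \<le> j}"
  by (auto simp: poly_space_def lincomb_def[abs_def] mon_def[abs_def])

lemma poly_space_mult:
  assumes "f \<in> poly_space i" "g \<in> poly_space j"
  shows "(\<lambda>x. f x * g x) \<in> poly_space (i + j)"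
  using assms unfolding poly_space_eq_mspan
  by (rule mspan_mult[OF finite_poly_idx, rotated]) (auto simp: sum.distrib)

lemma poly_space_base: "int (\<Sum>i\<in>UNIV. \<alpha> i) \<le> j \<Longrightarrow> mon (\<lambda>i x. x $ i) \<alpha> \<in> poly_space j"
  unfolding poly_space_eq_mspan by (rule span_base[OF finite_poly_idx]) simp

lemma poly_space_const: "0 \<le> j \<Longrightarrow> (\<lambda>x. c) \<in> poly_space j"
  using span_scale[of "mon (\<lambda>i x. x $ i) (\<lambda>_. 0)", OF poly_space_base[of "\<lambda>_. 0" j, unfolded poly_space_eq_mspan], of c]
  unfolding poly_space_eq_mspan by (simp add: mon_def)

lemma poly_space_coord: "(\<lambda>x. x $ i) \<in> poly_space 1"
proof -
  have "mon (\<lambda>i x. x $ i) (\<lambda>l. if l = i then 1 else 0) = (\<lambda>x. x $ i)"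
    by (simp add: mon_def fun_eq_iff if_distrib if_distribR cong: if_cong)
  then show ?thesis
    using poly_space_base[of "\<lambda>l. if l = i then 1 else 0" 1] by simp
qed

lemma poly_space_0: "poly_space 0 = range (\<lambda>c x. c)"
proof -
  have *: "{\<alpha> :: 'n::finite \<Rightarrow> nat. int (\<Sum>i\<in>UNIV. \<alpha> i) \<le> 0} = {\<lambda>_. 0}"
    by (auto simp: fun_eq_iff simp flip: of_nat_sum)
  show ?thesis
  proof
    show "poly_space 0 \<subseteq> range (\<lambda>c x. c)" unfolding poly_space_def * by auto
    show "range (\<lambda>c x. c) \<subseteq> poly_space 0" by (auto simp: poly_space_const)
  qed
qed

section \<open>Quadratic forms on coefficient vectors\<close>

definition bform :: "'i set \<Rightarrow> ('i \<Rightarrow> 'i \<Rightarrow> real) \<Rightarrow> ('i \<Rightarrow> real) \<Rightarrow> ('i \<Rightarrow> real) \<Rightarrow> real" where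
  "bform A m c d = (\<Sum>a\<in>A. \<Sum>b\<in>A. c a * d b * m a b)"

text \<open>Vectors are functions on the whole index type; forcing them to vanish off
  \<open>A\<close> makes them unique, so that \<open>l1_norm\<close> is definite on them. The linear
  constraints \<open>L\<close> will express orthogonality.\<close>

definition coefs :: "'i set \<Rightarrow> ('i \<Rightarrow> real) set \<Rightarrow> ('i \<Rightarrow> real) set" where
  "coefs A L = {c. (\<forall>a. a \<notin> A \<longrightarrow> c a = 0) \<and> (\<forall>l\<in>L. (\<Sum>a\<in>A. c a * l a) = 0)}"

definition l1_norm :: "'i set \<Rightarrow> ('i \<Rightarrow> real) \<Rightarrow> real" where
  "l1_norm A c = (\<Sum>a\<in>A. \<bar>c a\<bar>)"

lemma coefs_lin:
  assumes "c \<in> coefs A L" "d \<in> coefs A L"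
  shows "(\<lambda>a. r * c a + s * d a) \<in> coefs A L"
proof -
  have "(\<Sum>a\<in>A. (r * c a + s * d a) * l a) = r * (\<Sum>a\<in>A. c a * l a) + s * (\<Sum>a\<in>A. d a * l a)" for l
    by (simp add: algebra_simps sum.distrib sum_distrib_left)
  then show ?thesis using assms by (auto simp: coefs_def)
qed

lemma coefs_diff: "c \<in> coefs A L \<Longrightarrow> d \<in> coefs A L \<Longrightarrow> (\<lambda>a. c a - d a) \<in> coefs A L"
  using coefs_lin[of c A L d 1 "-1"] by simp

lemma coefs_zero: "(\<lambda>_. 0) \<in> coefs A L"
  by (simp add: coefs_def)

lemma bform_linear:
  "bform A m c (\<lambda>a. r * d a + s * e a) = r * bform A m c d + s * bform A m c e"
  "bform A m (\<lambda>a. r * d a + s * e a) c = r * bform A m d c + s * bform A m e c"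
  by (simp_all add: bform_def algebra_simps sum.distrib sum_distrib_left)

lemma bform_sym:
  assumes "\<And>a b. m a b = m b a"
  shows "bform A m c d = bform A m d c"
  unfolding bform_def by (subst sum.swap) (simp add: assms mult_ac)

lemma l1_norm_nonneg: "l1_norm A c \<ge> 0"
  by (simp add: l1_norm_def sum_nonneg)

lemma l1_norm_sum_bound:
  assumes "\<And>\<alpha>. \<alpha> \<in> A \<Longrightarrow> \<bar>f \<alpha>\<bar> \<le> F"
  shows "\<bar>\<Sum>\<alpha>\<in>A. c \<alpha> * f \<alpha>\<bar> \<le> l1_norm A c * F"
proof -
  have "\<bar>\<Sum>\<alpha>\<in>A. c \<alpha> * f \<alpha>\<bar> \<le> (\<Sum>\<alpha>\<in>A. \<bar>c \<alpha>\<bar> * \<bar>f \<alpha>\<bar>)"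
    unfolding abs_mult[symmetric] by (rule sum_abs)
  also have "\<dots> \<le> (\<Sum>\<alpha>\<in>A. \<bar>c \<alpha>\<bar> * F)" using assms by (intro sum_mono mult_left_mono) auto
  finally show ?thesis by (simp add: l1_norm_def sum_distrib_right)
qed

lemma l1_norm_eq_0: "finite A \<Longrightarrow> c \<in> coefs A L \<Longrightarrow> l1_norm A c = 0 \<longleftrightarrow> c = (\<lambda>_. 0)"
  by (auto simp: l1_norm_def sum_nonneg_eq_0_iff coefs_def fun_eq_iff)

lemma continuous_on_coord: "continuous_on S (\<lambda>c::'i \<Rightarrow> real. c a)"
  by (rule continuous_on_subset[OF continuous_on_product_coordinates]) simp

text \<open>Tychonoff: the factor is an interval on \<open>A\<close> and \<open>{0}\<close>
  elsewhere, and the constraints cut out a closed set in the topology of pointwise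
  convergence.\<close>

lemma compact_coefs:
  fixes A :: "'i set"
  assumes "finite A"
  shows "compact {c \<in> coefs A L. l1_norm A c \<le> R}"
proof -
  define B where "B = (\<lambda>a::'i. if a \<in> A then {-R..R} else {0})"
  have "compactin (product_topology (\<lambda>_. euclidean) UNIV) (PiE UNIV B)"
    by (subst compactin_PiE) (auto simp: B_def)
  then have "compact (PiE UNIV B)"
    by (simp add: euclidean_product_topology)
  moreover have "{c \<in> coefs A L. l1_norm A c \<le> R} =
      PiE UNIV B \<inter> ((\<Inter>l\<in>L. {c. (\<Sum>a\<in>A. c a * l a) = 0}) \<inter> {c. l1_norm A c \<le> R})" (is "?X = ?Y")
  proof
    show "?X \<subseteq> ?Y"
    proof
      fix c assume c: "c \<in> ?X"
      then have "\<bar>c a\<bar> \<le> R" if "a \<in> A" for a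
        using member_le_sum[of a A "\<lambda>a. \<bar>c a\<bar>"] that assms by (auto simp: l1_norm_def)
      then show "c \<in> ?Y" using c by (fastforce simp: B_def coefs_def abs_le_iff)
    qed
    show "?Y \<subseteq> ?X" by (auto simp: B_def coefs_def PiE_def Pi_def split: if_splits)
  qed
  moreover have "closed ((\<Inter>l\<in>L. {c. (\<Sum>a\<in>A. c a * l a) = 0}) \<inter> {c. l1_norm A c \<le> R})"
    unfolding l1_norm_def
    by (intro closed_Int closed_INT ballI closed_Collect_eq closed_Collect_le continuous_intros
        continuous_on_coord)
  ultimately show ?thesis by (simp add: compact_Int_closed)
qed

lemma continuous_on_bform: "continuous_on S (\<lambda>c. bform A m c c)"
  unfolding bform_def by (intro continuous_intros continuous_on_coord)

lemma continuous_on_l1: "continuous_on S (l1_norm A)"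
  unfolding l1_norm_def[abs_def] by (intro continuous_intros continuous_on_coord)

text \<open>The minimum over the compact unit sphere of \<open>l1_norm\<close> is positive, and both
  sides are homogeneous of degree two.\<close>

lemma bform_coercive:
  assumes A: "finite A" and pos: "\<And>c. c \<in> coefs A L \<Longrightarrow> c \<noteq> (\<lambda>_. 0) \<Longrightarrow> bform A m c c > 0"
  obtains \<kappa> where "\<kappa> > 0" "\<And>c. c \<in> coefs A L \<Longrightarrow> bform A m c c \<ge> \<kappa> * (l1_norm A c)\<^sup>2"
proof -
  define S where "S = {c \<in> coefs A L. l1_norm A c \<le> 1} \<inter> {c. l1_norm A c = 1}"
  have "compact S"
    unfolding S_def by (intro compact_Int_closed compact_coefs A closed_Collect_eq continuous_on_l1) simp
  have scale: "(\<lambda>a. c a / l1_norm A c) \<in> S" if "c \<in> coefs A L" "c \<noteq> (\<lambda>_. 0)" for c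
  proof -
    have "l1_norm A c > 0" using that l1_norm_eq_0[OF A that(1)] l1_norm_nonneg[of A c] by linarith
    moreover have "l1_norm A (\<lambda>a. c a / l1_norm A c) = l1_norm A c / l1_norm A c" if "l1_norm A c > 0"
      using that by (simp add: l1_norm_def sum_divide_distrib[symmetric] abs_divide)
    moreover have "(\<lambda>a. c a / l1_norm A c) \<in> coefs A L"
      using coefs_lin[OF that(1) coefs_zero, of "1 / l1_norm A c" 0] by simp
    ultimately show ?thesis by (simp add: S_def)
  qed
  show ?thesis
  proof (cases "S = {}")
    case True
    \<comment> \<open>An empty sphere leaves the zero vector alone, and any constant serves.\<close>
    then show ?thesis using that[of 1] scale by (force simp: bform_def l1_norm_def)
  next
    case False
    then obtain c0 where c0: "c0 \<in> S" "\<And>c. c \<in> S \<Longrightarrow> bform A m c0 c0 \<le> bform A m c c"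
      using continuous_attains_inf[OF \<open>compact S\<close> _ continuous_on_bform] by metis
    have "c0 \<noteq> (\<lambda>_. 0)" using c0(1) by (auto simp: S_def l1_norm_def)
    then have p: "bform A m c0 c0 > 0" using pos c0(1) by (simp add: S_def)
    show ?thesis
    proof (rule that[OF p])
      fix c assume c: "c \<in> coefs A L"
      show "bform A m c0 c0 * (l1_norm A c)\<^sup>2 \<le> bform A m c c"
      proof (cases "c = (\<lambda>_. 0)")
        case True then show ?thesis by (simp add: bform_def l1_norm_def)
      next
        case False
        have "l1_norm A c \<noteq> 0" using False l1_norm_eq_0[OF A c] by simp
        moreover have "bform A m (\<lambda>a. c a / l1_norm A c) (\<lambda>a. c a / l1_norm A c) = bform A m c c / (l1_norm A c)\<^sup>2"
          by (simp add: bform_def sum_divide_distrib power2_eq_square field_simps)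
        ultimately show ?thesis using c0(2)[OF scale[OF c False]]
          by (simp add: pos_le_divide_eq zero_less_power2)
      qed
    qed
  qed
qed

text \<open>The solution is the minimiser of \<open>bform A m c c - 2 \<Sum>c ff\<close> on the constrained space.\<close>

lemma bform_solve:
  assumes A: "finite A" and sym: "\<And>a b. m a b = m b a" and "\<kappa> > 0"
    and coer: "\<And>c. c \<in> coefs A L \<Longrightarrow> bform A m c c \<ge> \<kappa> * (l1_norm A c)\<^sup>2"
  obtains c where "c \<in> coefs A L" "\<And>d. d \<in> coefs A L \<Longrightarrow> bform A m d c = (\<Sum>a\<in>A. d a * ff a)"
proof -
  define J where "J c = bform A m c c - 2 * (\<Sum>a\<in>A. c a * ff a)" for c
  define M where "M = (\<Sum>a\<in>A. \<bar>ff a\<bar>)"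
  \<comment> \<open>For \<open>t = l1_norm A c > R\<close> coercivity gives
    \<open>J c \<ge> t * (\<kappa> * t - 2 * M) \<ge> 0 = J 0\<close>, so a minimiser over the ball
    of radius \<open>R\<close> is a global one.\<close>
  define R where "R = 2 * M / \<kappa> + 1"
  define S where "S = {c \<in> coefs A L. l1_norm A c \<le> R}"
  have M: "\<bar>\<Sum>a\<in>A. c a * ff a\<bar> \<le> l1_norm A c * M" for c
    unfolding M_def by (intro l1_norm_sum_bound member_le_sum) (auto simp: A)
  have "M \<ge> 0" by (simp add: M_def sum_nonneg)
  then have "R \<ge> 1" using \<open>\<kappa> > 0\<close> by (simp add: R_def)
  have "compact S" unfolding S_def by (rule compact_coefs[OF A])
  moreover have "S \<noteq> {}" using coefs_zero[of A L] \<open>R \<ge> 1\<close> by (auto simp: S_def l1_norm_def intro!: exI[of _ "\<lambda>_. 0"])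
  moreover have "continuous_on S J"
    unfolding J_def[abs_def] by (intro continuous_intros continuous_on_bform continuous_on_coord)
  ultimately obtain c0 where c0: "c0 \<in> S" "\<And>c. c \<in> S \<Longrightarrow> J c0 \<le> J c"
    using continuous_attains_inf by metis
  have min: "J c0 \<le> J c" if c: "c \<in> coefs A L" for c
  proof (cases "l1_norm A c \<le> R")
    case True then show ?thesis using c0(2) c by (simp add: S_def)
  next
    case False
    have "J c0 \<le> J (\<lambda>_. 0)" using c0(2)[of "\<lambda>_. 0"] coefs_zero[of A L] \<open>R \<ge> 1\<close> by (simp add: S_def l1_norm_def)
    also have "\<dots> = 0" by (simp add: J_def bform_def)
    also have "0 \<le> l1_norm A c * (\<kappa> * l1_norm A c - 2 * M)"
    proof (rule mult_nonneg_nonneg[OF l1_norm_nonneg])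
      have "\<kappa> * R \<le> \<kappa> * l1_norm A c" using False \<open>\<kappa> > 0\<close> by simp
      moreover have "\<kappa> * R = 2 * M + \<kappa>" using \<open>\<kappa> > 0\<close> by (simp add: R_def field_simps)
      ultimately show "0 \<le> \<kappa> * l1_norm A c - 2 * M" using \<open>\<kappa> > 0\<close> by linarith
    qed
    also have "\<dots> \<le> J c" using coer[OF c] M[of c] by (simp add: J_def algebra_simps power2_eq_square)
    finally show ?thesis .
  qed
  have c0E: "c0 \<in> coefs A L" using c0 by (simp add: S_def)
  show ?thesis
  proof (rule that[OF c0E])
    fix d assume d: "d \<in> coefs A L"
    define r where "r = bform A m d c0 - (\<Sum>a\<in>A. d a * ff a)"
    have expand: "J (\<lambda>a. c0 a + t * d a) = J c0 + 2 * t * r + t\<^sup>2 * bform A m d d" for t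
      using bform_linear(1)[of A m "\<lambda>a. c0 a + t * d a" 1 c0 t d]
        bform_linear(2)[of A m 1 c0 t d c0] bform_linear(2)[of A m 1 c0 t d d]
        bform_sym[of m A c0 d, OF sym]
      by (simp add: J_def r_def algebra_simps sum.distrib sum_distrib_left power2_eq_square)
    have nonneg: "0 \<le> 2 * t * r + t\<^sup>2 * bform A m d d" for t
      using min[OF coefs_lin[OF c0E d, of 1 t]] expand[of t] by simp
    have "r = 0"
    proof (rule ccontr)
      assume "r \<noteq> 0"
      \<comment> \<open>\<open>D\<close> bounds the curvature along \<open>d\<close>. The value
        \<open>t = - r / D\<close> minimises \<open>2 * t * r + t\<^sup>2 * D\<close>, with the
        negative minimum \<open>- (r\<^sup>2 / D)\<close>.\<close>
      define D where "D = \<bar>bform A m d d\<bar> + 1"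
      have "D > 0" by (simp add: D_def add_nonneg_pos)
      have "0 \<le> 2 * (- r / D) * r + (- r / D)\<^sup>2 * bform A m d d" by (rule nonneg)
      also have "\<dots> \<le> 2 * (- r / D) * r + (- r / D)\<^sup>2 * D"
        by (intro add_left_mono mult_left_mono) (auto simp: D_def)
      also have "\<dots> = - (r\<^sup>2 / D)" using \<open>D > 0\<close> by (simp add: power2_eq_square field_simps)
      finally have "r\<^sup>2 / D \<le> 0" by simp
      then show False using \<open>D > 0\<close> \<open>r \<noteq> 0\<close> by (simp add: divide_le_0_iff)
    qed
    then show "bform A m d c0 = (\<Sum>a\<in>A. d a * ff a)" by (simp add: r_def)
  qed
qed

section \<open>Smooth bump functions\<close>

lemma Ck_continuous: "Ck m f \<Longrightarrow> continuous_on UNIV f"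
  by (cases m) (auto intro: differentiable_imp_continuous_on)

lemma Ck_Suc_imp: "Ck (Suc m) f \<Longrightarrow> Ck m f"
proof (induction m arbitrary: f)
  case 0
  then show ?case by (auto intro: differentiable_imp_continuous_on)
next
  case (Suc m)
  note f = Suc.prems[unfolded Ck.simps(2)[of "Suc m" f], THEN conjunct1]
  note f' = Suc.prems[unfolded Ck.simps(2)[of "Suc m" f], THEN conjunct2]
  have "\<forall>i. Ck m (\<lambda>x. frechet_derivative f (at x) (axis i 1))"
    by (rule allI, rule Suc.IH, rule f'[rule_format])
  with f show ?case unfolding Ck.simps(2)[of m f] by (rule conjI)
qed

lemma Ck_const: "Ck m (\<lambda>x. c)"
  by (induction m arbitrary: c) simp_all

lemma Ck_SucD:
  assumes "Ck (Suc m) f"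
  shows "(f has_derivative frechet_derivative f (at x)) (at x)"
    "Ck m (\<lambda>x. frechet_derivative f (at x) (axis i 1))"
  using assms by (auto simp: differentiable_on_def frechet_derivative_works)

lemma Ck_SucI:
  assumes "\<And>x. (f has_derivative f' x) (at x)" "\<And>i. Ck m (\<lambda>x. f' x (axis i 1))"
  shows "Ck (Suc m) f"
proof -
  have "frechet_derivative f (at x) = f' x" for x
    using frechet_derivative_at[OF assms(1)] by simp
  moreover have "f differentiable_on UNIV"
    using assms(1) unfolding differentiable_on_def differentiable_def by blast
  ultimately show ?thesis using assms(2) by simp
qed

lemma Ck_add: "Ck m f \<Longrightarrow> Ck m g \<Longrightarrow> Ck m (\<lambda>x. f x + g x)"
proof (induction m arbitrary: f g)
  case 0 then show ?case by (simp add: continuous_on_add)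
next
  case (Suc m)
  note d = Ck_SucD[OF Suc.prems(1)] Ck_SucD[OF Suc.prems(2)]
  show ?case
    by (rule Ck_SucI[OF has_derivative_add[OF d(1) d(3)] Suc.IH[OF d(2) d(4)]])
qed

lemma Ck_mult: "Ck m f \<Longrightarrow> Ck m g \<Longrightarrow> Ck m (\<lambda>x. f x * g x)"
proof (induction m arbitrary: f g)
  case 0 then show ?case by (simp add: continuous_on_mult)
next
  case (Suc m)
  show ?case
  proof (rule Ck_SucI)
    show "((\<lambda>x. f x * g x) has_derivative
        (\<lambda>h. f x * frechet_derivative g (at x) h + frechet_derivative f (at x) h * g x)) (at x)" for x
      by (rule has_derivative_mult[OF Ck_SucD(1)[OF Suc.prems(1)] Ck_SucD(1)[OF Suc.prems(2)]])
    show "Ck m (\<lambda>x. f x * frechet_derivative g (at x) (axis i 1) + frechet_derivative f (at x) (axis i 1) * g x)" for i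
      by (rule Ck_add[OF Suc.IH[OF Ck_Suc_imp[OF Suc.prems(1)] Ck_SucD(2)[OF Suc.prems(2)]]
            Suc.IH[OF Ck_SucD(2)[OF Suc.prems(1)] Ck_Suc_imp[OF Suc.prems(2)]]])
  qed
qed

lemma Ck_prod: "finite S \<Longrightarrow> (\<And>s. s \<in> S \<Longrightarrow> Ck m (f s)) \<Longrightarrow> Ck m (\<lambda>x. \<Prod>s\<in>S. f s x)"
  by (induction S rule: finite_induct) (simp_all add: Ck_const Ck_mult)

text \<open>The family P(1/t) exp(-1/t), continued by 0, is closed under differentiation
  (\<open>flat_exp_deriv\<close>). Carrying the polynomial \<open>P\<close> along is what lets
  smoothness be proved by induction on the order.\<close>

definition flat_exp :: "real poly \<Rightarrow> real \<Rightarrow> real" where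
  "flat_exp P t = (if t > 0 then poly P (1 / t) * exp (- (1 / t)) else 0)"

lemma poly_exp_tendsto_0: "((\<lambda>s. poly P s * exp (- s)) \<longlongrightarrow> 0) at_top" for P :: "real poly"
proof -
  have "((\<lambda>s. \<Sum>i\<le>degree P. coeff P i * (s ^ i / exp s)) \<longlongrightarrow> (\<Sum>i\<le>degree P. coeff P i * 0)) at_top"
    by (intro tendsto_sum tendsto_mult tendsto_const tendsto_power_div_exp_0)
  moreover have "(\<Sum>i\<le>degree P. coeff P i * (s ^ i / exp s)) = poly P s * exp (- s)" for s
    by (simp add: poly_altdef exp_minus divide_inverse sum_distrib_right mult.assoc)
  ultimately show ?thesis by simp
qed

text \<open>The quotient is the difference quotient at 0. Under s = 1/t the division by t becomes
  one more power of s, absorbed into the polynomial.\<close>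

lemma flat_exp_tendsto_0: "((\<lambda>t. flat_exp P t / t) \<longlongrightarrow> 0) (at 0)"
proof -
  have "((\<lambda>s. poly ([:0,1:] * P) s * exp (- s)) \<longlongrightarrow> 0) at_top"
    by (rule poly_exp_tendsto_0)
  then have "((\<lambda>t. poly ([:0,1:] * P) (inverse t) * exp (- inverse t)) \<longlongrightarrow> 0) (at_right 0)"
    by (rule filterlim_compose[OF _ filterlim_inverse_at_top_right])
  then have "((\<lambda>t. flat_exp P t / t) \<longlongrightarrow> 0) (at_right 0)"
  proof (rule Lim_transform_eventually)
    have "poly ([:0,1:] * P) (inverse t) * exp (- inverse t) = flat_exp P t / t" if "t > 0" for t
      using that by (simp add: flat_exp_def divide_inverse)
    then show "\<forall>\<^sub>F t in at_right 0. poly ([:0,1:] * P) (inverse t) * exp (- inverse t) = flat_exp P t / t"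
      by (intro eventually_at_rightI[of 0 1]) auto
  qed
  moreover have "((\<lambda>t. flat_exp P t / t) \<longlongrightarrow> 0) (at_left 0)"
    by (rule Lim_transform_eventually[OF tendsto_const])
       (rule eventually_at_leftI[of "-1"], auto simp: flat_exp_def)
  ultimately show ?thesis by (simp add: filterlim_split_at_real)
qed

lemma flat_exp_deriv: "(flat_exp P has_real_derivative flat_exp ([:0,0,1:] * (P - pderiv P)) t) (at t)"
proof -
  consider "t > 0" | "t < 0" | "t = 0" by linarith
  then show ?thesis
  proof cases
    case 1
    have "((\<lambda>t. poly P (1 / t) * exp (- (1 / t))) has_real_derivative
        flat_exp ([:0,0,1:] * (P - pderiv P)) t) (at t)"
      using 1 by (auto intro!: derivative_eq_intros simp: flat_exp_def field_simps power2_eq_square)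
    then show ?thesis
      by (rule has_field_derivative_transform_within_open[where S = "{0<..}"]) (use 1 in \<open>auto simp: flat_exp_def\<close>)
  next
    case 2
    have "((\<lambda>t. 0) has_real_derivative 0) (at t)" by simp
    then have "(flat_exp P has_real_derivative 0) (at t)"
      by (rule has_field_derivative_transform_within_open[where S = "{..<0}"]) (use 2 in \<open>auto simp: flat_exp_def\<close>)
    then show ?thesis using 2 by (simp add: flat_exp_def)
  next
    case 3
    then show ?thesis using flat_exp_tendsto_0[of P] by (simp add: has_field_derivative_iff flat_exp_def)
  qed
qed

lemma Ck_flat_exp: "Ck m (\<lambda>x::real^'n. flat_exp P (c * (x $ i) + d))"
proof (induction m arbitrary: P)
  case 0
  have "continuous_on UNIV (flat_exp P)"
    by (intro continuous_at_imp_continuous_on ballI DERIV_isCont[OF flat_exp_deriv])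
  then show ?case
    unfolding Ck.simps by (rule continuous_on_compose2) (auto intro!: continuous_intros)
next
  case (Suc m)
  define Q where "Q = [:0,0,1:] * (P - pderiv P)"
  have der: "((\<lambda>x::real^'n. flat_exp P (c * (x $ i) + d)) has_derivative
      (\<lambda>h. flat_exp Q (c * (x $ i) + d) * (c * (h $ i)))) (at x)" for x
  proof -
    have "((\<lambda>x::real^'n. x $ i) has_derivative (\<lambda>h. h $ i)) (at x)"
      by (rule bounded_linear_imp_has_derivative[OF bounded_linear_vec_nth])
    then have "((\<lambda>x::real^'n. c * (x $ i) + d) has_derivative (\<lambda>h. c * (h $ i))) (at x)"
      by (intro has_derivative_add_const has_derivative_mult_right)
    from has_derivative_compose[OF this flat_exp_deriv[of P "c * (x $ i) + d", unfolded has_field_derivative_def]]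
    show ?thesis by (simp add: Q_def)
  qed
  then show ?case by (rule Ck_SucI) (intro Ck_mult Ck_const Suc)
qed

text \<open>A smooth approximation of the indicator of the open box: inside, each factor is exp(-1 /
  ((m + 1) d)) with d the distance to one face, and it tends to 1 as m grows; outside, some factor
  is 0. The arguments have the shape \<open>c * (x $ i) + d\<close> demanded by
  \<open>Ck_flat_exp\<close>.\<close>

definition bump :: "nat \<Rightarrow> real^'n \<Rightarrow> real^'n \<Rightarrow> real^'n \<Rightarrow> real" where
  "bump m a b x = (\<Prod>i\<in>UNIV. flat_exp 1 (real (Suc m) * (x $ i) + - real (Suc m) * a $ i)
                        * flat_exp 1 (- real (Suc m) * (x $ i) + real (Suc m) * b $ i))"

lemma bump_support:
  assumes "bump m a b x \<noteq> 0"
  shows "x \<in> box a b"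
proof -
  define c where "c = real (Suc m)"
  have "c > 0" by (simp add: c_def)
  have pos: "t > 0" if "flat_exp 1 t \<noteq> 0" for t using that by (auto simp: flat_exp_def split: if_splits)
  have "x $ i > a $ i \<and> b $ i > x $ i" for i
  proof -
    have "flat_exp 1 (c * (x $ i) + - c * a $ i) * flat_exp 1 (- c * (x $ i) + c * b $ i) \<noteq> 0"
    proof
      assume z: "flat_exp 1 (c * (x $ i) + - c * a $ i) * flat_exp 1 (- c * (x $ i) + c * b $ i) = 0"
      have "bump m a b x = 0"
        unfolding bump_def c_def[symmetric] by (rule prod_zero[OF finite], rule bexI[where x = i], rule z, rule UNIV_I)
      then show False using assms by simp
    qed
    then have "flat_exp 1 (c * (x $ i) + - c * a $ i) \<noteq> 0" "flat_exp 1 (- c * (x $ i) + c * b $ i) \<noteq> 0"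
      unfolding mult_eq_0_iff by blast+
    then have "c * (x $ i) + - c * a $ i > 0" "- c * (x $ i) + c * b $ i > 0"
      using pos by blast+
    then have "c * a $ i < c * x $ i" "c * x $ i < c * b $ i" by linarith+
    then show ?thesis using \<open>c > 0\<close> by simp
  qed
  then show ?thesis by (simp add: mem_box_cart)
qed

lemma test_function_bump:
  assumes "cbox a b \<subseteq> U"
  shows "test_function U (bump m a b :: real^'n \<Rightarrow> real)"
proof -
  have "Ck k (bump m a b)" for k
    unfolding bump_def[abs_def] by (intro Ck_prod Ck_mult Ck_flat_exp) simp
  moreover have "closure {x. bump m a b x \<noteq> 0} \<subseteq> cbox a b"
    using bump_support box_subset_cbox by (intro closure_minimal) (auto, blast)
  moreover have "compact (closure {x. bump m a b x \<noteq> 0})"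
    using calculation(2) bounded_cbox bounded_subset compact_eq_bounded_closed by blast
  ultimately show ?thesis using assms by (auto simp: test_function_def)
qed

lemma bump_bounds: "0 \<le> bump m a b x" "bump m a b x \<le> 1"
  by (auto simp: bump_def flat_exp_def intro!: prod_nonneg prod_le_1 mult_le_one)

lemma bump_tendsto: "(\<lambda>m. bump m a b x) \<longlonglongrightarrow> indicator (box a b) x"
proof (cases "x \<in> box a b")
  case True
  have e: "(\<lambda>m. flat_exp 1 (real (Suc m) * t)) \<longlonglongrightarrow> 1" if "t > 0" for t :: real
  proof -
    have "(\<lambda>m. exp (- ((1 / t) * inverse (real (Suc m))))) \<longlonglongrightarrow> exp (- ((1 / t) * 0))"
      by (intro tendsto_intros LIMSEQ_inverse_real_of_nat)
    moreover have "flat_exp 1 (real (Suc m) * t) = exp (- ((1 / t) * inverse (real (Suc m))))" for m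
      using that by (simp add: flat_exp_def field_simps add_pos_nonneg)
    ultimately show ?thesis by simp
  qed
  have "(\<lambda>m. bump m a b x) \<longlonglongrightarrow> (\<Prod>i\<in>(UNIV::'a set). 1 * 1)"
    unfolding bump_def
  proof (intro tendsto_prod tendsto_mult)
    fix i
    have "x $ i - a $ i > 0" "b $ i - x $ i > 0" using True by (auto simp: mem_box_cart)
    note e = this[THEN e]
    have eq: "real (Suc m) * x $ i + - real (Suc m) * a $ i = real (Suc m) * (x $ i - a $ i)"
      "- real (Suc m) * x $ i + real (Suc m) * b $ i = real (Suc m) * (b $ i - x $ i)" for m
      unfolding right_diff_distrib by linarith+
    show "(\<lambda>m. flat_exp 1 (real (Suc m) * x $ i + - real (Suc m) * a $ i)) \<longlonglongrightarrow> 1"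
      "(\<lambda>m. flat_exp 1 (- real (Suc m) * x $ i + real (Suc m) * b $ i)) \<longlonglongrightarrow> 1"
      unfolding eq by (rule e)+
  qed
  then show ?thesis using True by simp
next
  case False
  then have "bump m a b x = 0" for m using bump_support by blast
  then show ?thesis using False by simp
qed

section \<open>Weak directional derivatives\<close>

lemma integral_lebesgue_on:
  fixes f :: "'a::euclidean_space \<Rightarrow> real"
  assumes "S \<in> sets lebesgue"
  shows "(LINT x|lebesgue_on S. f x) = (LINT x|lebesgue. indicator S x * f x)"
  using integral_restrict_space[of S lebesgue f] assms by simp

lemma integrable_lebesgue_on:
  fixes f :: "'a::euclidean_space \<Rightarrow> real"
  assumes "S \<in> sets lebesgue"
  shows "integrable (lebesgue_on S) f \<longleftrightarrow> integrable lebesgue (\<lambda>x. indicator S x * f x)"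
  using integrable_restrict_space[of S lebesgue f] assms by simp

text \<open>Open boxes are closed under intersection and generate the Borel sets, so the Dynkin
  argument carries vanishing integrals from boxes to all Borel parts of \<open>box u v\<close>.
  Lebesgue sets differ from Borel sets by null sets, and a density with zero integral over every
  measurable set is zero.\<close>

lemma box_integrals_zero_imp_AE:
  fixes h :: "'a::euclidean_space \<Rightarrow> real"
  assumes h: "integrable lebesgue h"
    and box: "\<And>c d. cbox c d \<subseteq> cbox u v \<Longrightarrow> (LINT x:box c d|lebesgue. h x) = 0"
  shows "AE x in lebesgue. x \<in> box u v \<longrightarrow> h x = 0"
proof -
  define B where "B = box u v"
  have B: "B \<in> sets lebesgue" by (simp add: B_def)
  have int: "set_integrable lebesgue A h" if "A \<in> sets lebesgue" for A
    using integrable_mult_indicator[OF that h] by (simp add: set_integrable_def)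
  have zeroB: "(LINT x:B|lebesgue. h x) = 0" unfolding B_def by (rule box) simp
  have borel: "(LINT x:(A \<inter> B)|lebesgue. h x) = 0" if "A \<in> sets borel" for A
  proof -
    have "Int_stable (range (\<lambda>(a, b). box a b :: 'a set))"
      by (auto simp: Int_stable_def box_Int_box)
    moreover have "range (\<lambda>(a, b). box a b :: 'a set) \<subseteq> Pow UNIV" by simp
    moreover have "A \<in> sigma_sets UNIV (range (\<lambda>(a, b). box a b))"
      using that by (simp add: borel_eq_box)
    ultimately show ?thesis
    proof (induction A rule: sigma_sets_induct_disjoint)
      case (basic A)
      then obtain a b where A: "A = box a b" by auto
      obtain c d where cd: "A \<inter> B = box c d" unfolding A B_def box_Int_box by blast
      show ?case
      proof (cases "box c d = {}")
        case True then show ?thesis unfolding cd by (simp add: set_lebesgue_integral_def)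
      next
        case False
        then have "cbox c d = closure (box c d)" by simp
        also have "\<dots> \<subseteq> cbox u v"
          using cd B_def box_subset_cbox by (intro closure_minimal) auto
        finally show ?thesis using cd box by simp
      qed
    next
      case empty show ?case by (simp add: set_lebesgue_integral_def)
    next
      case (compl A)
      have A: "A \<in> sets lebesgue" using compl by (simp add: borel_eq_box)
      have "(LINT x:((A \<inter> B) \<union> ((UNIV - A) \<inter> B))|lebesgue. h x)
          = (LINT x:(A \<inter> B)|lebesgue. h x) + (LINT x:((UNIV - A) \<inter> B)|lebesgue. h x)"
        using A B by (intro set_integral_Un int) auto
      moreover have "(A \<inter> B) \<union> ((UNIV - A) \<inter> B) = B" by auto
      ultimately show ?case using compl zeroB by simp
    next
      case (union A)
      have "A i \<in> sets borel" for i using union(2) by (auto simp: borel_eq_box)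
      then have A: "A i \<in> sets lebesgue" for i by simp
      have "(LINT x:(\<Union>i. A i \<inter> B)|lebesgue. h x) = (\<Sum>i. (LINT x:(A i \<inter> B)|lebesgue. h x))"
        using A B union(1) by (intro lebesgue_integral_countable_add int) (auto simp: disjoint_family_on_def)
      then show ?case using union by (simp add: Int_UN_distrib2)
    qed
  qed
  have leb: "(LINT x:A|lebesgue. indicator B x * h x) = 0" if A_leb: "A \<in> sets lebesgue" for A
  proof -
    obtain S N N' where A: "A = S \<union> N" "N \<subseteq> N'" "N' \<in> null_sets lborel" "S \<in> sets lborel"
      using sets_completionE[OF A_leb] by blast
    have "AE x in lebesgue. x \<notin> N'" using A(3) by (intro AE_not_in null_sets_completionI)
    then have "AE x in lebesgue. indicator A x * (indicator B x * h x) = indicator (S \<inter> B) x * h x"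
      by eventually_elim (use A in \<open>auto simp: indicator_def\<close>)
    then have "(LINT x|lebesgue. indicator A x * (indicator B x * h x)) = (LINT x|lebesgue. indicator (S \<inter> B) x * h x)"
      using A A_leb B h by (intro integral_cong_AE) (auto intro!: borel_measurable_times borel_measurable_indicator)
    then show ?thesis using borel[of S] A(4) by (simp add: set_lebesgue_integral_def)
  qed
  have "AE x in lebesgue. indicator B x * h x = 0"
    by (rule density_unique_real)
       (use integrable_mult_indicator[OF B h] leb in \<open>auto simp: set_lebesgue_integral_def\<close>)
  then show ?thesis by eventually_elim (auto simp: B_def)
qed

text \<open>Dominated convergence along the bumps makes the integral over each box in the interior
  vanish. The interior is a countable union of closed boxes, and the rest of \<open>K\<close> lies
  in the negligible frontier.\<close>

lemma fundamental_lemma: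
  fixes h :: "real^'n \<Rightarrow> real"
  assumes K: "K \<in> sets lebesgue" "negligible (frontier K)" and h: "integrable (lebesgue_on K) h"
    and zero: "\<And>\<phi>. test_function (interior K) \<phi> \<Longrightarrow> (LINT x|lebesgue_on K. h x * \<phi> x) = 0"
  shows "AE x in lebesgue_on K. h x = 0"
proof -
  define H where "H x = indicator K x * h x" for x
  have H: "integrable lebesgue H" unfolding H_def using h K by (simp add: integrable_lebesgue_on)
  have box: "(LINT x:box a b|lebesgue. H x) = 0" if ab: "cbox a b \<subseteq> interior K" for a b
  proof -
    have meas: "bump m a b \<in> borel_measurable lebesgue" for m
    proof -
      have "continuous_on UNIV (bump m a b)"
        using test_function_bump[OF ab, of m] Ck_continuous by (auto simp: test_function_def)
      then show ?thesis by (simp add: borel_measurable_continuous_onI measurable_completion)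
    qed
    have "(\<lambda>m. LINT x|lebesgue. bump m a b x * H x) \<longlonglongrightarrow> (LINT x|lebesgue. indicator (box a b) x * H x)"
    proof (rule integral_dominated_convergence[where w = "\<lambda>x. \<bar>H x\<bar>"])
      show "(\<lambda>x. indicator (box a b) x * H x) \<in> borel_measurable lebesgue"
        using H by (intro borel_measurable_times borel_measurable_indicator) auto
      show "(\<lambda>x. bump m a b x * H x) \<in> borel_measurable lebesgue" for m
        using H meas by auto
      show "integrable lebesgue (\<lambda>x. \<bar>H x\<bar>)" using H by simp
      show "AE x in lebesgue. (\<lambda>m. bump m a b x * H x) \<longlonglongrightarrow> indicator (box a b) x * H x"
        by (intro AE_I2 tendsto_mult bump_tendsto tendsto_const)
      show "AE x in lebesgue. norm (bump m a b x * H x) \<le> \<bar>H x\<bar>" for m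
        using bump_bounds[of m a b] by (auto simp: abs_mult intro!: mult_left_le_one_le)
    qed
    moreover have "(LINT x|lebesgue. bump m a b x * H x) = 0" for m
      using zero[OF test_function_bump[OF ab], of m] K
      by (simp add: integral_lebesgue_on H_def mult_ac)
    ultimately show ?thesis by (simp add: set_lebesgue_integral_def LIMSEQ_const_iff)
  qed
  obtain D where D: "countable D" "D \<subseteq> Pow (interior K)" "\<And>X. X \<in> D \<Longrightarrow> \<exists>a b. X = cbox a b"
      "\<Union>D = interior K"
    using open_countable_Union_open_cbox[OF open_interior] by metis
  have "AE x in lebesgue. \<forall>X\<in>D. x \<in> X \<longrightarrow> H x = 0"
  proof (subst AE_ball_countable[OF D(1)], rule ballI)
    fix X assume "X \<in> D"
    then obtain a b where X: "X = cbox a b" "cbox a b \<subseteq> interior K" using D by blast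
    have "AE x in lebesgue. x \<in> box a b \<longrightarrow> H x = 0"
      using box X by (intro box_integrals_zero_imp_AE H) blast
    moreover have "AE x in lebesgue. x \<notin> cbox a b - box a b"
      using negligible_frontier_interval[of a b] by (intro AE_not_in) (simp add: negligible_iff_null_sets)
    ultimately show "AE x in lebesgue. x \<in> X \<longrightarrow> H x = 0"
      unfolding X by eventually_elim auto
  qed
  moreover have "AE x in lebesgue. x \<notin> frontier K"
    using K(2) by (intro AE_not_in) (simp add: negligible_iff_null_sets)
  ultimately have "AE x in lebesgue. x \<in> K \<longrightarrow> h x = 0"
  proof eventually_elim
    case (elim x)
    show ?case
    proof
      assume "x \<in> K"
      then have "x \<in> interior K" using elim(2) closure_subset by (auto simp: frontier_def)
      then have "H x = 0" using elim(1) D(4) by blast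
      then show "h x = 0" using \<open>x \<in> K\<close> by (simp add: H_def)
    qed
  qed
  then show ?thesis using K by (subst AE_restrict_space_iff) auto
qed

text \<open>Differentiability is asked for along \<open>\<beta>\<close> only, which is all that
  integration by parts in that direction uses. Since \<open>f\<close> determines \<open>g\<close>
  (\<open>dirC1_unique\<close>), two expressions for the same derivative can be equated without
  computing either.\<close>

definition dirC1 :: "'a::euclidean_space \<Rightarrow> ('a \<Rightarrow> real) \<Rightarrow> ('a \<Rightarrow> real) \<Rightarrow> bool" where
  "dirC1 \<beta> f g \<longleftrightarrow> continuous_on UNIV f \<and> continuous_on UNIV g \<and>
     (\<forall>x. ((\<lambda>t. f (x + t *\<^sub>R \<beta>)) has_real_derivative g x) (at 0))"

lemma dirC1_add:
  assumes "dirC1 \<beta> f f'" "dirC1 \<beta> g g'"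
  shows "dirC1 \<beta> (\<lambda>x. f x + g x) (\<lambda>x. f' x + g' x)"
  using assms by (auto simp: dirC1_def intro!: continuous_on_add DERIV_add)

lemma dirC1_mult:
  assumes "dirC1 \<beta> f f'" "dirC1 \<beta> g g'"
  shows "dirC1 \<beta> (\<lambda>x. f x * g x) (\<lambda>x. f' x * g x + f x * g' x)"
  using assms unfolding dirC1_def
  by (auto intro!: continuous_on_add continuous_on_mult derivative_eq_intros)

lemma dirC1_const: "dirC1 \<beta> (\<lambda>x. c) (\<lambda>x. 0)"
  by (simp add: dirC1_def)

lemma dirC1_scale:
  assumes "dirC1 \<beta> f f'"
  shows "dirC1 \<beta> (\<lambda>x. c * f x) (\<lambda>x. c * f' x)"
  using dirC1_mult[OF dirC1_const assms, of c] by simp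

lemma dirC1_sum:
  assumes "\<And>s. s \<in> S \<Longrightarrow> dirC1 \<beta> (f s) (f' s)"
  shows "dirC1 \<beta> (\<lambda>x. \<Sum>s\<in>S. f s x) (\<lambda>x. \<Sum>s\<in>S. f' s x)"
  using assms by (induction S rule: infinite_finite_induct) (auto intro: dirC1_const dirC1_add)

lemma dirC1_unique: "dirC1 \<beta> f g \<Longrightarrow> dirC1 \<beta> f g' \<Longrightarrow> g = g'"
  by (auto simp: dirC1_def fun_eq_iff intro: DERIV_unique)

lemma dirC1_deriv:
  assumes "dirC1 \<beta> f g"
  shows "((\<lambda>t. f (x + t *\<^sub>R \<beta>)) has_real_derivative g (x + s *\<^sub>R \<beta>)) (at s)"
proof -
  have "((\<lambda>t. f ((x + s *\<^sub>R \<beta>) + t *\<^sub>R \<beta>)) has_real_derivative g (x + s *\<^sub>R \<beta>)) (at 0)"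
    using assms by (simp add: dirC1_def)
  moreover have "f ((x + s *\<^sub>R \<beta>) + t *\<^sub>R \<beta>) = f (x + (t + s) *\<^sub>R \<beta>)" for t
    by (simp add: algebra_simps)
  ultimately show ?thesis
    using DERIV_shift[of "\<lambda>t. f (x + t *\<^sub>R \<beta>)" "g (x + s *\<^sub>R \<beta>)" 0 s] by simp
qed

lemma dirC1_zero_outside:
  assumes F: "dirC1 \<beta> F F'" and C: "closed C" and 0: "\<And>x. x \<notin> C \<Longrightarrow> F x = 0" and x: "x \<notin> C"
  shows "F' x = 0"
proof -
  have "((\<lambda>t. F (x + t *\<^sub>R \<beta>)) has_real_derivative 0) (at 0)"
  proof (rule has_field_derivative_transform_within_open)
    show "((\<lambda>t. 0) has_real_derivative 0) (at (0::real))" by simp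
    show "open ((\<lambda>t. x + t *\<^sub>R \<beta>) -` (- C))"
      using C by (intro open_vimage continuous_intros) auto
  qed (use x 0 in auto)
  moreover have "((\<lambda>t. F (x + t *\<^sub>R \<beta>)) has_real_derivative F' x) (at 0)"
    using F by (simp add: dirC1_def)
  ultimately show ?thesis by (rule DERIV_unique[symmetric])
qed

lemma bounded_on_compact:
  fixes f :: "'a::euclidean_space \<Rightarrow> real"
  assumes "compact K" "continuous_on UNIV f"
  obtains B where "\<And>x. x \<in> K \<Longrightarrow> norm (f x) \<le> B"
proof -
  have "compact (f ` K)"
    by (rule compact_continuous_image[OF continuous_on_subset[OF assms(2) subset_UNIV] assms(1)])
  from compact_imp_bounded[OF this] show ?thesis using that by (auto simp: bounded_iff)
qed

lemma integrable_compact_support: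
  fixes F :: "'a::euclidean_space \<Rightarrow> real"
  assumes F: "continuous_on UNIV F" and C: "compact C" and 0: "\<And>x. x \<notin> C \<Longrightarrow> F x = 0"
  shows "integrable lborel F"
proof -
  obtain B where "\<And>x. x \<in> C \<Longrightarrow> norm (F x) \<le> B"
    using bounded_on_compact[OF C F] by blast
  then show ?thesis
    using C F 0 emeasure_compact_finite[OF C]
    by (intro integrableI_bounded_set[where A = C and B = B])
       (auto simp: compact_imp_closed borel_measurable_continuous_onI)
qed

text \<open>Translation invariance of Lebesgue measure makes the difference quotients of \<open>F\<close> have integral
  zero.\<close>

lemma integral_dirC1_zero:
  fixes F :: "'a::euclidean_space \<Rightarrow> real"
  assumes F: "dirC1 \<beta> F F'" and C: "compact C" and 0: "\<And>x. x \<notin> C \<Longrightarrow> F x = 0"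
  shows "integrable lborel F'" "(LINT x|lborel. F' x) = 0"
proof -
  have cont: "continuous_on UNIV F" "continuous_on UNIV F'" using F by (auto simp: dirC1_def)
  have F'0: "F' x = 0" if "x \<notin> C" for x
    using dirC1_zero_outside[OF F compact_imp_closed[OF C] 0 that] .
  obtain B0 where B0: "\<And>x. x \<in> C \<Longrightarrow> norm (F' x) \<le> B0"
    using bounded_on_compact[OF C cont(2)] by blast
  define B where "B = max B0 0"
  have B: "\<bar>F' x\<bar> \<le> B" for x using B0[of x] F'0[of x] by (cases "x \<in> C") (auto simp: B_def)
  \<comment> \<open>\<open>C'\<close> collects the points whose segment from x to x + beta meets
    \<open>C\<close>. All difference quotients vanish off this one compact set, so \<open>B\<close>
    on it dominates them by the mean value theorem.\<close>
  define C' where "C' = (\<lambda>(y, t). y - t *\<^sub>R \<beta>) ` (C \<times> {0..1::real})"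
  have C': "compact C'" unfolding C'_def
    by (intro compact_continuous_image compact_Times C)
       (auto simp: case_prod_unfold intro!: continuous_intros)
  define s where "s n x = (F (x + (1 / real (Suc n)) *\<^sub>R \<beta>) - F x) / (1 / real (Suc n))" for n x
  have intF: "integrable lborel F" by (rule integrable_compact_support[OF cont(1) C 0])
  have shift: "has_bochner_integral lborel (\<lambda>x. F (c + x)) (LINT x|lborel. F x)" for c
  proof -
    have [measurable]: "F \<in> borel_measurable borel" using cont(1) by (rule borel_measurable_continuous_onI)
    have "integrable (distr lborel borel ((+) c)) F" "integral\<^sup>L (distr lborel borel ((+) c)) F = integral\<^sup>L lborel F"
      using intF by (simp_all add: lborel_distr_plus)
    then show ?thesis
      by (simp add: has_bochner_integral_iff integrable_distr_eq integral_distr)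
  qed
  have int_s: "(LINT x|lborel. s n x) = 0" for n
  proof -
    have "has_bochner_integral lborel (\<lambda>x. F (x + (1 / real (Suc n)) *\<^sub>R \<beta>) - F x) (integral\<^sup>L lborel F - integral\<^sup>L lborel F)"
      using shift[of "(1 / real (Suc n)) *\<^sub>R \<beta>"] intF
      by (intro has_bochner_integral_diff has_bochner_integral_integrable) (simp_all add: add.commute)
    then show ?thesis unfolding s_def by (simp add: has_bochner_integral_integral_eq)
  qed
  have bound: "norm (s n x) \<le> B * indicator C' x" for n x
  proof (cases "x \<in> C'")
    case True
    define d where "d = 1 / real (Suc n)"
    have "d > 0" by (simp add: d_def)
    obtain z where "0 < z" "z < d" "F (x + d *\<^sub>R \<beta>) - F (x + 0 *\<^sub>R \<beta>) = (d - 0) * F' (x + z *\<^sub>R \<beta>)"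
      using MVT2[OF \<open>d > 0\<close>, of "\<lambda>t. F (x + t *\<^sub>R \<beta>)" "\<lambda>t. F' (x + t *\<^sub>R \<beta>)"] dirC1_deriv[OF F] by blast
    then have "s n x = F' (x + z *\<^sub>R \<beta>)" using \<open>d > 0\<close> unfolding s_def d_def[symmetric] by simp
    then show ?thesis using B True by simp
  next
    case False
    have "F x = 0"
    proof (rule 0, rule notI)
      assume "x \<in> C" then have "x \<in> C'" unfolding C'_def by (intro image_eqI[of _ _ "(x, 0)"]) auto
      with False show False ..
    qed
    moreover have "F (x + (1 / real (Suc n)) *\<^sub>R \<beta>) = 0"
    proof (rule 0, rule notI)
      assume "x + (1 / real (Suc n)) *\<^sub>R \<beta> \<in> C"
      then have "x \<in> C'" unfolding C'_def
        by (intro image_eqI[of _ _ "(x + (1 / real (Suc n)) *\<^sub>R \<beta>, 1 / real (Suc n))"]) auto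
      with False show False ..
    qed
    ultimately show ?thesis using False by (simp add: s_def)
  qed
  have lim: "(\<lambda>n. s n x) \<longlonglongrightarrow> F' x" for x
  proof -
    have "((\<lambda>h. (F (x + (0 + h) *\<^sub>R \<beta>) - F (x + 0 *\<^sub>R \<beta>)) / h) \<longlongrightarrow> F' x) (at 0)"
      using F unfolding dirC1_def DERIV_def by blast
    moreover have "filterlim (\<lambda>n. 1 / real (Suc n)) (at 0) sequentially"
      using LIMSEQ_inverse_real_of_nat by (auto simp: filterlim_at inverse_eq_divide)
    ultimately have "(\<lambda>n. (F (x + (0 + 1 / real (Suc n)) *\<^sub>R \<beta>) - F (x + 0 *\<^sub>R \<beta>)) / (1 / real (Suc n))) \<longlonglongrightarrow> F' x"
      by (rule filterlim_compose)
    then show ?thesis by (simp add: s_def)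
  qed
  have s_cont: "continuous_on UNIV (s n)" for n
    unfolding s_def[abs_def]
    by (intro continuous_on_divide continuous_on_diff continuous_on_compose2[OF cont(1)] cont continuous_intros) auto
  have dom: "F' \<in> borel_measurable lborel" "\<And>n. s n \<in> borel_measurable lborel"
      "integrable lborel (\<lambda>x. B * indicator C' x)"
      "AE x in lborel. (\<lambda>n. s n x) \<longlonglongrightarrow> F' x" "\<And>n. AE x in lborel. norm (s n x) \<le> B * indicator C' x"
    using cont s_cont C' emeasure_compact_finite[OF C'] lim bound
    by (auto simp: borel_measurable_continuous_onI compact_imp_closed)
  show "integrable lborel F'" by (rule integrable_dominated_convergence[OF dom])
  have "(\<lambda>n. LINT x|lborel. s n x) \<longlonglongrightarrow> (LINT x|lborel. F' x)"
    by (rule integral_dominated_convergence[OF dom])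
  then show "(LINT x|lborel. F' x) = 0" by (simp add: int_s LIMSEQ_const_iff)
qed

lemma dirC1_test_function:
  assumes "test_function U \<phi>"
  shows "dirC1 \<beta> \<phi> (\<lambda>x. frechet_derivative \<phi> (at x) \<beta>)"
proof -
  have "Ck 1 \<phi>" using assms by (simp add: test_function_def)
  then have "Ck (Suc 0) \<phi>" by simp
  note d = Ck_SucD[OF this]
  have "frechet_derivative \<phi> (at x) \<beta> = (\<Sum>i\<in>UNIV. \<beta> $ i * frechet_derivative \<phi> (at x) (axis i 1))" for x
  proof -
    interpret bounded_linear "frechet_derivative \<phi> (at x)" using d(1) by (rule has_derivative_bounded_linear)
    have "\<beta> = (\<Sum>i\<in>UNIV. \<beta> $ i *\<^sub>R axis i 1)"
      using basis_expansion[of \<beta>] by (simp add: scalar_mult_eq_scaleR)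
    then have "frechet_derivative \<phi> (at x) \<beta> = frechet_derivative \<phi> (at x) (\<Sum>i\<in>UNIV. \<beta> $ i *\<^sub>R axis i 1)"
      by (rule arg_cong)
    then show ?thesis by (simp add: sum scaleR)
  qed
  then have "continuous_on UNIV (\<lambda>x. frechet_derivative \<phi> (at x) \<beta>)"
    using d(2) by (auto intro!: continuous_intros)
  moreover have "continuous_on UNIV \<phi>" using assms Ck_continuous by (auto simp: test_function_def)
  moreover have "((\<lambda>t. \<phi> (x + t *\<^sub>R \<beta>)) has_real_derivative frechet_derivative \<phi> (at x) \<beta>) (at 0)" for x
  proof -
    have "((\<lambda>t. x + t *\<^sub>R \<beta>) has_derivative (\<lambda>t. t *\<^sub>R \<beta>)) (at 0)"
      by (auto intro!: derivative_eq_intros)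
    then have "((\<lambda>t. \<phi> (x + t *\<^sub>R \<beta>)) has_derivative (\<lambda>t. frechet_derivative \<phi> (at x) (t *\<^sub>R \<beta>))) (at 0)"
      by (rule has_derivative_compose) (simp add: d(1))
    moreover have "frechet_derivative \<phi> (at x) (t *\<^sub>R \<beta>) = frechet_derivative \<phi> (at x) \<beta> * t" for t
      using linear_scale[OF bounded_linear.linear[OF has_derivative_bounded_linear[OF d(1)]]] by simp
    ultimately show ?thesis by (simp add: has_field_derivative_def)
  qed
  ultimately show ?thesis by (simp add: dirC1_def)
qed

section \<open>Distributional derivatives on a compact set and the pairing D_K\<close>

lemma integrable_mult_continuous:
  fixes f v :: "real^'n \<Rightarrow> real"
  assumes "compact K" "continuous_on UNIV f" "integrable (lebesgue_on K) v"
  shows "integrable (lebesgue_on K) (\<lambda>x. f x * v x)"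
proof -
  have K: "K \<in> sets lebesgue" using assms(1) by (simp add: compact_imp_closed)
  obtain B where B: "\<And>x. x \<in> K \<Longrightarrow> norm (f x) \<le> B"
    using bounded_on_compact[OF assms(1,2)] by blast
  have "f \<in> borel_measurable (lebesgue_on K)"
    using assms K by (intro continuous_imp_measurable_on_sets_lebesgue) (auto intro: continuous_on_subset)
  then show ?thesis
    by (intro Bochner_Integration.integrable_bound[OF integrable_mult_right[OF assms(3), of B]])
       (use assms(3) K B in \<open>auto simp: abs_mult intro!: AE_I2 mult_right_mono intro: order.trans[OF _ abs_ge_self]\<close>)
qed

lemma integrable_mult_continuous':
  fixes f v :: "real^'n \<Rightarrow> real"
  assumes "compact K" "continuous_on UNIV f" "integrable (lebesgue_on K) v"
  shows "integrable (lebesgue_on K) (\<lambda>x. v x * f x)"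
  using integrable_mult_continuous[OF assms] by (subst mult.commute)

lemma integrable_const_compact:
  fixes K :: "(real^'n) set"
  shows "compact K \<Longrightarrow> integrable (lebesgue_on K) (\<lambda>x. c::real)"
  by (metis compact_imp_closed finite_measure.integrable_const finite_measure_lebesgue_on lmeasurable_compact)

lemma integrable_continuous_compact:
  fixes f :: "real^'n \<Rightarrow> real"
  assumes "compact K" "continuous_on UNIV f"
  shows "integrable (lebesgue_on K) f"
  using integrable_mult_continuous[OF assms integrable_const_compact[OF assms(1), of 1]] by simp

text \<open>Integration by parts: the product with a test function has compact support inside
  \<open>K\<close>, so the integral of its derivative over the whole space is zero, and restriction
  to \<open>K\<close> loses nothing.\<close>

lemma has_dir_deriv_dirC1:
  fixes f :: "real^'n \<Rightarrow> real"
  assumes K: "compact K" and f: "dirC1 \<beta> f g"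
  shows "has_dir_deriv K \<beta> f g"
  unfolding has_dir_deriv_def
proof (intro conjI allI impI)
  have c: "continuous_on UNIV f" "continuous_on UNIV g" using f by (auto simp: dirC1_def)
  have Kl: "K \<in> sets lebesgue" using K by (simp add: compact_imp_closed)
  show "integrable (lebesgue_on K) g" using K c(2) by (rule integrable_continuous_compact)
  fix \<phi> assume \<phi>: "test_function (interior K) \<phi>"
  define \<phi>' where "\<phi>' x = frechet_derivative \<phi> (at x) \<beta>" for x
  have d: "dirC1 \<beta> \<phi> \<phi>'" unfolding \<phi>'_def[abs_def] using \<phi> by (rule dirC1_test_function)
  then have c': "continuous_on UNIV \<phi>" "continuous_on UNIV \<phi>'" by (auto simp: dirC1_def)
  define C where "C = closure {x. \<phi> x \<noteq> 0}"
  have C: "compact C" "C \<subseteq> K" "\<And>x. x \<notin> C \<Longrightarrow> \<phi> x = 0"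
    using \<phi> interior_subset[of K] closure_subset[of "{x. \<phi> x \<noteq> 0}"] by (auto simp: C_def test_function_def)
  have supp: "\<phi>' x = 0" if "x \<notin> C" for x
    using dirC1_zero_outside[OF d compact_imp_closed[OF C(1)] C(3) that] .
  have P: "dirC1 \<beta> (\<lambda>x. f x * \<phi> x) (\<lambda>x. g x * \<phi> x + f x * \<phi>' x)" by (rule dirC1_mult[OF f d])
  have Z: "integrable lborel (\<lambda>x. g x * \<phi> x + f x * \<phi>' x)"
    "(LINT x|lborel. g x * \<phi> x + f x * \<phi>' x) = 0"
    using integral_dirC1_zero[OF P C(1)] C(3) by auto
  have "(LINT x|lebesgue_on K. f x * \<phi>' x) + (LINT x|lebesgue_on K. g x * \<phi> x)
      = (LINT x|lebesgue_on K. g x * \<phi> x + f x * \<phi>' x)"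
    using K c c' by (subst Bochner_Integration.integral_add) (auto intro!: integrable_continuous_compact continuous_on_mult)
  also have "\<dots> = (LINT x|lebesgue. g x * \<phi> x + f x * \<phi>' x)"
    unfolding integral_lebesgue_on[OF Kl]
  proof (intro Bochner_Integration.integral_cong refl)
    fix x
    show "indicator K x * (g x * \<phi> x + f x * \<phi>' x) = g x * \<phi> x + f x * \<phi>' x"
      using C(2,3) supp[of x] by (cases "x \<in> C") (auto simp: indicator_def)
  qed
  also have "\<dots> = 0" using Z by (subst integral_completion) auto
  finally show "(LINT x|lebesgue_on K. f x * frechet_derivative \<phi> (at x) \<beta>)
      = - (LINT x|lebesgue_on K. g x * \<phi> x)" by (simp add: \<phi>'_def)
qed

lemma has_dir_deriv_unique:
  assumes K: "compact K" "negligible (frontier K)"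
    and g: "has_dir_deriv K \<beta> v g" "has_dir_deriv K \<beta> v g'"
  shows "AE x in lebesgue_on K. g x = g' x"
proof -
  have int: "integrable (lebesgue_on K) g" "integrable (lebesgue_on K) g'"
    using g by (auto simp: has_dir_deriv_def)
  have "AE x in lebesgue_on K. g x - g' x = 0"
  proof (rule fundamental_lemma)
    show "K \<in> sets lebesgue" using K by (simp add: compact_imp_closed)
    fix \<phi> assume \<phi>: "test_function (interior K) \<phi>"
    then have c: "continuous_on UNIV \<phi>" using Ck_continuous by (auto simp: test_function_def)
    have "integrable (lebesgue_on K) (\<lambda>x. g x * \<phi> x)" "integrable (lebesgue_on K) (\<lambda>x. g' x * \<phi> x)"
      using integrable_mult_continuous'[OF K(1) c] int by simp_all
    then show "(LINT x|lebesgue_on K. (g x - g' x) * \<phi> x) = 0"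
      using g \<phi> by (simp add: left_diff_distrib has_dir_deriv_def)
  qed (use K int in auto)
  then show ?thesis by eventually_elim simp
qed

lemma dir_deriv_works:
  assumes "has_dir_deriv K \<beta> v g"
  shows "has_dir_deriv K \<beta> v (dir_deriv K \<beta> v)"
  unfolding dir_deriv_def using assms by (rule someI[where P = "has_dir_deriv K \<beta> v"])

text \<open>The choice made in \<open>dir_deriv\<close> is harmless: any known representative may
  replace it under an integral.\<close>

lemma dir_deriv_eq_AE:
  assumes "compact K" "negligible (frontier K)" "has_dir_deriv K \<beta> v g"
  shows "AE x in lebesgue_on K. dir_deriv K \<beta> v x = g x"
  using has_dir_deriv_unique[OF assms(1,2) dir_deriv_works[OF assms(3)] assms(3)] .

lemma has_dir_deriv_diff:
  fixes u v :: "real^'n \<Rightarrow> real"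
  assumes K: "compact K" and u: "has_dir_deriv K \<beta> u g" "integrable (lebesgue_on K) u"
    and v: "has_dir_deriv K \<beta> v g'" "integrable (lebesgue_on K) v"
  shows "has_dir_deriv K \<beta> (\<lambda>x. u x - v x) (\<lambda>x. g x - g' x)"
  unfolding has_dir_deriv_def
proof (intro conjI allI impI)
  have int: "integrable (lebesgue_on K) g" "integrable (lebesgue_on K) g'"
    using u v by (auto simp: has_dir_deriv_def)
  then show "integrable (lebesgue_on K) (\<lambda>x. g x - g' x)" by simp
  fix \<phi> assume \<phi>: "test_function (interior K) \<phi>"
  then have c: "continuous_on UNIV \<phi>" "continuous_on UNIV (\<lambda>x. frechet_derivative \<phi> (at x) \<beta>)"
    using dirC1_test_function[OF \<phi>, of \<beta>] by (auto simp: dirC1_def)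
  have "integrable (lebesgue_on K) (\<lambda>x. g x * \<phi> x)" "integrable (lebesgue_on K) (\<lambda>x. g' x * \<phi> x)"
    "integrable (lebesgue_on K) (\<lambda>x. u x * frechet_derivative \<phi> (at x) \<beta>)"
    "integrable (lebesgue_on K) (\<lambda>x. v x * frechet_derivative \<phi> (at x) \<beta>)"
    using integrable_mult_continuous'[OF K c(1)] integrable_mult_continuous'[OF K c(2)] int u v
    by simp_all
  then show "(LINT x|lebesgue_on K. (u x - v x) * frechet_derivative \<phi> (at x) \<beta>)
      = - (LINT x|lebesgue_on K. (g x - g' x) * \<phi> x)"
    using u v \<phi> by (simp add: left_diff_distrib has_dir_deriv_def)
qed

text \<open>The derivative of the difference is a fresh choice, unrelated by definition to the
  derivatives of \<open>u\<close> and \<open>v\<close>; almost everywhere uniqueness replaces it by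
  \<open>u' - g\<close>, after which the pairing splits.\<close>

lemma Dpairing_diff:
  fixes u v w :: "real^'n \<Rightarrow> real"
  assumes K: "compact K" "negligible (frontier K)" and w: "dirC1 \<beta> w w'" and u: "dirC1 \<beta> u u'"
    and v: "integrable (lebesgue_on K) v" "has_dir_deriv K \<beta> v g"
  shows "Dpairing K \<beta> w (\<lambda>x. u x - v x) =
    (LINT x|lebesgue_on K. w' x * u x + w x * u' x) - (LINT x|lebesgue_on K. w' x * v x + w x * g x)"
proof -
  have c: "continuous_on UNIV w" "continuous_on UNIV w'" "continuous_on UNIV u" "continuous_on UNIV u'"
    using w u by (auto simp: dirC1_def)
  have g: "integrable (lebesgue_on K) g" using v by (simp add: has_dir_deriv_def)
  note int = integrable_continuous_compact[OF K(1)] integrable_mult_continuous[OF K(1)]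
  have dw: "has_dir_deriv K \<beta> w w'" by (rule has_dir_deriv_dirC1[OF K(1) w])
  have duv: "has_dir_deriv K \<beta> (\<lambda>x. u x - v x) (\<lambda>x. u' x - g x)"
    by (intro has_dir_deriv_diff has_dir_deriv_dirC1[OF K(1) u] K(1) int c v)
  have m: "integrable (lebesgue_on K) (dir_deriv K \<beta> w)" "integrable (lebesgue_on K) (dir_deriv K \<beta> (\<lambda>x. u x - v x))"
    using dir_deriv_works[OF dw] dir_deriv_works[OF duv] by (simp_all add: has_dir_deriv_def)
  note iw = int(1)[OF c(1)] int(1)[OF c(2)] int(1)[OF c(3)] int(1)[OF c(4)]
  have [measurable]: "w \<in> borel_measurable (lebesgue_on K)" "w' \<in> borel_measurable (lebesgue_on K)"
     "u \<in> borel_measurable (lebesgue_on K)" "u' \<in> borel_measurable (lebesgue_on K)"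
     "v \<in> borel_measurable (lebesgue_on K)" "g \<in> borel_measurable (lebesgue_on K)"
     "dir_deriv K \<beta> w \<in> borel_measurable (lebesgue_on K)"
     "dir_deriv K \<beta> (\<lambda>x. u x - v x) \<in> borel_measurable (lebesgue_on K)"
    using iw v(1) g m by (simp_all only: borel_measurable_integrable)
  have "pairing K (dir_deriv K \<beta> w) (\<lambda>x. u x - v x) = (LINT x|lebesgue_on K. w' x * u x - w' x * v x)"
    unfolding pairing_def
  proof (rule integral_cong_AE)
    show "AE x in lebesgue_on K. dir_deriv K \<beta> w x * (u x - v x) = w' x * u x - w' x * v x"
      using dir_deriv_eq_AE[OF K dw] by eventually_elim (simp add: right_diff_distrib)
  qed measurable
  moreover have "pairing K w (dir_deriv K \<beta> (\<lambda>x. u x - v x)) = (LINT x|lebesgue_on K. w x * u' x - w x * g x)"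
    unfolding pairing_def
  proof (rule integral_cong_AE)
    show "AE x in lebesgue_on K. w x * dir_deriv K \<beta> (\<lambda>x. u x - v x) x = w x * u' x - w x * g x"
      using dir_deriv_eq_AE[OF K duv] by eventually_elim (simp add: right_diff_distrib)
  qed measurable
  moreover have "integrable (lebesgue_on K) (\<lambda>x. w' x * u x)" "integrable (lebesgue_on K) (\<lambda>x. w' x * v x)"
    "integrable (lebesgue_on K) (\<lambda>x. w x * u' x)" "integrable (lebesgue_on K) (\<lambda>x. w x * g x)"
    by (intro int c v(1) g iw)+
  ultimately show ?thesis unfolding Dpairing_def by simp
qed

text \<open>By continuity the set where \<open>f\<close> is nonzero is open in the interior, and a
  nonempty open set is not negligible. This is the source of definiteness for all moment
  forms.\<close>

lemma set_nonneg_integral_zero: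
  fixes f :: "real^'n \<Rightarrow> real"
  assumes K: "compact K" and f: "continuous_on UNIV f" "\<And>x. x \<in> K \<Longrightarrow> f x \<ge> 0"
    and 0: "(LINT x|lebesgue_on K. f x) = 0" and x: "x \<in> interior K"
  shows "f x = 0"
proof (rule ccontr)
  assume "f x \<noteq> 0"
  have Kl: "K \<in> sets lebesgue" using K by (simp add: compact_imp_closed)
  have "AE x in lebesgue_on K. 0 \<le> f x" using f(2) Kl by (intro AE_I2) auto
  then have "AE x in lebesgue_on K. f x = 0"
    using integral_nonneg_eq_0_iff_AE[OF integrable_continuous_compact[OF K f(1)]] 0 by simp
  then have "AE x in lebesgue. x \<in> K \<longrightarrow> f x = 0"
    using Kl by (subst (asm) AE_restrict_space_iff) auto
  then have "AE x in lebesgue. x \<notin> interior K \<inter> {x. f x \<noteq> 0}"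
    by eventually_elim (use interior_subset in auto)
  moreover have op: "open (interior K \<inter> {x. f x \<noteq> 0})"
    by (intro open_Int open_interior open_Collect_neq f(1) continuous_intros)
  ultimately have "negligible (interior K \<inter> {x. f x \<noteq> 0})"
    unfolding negligible_iff_null_sets by (subst (asm) AE_iff_null_sets[symmetric]) auto
  with op have "interior K \<inter> {x. f x \<noteq> 0} = {}" using open_not_negligible by blast
  then show False using x \<open>f x \<noteq> 0\<close> by auto
qed

section \<open>Mean values and norms\<close>

text \<open>The common currency of the estimates. Data enter the coefficient bounds through these
  averages, and the power of the volume in \<open>mean_abs_le_Lnorm\<close> is the one that
  \<open>Lnorm_bound\<close> produces, so the volume cancels.\<close>

definition mean_abs :: "(real^'n) set \<Rightarrow> (real^'n \<Rightarrow> real) \<Rightarrow> real" where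
  "mean_abs K v = (LINT x|lebesgue_on K. \<bar>v x\<bar>) / measure lebesgue K"

lemma Lspace_integrable:
  assumes K: "compact K" and v: "v \<in> Lspace q K" and "q > 1"
  shows "integrable (lebesgue_on K) v"
proof (rule Bochner_Integration.integrable_bound)
  show "integrable (lebesgue_on K) (\<lambda>x. 1 + \<bar>v x\<bar> powr q)"
    using v integrable_const_compact[OF K, of 1] by (simp add: Lspace_def)
  show "v \<in> borel_measurable (lebesgue_on K)" using v by (simp add: Lspace_def)
  have "\<bar>t\<bar> \<le> 1 + \<bar>t\<bar> powr q" for t :: real
  proof (cases "\<bar>t\<bar> \<le> 1")
    case True
    moreover have "0 \<le> \<bar>t\<bar> powr q" by simp
    ultimately show ?thesis by linarith
  next
    case False
    then have "\<bar>t\<bar> powr 1 \<le> \<bar>t\<bar> powr q" using \<open>q > 1\<close> by (intro powr_mono) auto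
    then show ?thesis using False by simp
  qed
  then show "AE x in lebesgue_on K. norm (v x) \<le> norm (1 + \<bar>v x\<bar> powr q)"
    by (auto intro!: AE_I2 simp: abs_of_nonneg)
qed

lemma tangent_powr:
  assumes "q > 1" "t \<ge> (0::real)"
  shows "t \<le> t powr q / q + (1 - 1 / q)"
proof -
  have "t * 1 \<le> t powr q / q + 1 powr (q / (q - 1)) / (q / (q - 1))"
    using assms by (intro Youngs_inequality) (auto simp: field_simps)
  then show ?thesis using assms by (simp add: diff_divide_distrib)
qed

text \<open>Jensen's inequality for the power q, by optimising over tangents:
  \<open>tangent_powr\<close> applied to \<open>\<bar>v x\<bar> / l\<close> and averaged gives a
  bound for every \<open>l > 0\<close>, and the best \<open>l\<close> is (I / M)^(1/q). If
  \<open>I = 0\<close>, this value is not positive and \<open>l\<close> is sent to 0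
  instead.\<close>

lemma mean_abs_le_Lnorm:
  assumes K: "compact K" "measure lebesgue K > 0" and v: "v \<in> Lspace q K" and q: "q > 1"
  shows "measure lebesgue K powr (1 / q) * mean_abs K v \<le> Lnorm q K v"
proof -
  define M where "M = measure lebesgue K"
  define I where "I = (LINT x|lebesgue_on K. \<bar>v x\<bar> powr q)"
  have "M > 0" using K by (simp add: M_def)
  have Kl: "K \<in> sets lebesgue" using K by (simp add: compact_imp_closed)
  have Iint: "integrable (lebesgue_on K) (\<lambda>x. \<bar>v x\<bar> powr q)" using v by (simp add: Lspace_def)
  have "I \<ge> 0" unfolding I_def by (intro Bochner_Integration.integral_nonneg) simp
  have const: "(LINT x|lebesgue_on K. c) = c * M" for c :: real
    using Kl by (simp add: M_def measure_restrict_space)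
  have key: "mean_abs K v \<le> l * (1 - 1 / q) + l powr (1 - q) * (I / M) / q" if l: "l > 0" for l
  proof -
    have pt: "\<bar>v x\<bar> \<le> l powr (1 - q) / q * \<bar>v x\<bar> powr q + l * (1 - 1 / q)" for x
    proof -
      have "\<bar>v x\<bar> / l \<le> (\<bar>v x\<bar> / l) powr q / q + (1 - 1 / q)" using tangent_powr[OF q] l by simp
      then have "l * (\<bar>v x\<bar> / l) \<le> l * ((\<bar>v x\<bar> / l) powr q / q + (1 - 1 / q))" using l by (intro mult_left_mono) auto
      moreover have "l * (\<bar>v x\<bar> / l) powr q = l powr (1 - q) * \<bar>v x\<bar> powr q"
        using l by (simp add: powr_divide powr_diff)
      ultimately show ?thesis using l by (simp add: distrib_left)
    qed
    have "(LINT x|lebesgue_on K. \<bar>v x\<bar>) \<le> (LINT x|lebesgue_on K. l powr (1 - q) / q * \<bar>v x\<bar> powr q + l * (1 - 1 / q))"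
      using Lspace_integrable[OF K(1) v q] Iint integrable_const_compact[OF K(1)] pt
      by (intro integral_mono Bochner_Integration.integrable_add integrable_mult_right) auto
    also have "\<dots> = l powr (1 - q) / q * I + l * (1 - 1 / q) * M"
      using Iint integrable_const_compact[OF K(1)]
      by (subst Bochner_Integration.integral_add) (auto simp only: integral_mult_right_zero const I_def intro!: integrable_mult_right)
    finally show ?thesis using \<open>M > 0\<close> by (simp add: mean_abs_def M_def[symmetric] pos_divide_le_eq distrib_right)
  qed
  have "mean_abs K v \<le> (I / M) powr (1 / q)"
  proof (cases "I = 0")
    case True
    have "mean_abs K v \<le> 0"
    proof (rule field_le_epsilon)
      fix e :: real assume "e > 0"
      have "mean_abs K v \<le> e * (1 - 1 / q)" using key[OF \<open>e > 0\<close>] True by simp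
      also have "\<dots> \<le> e" using \<open>e > 0\<close> q by (simp add: mult_left_le)
      finally show "mean_abs K v \<le> 0 + e" by simp
    qed
    then show ?thesis using True by simp
  next
    case False
    define l where "l = (I / M) powr (1 / q)"
    have "I / M > 0" using False \<open>I \<ge> 0\<close> \<open>M > 0\<close> by simp
    then have l: "l > 0" "l powr q = I / M" using q False \<open>M > 0\<close> \<open>I \<ge> 0\<close> by (simp_all add: l_def powr_powr powr_gt_zero)
    have "l powr (1 - q) * (I / M) = l" using l by (simp add: powr_diff flip: l(2))
    then have "mean_abs K v \<le> l * (1 - 1 / q) + l / q" using key[OF l(1)] by simp
    also have "\<dots> = l" by (simp add: right_diff_distrib)
    finally show ?thesis by (simp add: l_def)
  qed
  then have "M powr (1 / q) * mean_abs K v \<le> M powr (1 / q) * (I / M) powr (1 / q)"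
    by (intro mult_left_mono) auto
  also have "\<dots> = I powr (1 / q)" using \<open>M > 0\<close> \<open>I \<ge> 0\<close> by (simp add: powr_divide)
  finally show ?thesis by (simp add: M_def I_def Lnorm_def)
qed

lemma Lnorm_nonneg: "Lnorm q K v \<ge> 0"
  by (simp add: Lnorm_def)

lemma mean_abs_nonneg: "mean_abs K v \<ge> 0"
  by (simp add: mean_abs_def)

lemma Lnorm_bound:
  assumes K: "compact K" and u: "continuous_on UNIV u" "\<And>x. x \<in> K \<Longrightarrow> \<bar>u x\<bar> \<le> U"
    and f: "f \<in> borel_measurable (lebesgue_on K)" "AE x in lebesgue_on K. f x = u x" and "q > 1" "U \<ge> 0"
  shows "Lnorm q K f \<le> U * measure lebesgue K powr (1 / q)"
proof -
  have Kl: "K \<in> sets lebesgue" using K by (simp add: compact_imp_closed)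
  have c: "continuous_on UNIV (\<lambda>x. \<bar>u x\<bar> powr q)"
    using u(1) \<open>q > 1\<close> by (intro continuous_on_powr') (auto intro!: continuous_intros)
  have [measurable]: "u \<in> borel_measurable (lebesgue_on K)"
    using integrable_continuous_compact[OF K u(1)] by (rule borel_measurable_integrable)
  have "(LINT x|lebesgue_on K. \<bar>f x\<bar> powr q) = (LINT x|lebesgue_on K. \<bar>u x\<bar> powr q)"
    using f by (intro integral_cong_AE) (auto intro!: measurable)
  also have "\<dots> \<le> (LINT x|lebesgue_on K. U powr q)"
    using u(2) \<open>q > 1\<close> Kl
    by (intro integral_mono integrable_continuous_compact[OF K c] integrable_const_compact[OF K] powr_mono2) auto
  also have "\<dots> = U powr q * measure lebesgue K" using Kl by (simp add: measure_restrict_space)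
  finally have "Lnorm q K f \<le> (U powr q * measure lebesgue K) powr (1 / q)"
    unfolding Lnorm_def using \<open>q > 1\<close> by (intro powr_mono2) auto
  also have "\<dots> = U * measure lebesgue K powr (1 / q)"
    using \<open>q > 1\<close> \<open>U \<ge> 0\<close> by (simp add: powr_mult powr_powr)
  finally show ?thesis .
qed

section \<open>Barycentric coordinates\<close>

lemma mon_single: "mon \<xi> (\<lambda>j. if j = i then 1 else 0) = \<xi> i"
  by (simp add: mon_def fun_eq_iff if_distrib if_distribR prod.delta cong: if_cong)

lemma hidx_add: "\<alpha> \<in> hidx i \<Longrightarrow> \<gamma> \<in> hidx j \<Longrightarrow> (\<lambda>l. \<alpha> l + \<gamma> l) \<in> hidx (i + j)"
  by (auto simp: hidx_def sum.distrib)

locale nondegenerate_element =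
  fixes a :: "'n::finite element"
  assumes nondeg: "nondegenerate a"
begin

abbreviation lam :: "'n option \<Rightarrow> real^'n \<Rightarrow> real" where "lam \<equiv> bary a"

lemma coords_zero:
  assumes "(\<Sum>j\<in>UNIV. u j) = 0" "(\<Sum>j\<in>UNIV. u j *\<^sub>R a j) = 0"
  shows "u j = 0"
proof (rule ccontr)
  assume "u j \<noteq> 0"
  have inj: "inj a" using nondeg by (simp add: nondegenerate_def)
  have "(\<Sum>v\<in>range a. u (inv a v)) = 0" "(\<Sum>v\<in>range a. u (inv a v) *\<^sub>R v) = 0"
    using assms inj by (simp_all add: sum.reindex)
  moreover have "\<exists>v\<in>range a. u (inv a v) \<noteq> 0" using \<open>u j \<noteq> 0\<close> inj by auto
  ultimately have "affine_dependent (range a)"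
    unfolding affine_dependent_explicit_finite[OF finite_imageI[OF finite]] by blast
  then show False using nondeg by (simp add: nondegenerate_def)
qed

lemma coords_exist: "\<exists>l. (\<Sum>j\<in>UNIV. l j) = 1 \<and> (\<Sum>j\<in>UNIV. l j *\<^sub>R a j) = x"
proof -
  have inj: "inj a" and ind: "\<not> affine_dependent (range a)" using nondeg by (auto simp: nondegenerate_def)
  have "card (range a) = Suc DIM(real^'n)" using inj by (simp add: card_image card_UNIV_option)
  then have "affine hull (range a) = UNIV" using ind by (intro affine_independent_span_eq) auto
  then obtain u where "sum u (range a) = 1" "(\<Sum>v\<in>range a. u v *\<^sub>R v) = x"
    using affine_hull_finite[OF finite_imageI[OF finite], of a UNIV] by blast
  then show ?thesis using inj by (intro exI[of _ "u \<circ> a"]) (simp add: sum.reindex)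
qed

lemma bary_unique:
  assumes "(\<Sum>j\<in>UNIV. l j) = 1" "(\<Sum>j\<in>UNIV. l j *\<^sub>R a j) = x"
  shows "lam i x = l i"
proof -
  have "(THE l. (\<Sum>j\<in>UNIV. l j) = 1 \<and> (\<Sum>j\<in>UNIV. l j *\<^sub>R a j) = x) = l"
  proof (rule the_equality)
    fix l' assume l': "(\<Sum>j\<in>UNIV. l' j) = 1 \<and> (\<Sum>j\<in>UNIV. l' j *\<^sub>R a j) = x"
    show "l' = l"
    proof
      fix j
      have "l' j - l j = 0"
        using l' assms by (intro coords_zero[of "\<lambda>j. l' j - l j"]) (auto simp: sum_subtractf scaleR_diff_left)
      then show "l' j = l j" by simp
    qed
  qed (use assms in auto)
  then show ?thesis by (simp add: bary_def)
qed

lemma sum_bary: "(\<Sum>j\<in>UNIV. lam j x) = 1" and bary_comb: "(\<Sum>j\<in>UNIV. lam j x *\<^sub>R a j) = x"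
proof -
  obtain l where l: "(\<Sum>j\<in>UNIV. l j) = 1" "(\<Sum>j\<in>UNIV. l j *\<^sub>R a j) = x" using coords_exist by blast
  then have "lam j x = l j" for j by (rule bary_unique)
  then show "(\<Sum>j\<in>UNIV. lam j x) = 1" "(\<Sum>j\<in>UNIV. lam j x *\<^sub>R a j) = x" using l by simp_all
qed

lemma bary_vertex: "lam i (a j) = (if i = j then 1 else 0)"
  by (rule bary_unique) (simp_all add: if_distrib if_distribR cong: if_cong)

text \<open>The linear part of the affine function \<open>lam i\<close>; at \<open>\<beta>\<close>
  it is the constant directional derivative of \<open>lam i\<close> along
  \<open>\<beta>\<close>.\<close>

definition dlam :: "'n option \<Rightarrow> real^'n \<Rightarrow> real" where
  "dlam i v = lam i v - lam i 0"

lemma bary_add: "lam i (x + t *\<^sub>R v) = lam i x + t * dlam i v"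
proof (rule bary_unique)
  show "(\<Sum>j\<in>UNIV. lam j x + t * dlam j v) = 1"
    by (simp add: dlam_def sum.distrib sum_bary sum_subtractf flip: sum_distrib_left)
  have "(\<Sum>j\<in>UNIV. (lam j x + t * dlam j v) *\<^sub>R a j)
     = (\<Sum>j\<in>UNIV. lam j x *\<^sub>R a j) + t *\<^sub>R ((\<Sum>j\<in>UNIV. lam j v *\<^sub>R a j) - (\<Sum>j\<in>UNIV. lam j 0 *\<^sub>R a j))"
    by (simp add: dlam_def sum.distrib scaleR_add_left scaleR_diff_left sum_subtractf scaleR_right_diff_distrib scaleR_sum_right right_diff_distrib)
  then show "(\<Sum>j\<in>UNIV. (lam j x + t * dlam j v) *\<^sub>R a j) = x + t *\<^sub>R v" by (simp add: bary_comb)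
qed

lemma linear_dlam: "linear (dlam i)"
proof
  show "dlam i (x + y) = dlam i x + dlam i y" for x y
    using bary_add[of i x 1 y] by (simp add: dlam_def[of i "x + y"] dlam_def[of i x])
  show "dlam i (r *\<^sub>R x) = r *\<^sub>R dlam i x" for r x
    using bary_add[of i 0 r x] by (simp add: dlam_def[of i "r *\<^sub>R x"])
qed

lemma bary_affine: "lam i x = lam i 0 + dlam i x"
  by (simp add: dlam_def)

lemma sum_dlam: "(\<Sum>i\<in>UNIV. dlam i v) = 0" and dlam_comb: "(\<Sum>i\<in>UNIV. dlam i v *\<^sub>R a i) = v"
  by (simp_all add: dlam_def sum_subtractf sum_bary scaleR_diff_left bary_comb)

lemma continuous_bary: "continuous_on S (lam i)"
proof -
  have "continuous_on S (dlam i)" by (rule linear_continuous_on) (simp add: linear_dlam linear_conv_bounded_linear[symmetric])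
  then have "continuous_on S (\<lambda>x. lam i 0 + dlam i x)" by (intro continuous_intros)
  then show ?thesis by (simp add: bary_affine[symmetric])
qed

lemma continuous_mon: "continuous_on S (mon lam \<delta>)"
  unfolding mon_def[abs_def] by (intro continuous_intros continuous_bary)

lemma cell_eq: "cell a = {x. \<forall>i. 0 \<le> lam i x}"
proof
  have inj: "inj a" using nondeg by (simp add: nondegenerate_def)
  show "cell a \<subseteq> {x. \<forall>i. 0 \<le> lam i x}"
  proof
    fix x assume "x \<in> cell a"
    then obtain u where u: "\<forall>x\<in>range a. 0 \<le> u x" "sum u (range a) = 1" "(\<Sum>v\<in>range a. u v *\<^sub>R v) = x"
      unfolding cell_def convex_hull_finite[OF finite_imageI[OF finite]] by blast
    then have "lam i x = (u \<circ> a) i" for i using inj by (intro bary_unique) (simp_all add: sum.reindex)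
    then show "x \<in> {x. \<forall>i. 0 \<le> lam i x}" using u by auto
  qed
  show "{x. \<forall>i. 0 \<le> lam i x} \<subseteq> cell a"
  proof
    fix x assume x: "x \<in> {x. \<forall>i. 0 \<le> lam i x}"
    have "(\<Sum>v\<in>range a. lam (inv a v) x) = 1" "(\<Sum>v\<in>range a. lam (inv a v) x *\<^sub>R v) = x"
      using inj by (simp_all add: sum.reindex sum_bary bary_comb)
    then show "x \<in> cell a"
      unfolding cell_def convex_hull_finite[OF finite_imageI[OF finite]] using x
      by (auto intro!: exI[of _ "\<lambda>v. lam (inv a v) x"])
  qed
qed

lemma bary_le_1: "x \<in> cell a \<Longrightarrow> lam i x \<le> 1"
  using member_le_sum[of i UNIV "\<lambda>i. lam i x"] by (simp add: cell_eq sum_bary)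

lemma point_with_coords:
  assumes "(\<Sum>j\<in>UNIV. l j) = 1"
  shows "\<exists>x. \<forall>i. lam i x = l i"
  using bary_unique[OF assms refl] by blast

lemma compact_cell: "compact (cell a)"
  unfolding cell_def by (rule finite_imp_compact_convex_hull) simp

lemma cell_lebesgue: "cell a \<in> sets lebesgue"
  using compact_cell by (simp add: compact_imp_closed)

lemma negligible_frontier_cell: "negligible (frontier (cell a))"
  unfolding cell_def by (intro negligible_convex_frontier convex_convex_hull)

lemma interior_cellI:
  assumes "\<And>i. 0 < lam i x"
  shows "x \<in> interior (cell a)"
proof (rule interiorI)
  show "open (\<Inter>i. {x. 0 < lam i x})"
    by (intro open_INT finite ballI open_Collect_less continuous_bary continuous_on_const)
qed (use assms in \<open>auto simp: cell_eq less_imp_le\<close>)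

lemma frontier_cellD:
  assumes "x \<in> frontier (cell a)"
  shows "x \<in> cell a" "\<exists>i. lam i x = 0"
proof -
  have "x \<in> cell a" "x \<notin> interior (cell a)"
    using assms compact_cell by (auto simp: frontier_def compact_imp_closed)
  then show "x \<in> cell a" "\<exists>i. lam i x = 0"
    using interior_cellI[of x] by (auto simp: cell_eq order.order_iff_strict)
qed

lemma frontier_cellI:
  assumes x: "x \<in> cell a" "lam i x = 0"
  shows "x \<in> frontier (cell a)"
proof -
  have "x \<notin> interior (cell a)"
  proof
    assume "x \<in> interior (cell a)"
    then obtain e where e: "e > 0" "ball x e \<subseteq> cell a" by (auto simp: mem_interior)
    \<comment> \<open>Moving from \<open>x\<close> away from the vertex \<open>a i\<close> lowers
      \<open>lam i\<close> at unit rate, from 0 to negative values, and so leaves the cell at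
      once.\<close>
    define v where "v = a i - x"
    have "dlam i v = 1"
      using bary_add[of i x 1 v] x bary_vertex[of i i] by (simp add: v_def)
    define t where "t = e / (2 * (norm v + 1))"
    have "t > 0" using e by (simp add: t_def add_nonneg_pos)
    have "norm (t *\<^sub>R v) = t * norm v" using \<open>t > 0\<close> by simp
    also have "\<dots> \<le> e / 2"
    proof -
      have "norm v + 1 > 0" by (simp add: add_nonneg_pos)
      then have "t * (2 * (norm v + 1)) = e" by (simp add: t_def)
      then have "2 * (t * norm v) + 2 * t = e" by (simp add: algebra_simps)
      then show ?thesis using \<open>t > 0\<close> by linarith
    qed
    also have "\<dots> < e" using e by simp
    finally have "x + (- t) *\<^sub>R v \<in> ball x e" by (simp add: dist_norm)
    then have "x + (- t) *\<^sub>R v \<in> cell a" using e(2) by blast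
    then have "0 \<le> lam i (x + (- t) *\<^sub>R v)" by (simp only: cell_eq mem_Collect_eq)
    then have "0 \<le> lam i x + (- t) * dlam i v" unfolding bary_add .
    then show False using \<open>t > 0\<close> x \<open>dlam i v = 1\<close> by simp
  qed
  then show ?thesis using x compact_cell by (simp add: frontier_def compact_imp_closed)
qed

lemma cell_measure_pos: "measure lebesgue (cell a) > 0"
proof -
  \<comment> \<open>The barycentre has all coordinates 1/(N + 1) > 0 and is an interior
    point.\<close>
  have "(\<Sum>j\<in>(UNIV :: 'n option set). 1 / real (CARD('n option))) = 1" by simp
  from point_with_coords[OF this] obtain x where x: "\<forall>i. lam i x = 1 / real (CARD('n option))" ..
  have "x \<in> interior (cell a)" by (rule interior_cellI) (simp add: x zero_less_card_finite del: card_UNIV_option)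
  then have "\<not> negligible (cell a)"
    using open_not_negligible[OF open_interior] interior_subset negligible_subset by blast
  then show ?thesis using compact_cell
    by (metis lmeasurable_compact measure_nonneg negligible_iff_measure0 order_less_le)
qed

lemma integrable_cell:
  fixes f :: "real^'n \<Rightarrow> real"
  shows "continuous_on UNIV f \<Longrightarrow> integrable (lebesgue_on (cell a)) f"
  by (rule integrable_continuous_compact[OF compact_cell])

lemma dirC1_bary: "dirC1 \<beta> (lam i) (\<lambda>_. dlam i \<beta>)"
  unfolding dirC1_def
  by (auto simp: continuous_bary bary_add intro!: derivative_eq_intros)

end

lemma dirC1_power:
  assumes "dirC1 \<beta> f f'"
  shows "dirC1 \<beta> (\<lambda>x. f x ^ n) (\<lambda>x. real n * f' x * f x ^ (n - 1))"
  using assms unfolding dirC1_def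
  by (auto intro!: continuous_intros derivative_eq_intros)

text \<open>Truncated subtraction in the exponent is harmless: where \<open>\<delta> l = 0\<close>,
  the factor \<open>real (\<delta> l)\<close> removes the term.\<close>

lemma dirC1_prod_power:
  assumes "\<And>i. dirC1 \<beta> (f i) (\<lambda>_. d i)" "finite S"
  shows "dirC1 \<beta> (\<lambda>x. \<Prod>i\<in>S. f i x ^ \<delta> i)
     (\<lambda>x. \<Sum>l\<in>S. real (\<delta> l) * d l * (\<Prod>i\<in>S. f i x ^ (\<delta>(l := \<delta> l - 1)) i))"
  using assms(2)
proof (induction S rule: finite_induct)
  case empty then show ?case by (simp add: dirC1_const)
next
  case (insert s S)
  have "(\<Prod>i\<in>S. f i x ^ (\<delta>(s := \<delta> s - 1)) i) = (\<Prod>i\<in>S. f i x ^ \<delta> i)" for x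
    using insert.hyps by (intro prod.cong) auto
  moreover have "(\<Sum>l\<in>S. real (\<delta> l) * d l * (\<Prod>i\<in>insert s S. f i x ^ (\<delta>(l := \<delta> l - 1)) i))
    = f s x ^ \<delta> s * (\<Sum>l\<in>S. real (\<delta> l) * d l * (\<Prod>i\<in>S. f i x ^ (\<delta>(l := \<delta> l - 1)) i))" for x
    unfolding sum_distrib_left using insert.hyps by (intro sum.cong) auto
  ultimately show ?case
    using dirC1_mult[OF dirC1_power[OF assms(1)[of s], of "\<delta> s"] insert.IH] insert.hyps
    by (simp add: algebra_simps)
qed

lemma (in nondegenerate_element) dirC1_mon:
  "dirC1 \<beta> (mon lam \<delta>) (\<lambda>x. \<Sum>l\<in>UNIV. real (\<delta> l) * dlam l \<beta> * mon lam (\<delta>(l := \<delta> l - 1)) x)"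
  using dirC1_prod_power[OF dirC1_bary finite] unfolding mon_def[abs_def] .

section \<open>Moments of barycentric monomials\<close>

text \<open>An explicit quadratic remainder, uniform in x and y, so that it survives integration
  over the cell. The induction closes because n^2 + n is at most (n + 1)^2.\<close>

lemma power_taylor:
  fixes x y e :: real
  assumes "\<bar>x\<bar> \<le> 1" "\<bar>y\<bar> \<le> 1" "\<bar>x + e * y\<bar> \<le> 1" "e \<ge> 0"
  shows "\<bar>(x + e * y) ^ n - x ^ n - real n * e * y * x ^ (n - 1)\<bar> \<le> (real n)\<^sup>2 * e\<^sup>2"
proof (induction n)
  case (Suc n)
  define u where "u = x + e * y"
  define E where "E = u ^ n - x ^ n - real n * e * y * x ^ (n - 1)"
  have "u ^ Suc n - x ^ Suc n - real (Suc n) * e * y * x ^ (Suc n - 1) = u * E + real n * e\<^sup>2 * (y\<^sup>2 * x ^ (n - 1))"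
    unfolding E_def u_def by (cases n) (simp_all add: algebra_simps power2_eq_square)
  moreover have "\<bar>u * E\<bar> \<le> (real n)\<^sup>2 * e\<^sup>2"
    using Suc assms(3) mult_mono[of "\<bar>u\<bar>" 1 "\<bar>E\<bar>" "(real n)\<^sup>2 * e\<^sup>2"] by (simp add: abs_mult u_def E_def)
  moreover have "\<bar>real n * e\<^sup>2 * (y\<^sup>2 * x ^ (n - 1))\<bar> \<le> real n * e\<^sup>2 * 1"
  proof -
    have le: "\<bar>y\<^sup>2 * x ^ (n - 1)\<bar> \<le> 1"
      using assms power_le_one[of "\<bar>x\<bar>" "n - 1"]
      by (auto simp: abs_mult power_abs abs_square_le_1 intro!: mult_le_one)
    show ?thesis
      using mult_left_mono[OF le, of "real n * e\<^sup>2"] by (simp add: abs_mult)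
  qed
  ultimately have "\<bar>u ^ Suc n - x ^ Suc n - real (Suc n) * e * y * x ^ (Suc n - 1)\<bar> \<le> (real n)\<^sup>2 * e\<^sup>2 + real n * e\<^sup>2"
    by linarith
  also have "\<dots> = ((real n)\<^sup>2 + real n) * e\<^sup>2" by (simp add: distrib_right)
  also have "\<dots> \<le> (real (Suc n))\<^sup>2 * e\<^sup>2"
    by (intro mult_right_mono) (simp_all add: power2_eq_square algebra_simps)
  finally show ?case by (simp add: u_def)
qed simp

context nondegenerate_element
begin

definition moment :: "('n option \<Rightarrow> nat) \<Rightarrow> real" where
  "moment \<delta> = (LINT x|lebesgue_on (cell a). mon lam \<delta> x)"

abbreviation vol :: real where "vol \<equiv> measure lebesgue (cell a)"

lemma mon_bounds: "x \<in> cell a \<Longrightarrow> 0 \<le> mon lam \<delta> x" "x \<in> cell a \<Longrightarrow> mon lam \<delta> x \<le> 1"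
proof -
  assume x: "x \<in> cell a"
  have "0 \<le> lam i x" "lam i x \<le> 1" for i using x bary_le_1 by (auto simp: cell_eq)
  then show "0 \<le> mon lam \<delta> x" "mon lam \<delta> x \<le> 1"
    unfolding mon_def by (auto intro!: prod_nonneg prod_le_1 power_le_one)
qed

lemma integral_cell_const: "(LINT x|lebesgue_on (cell a). c) = c * vol" for c :: real
  using cell_lebesgue by (simp add: measure_restrict_space)

text \<open>The homothety with centre \<open>a l\<close> and ratio \<open>1 - e\<close>. It maps the
  cell onto the part where \<open>lam l \<ge> e\<close>, and to first order in \<open>e\<close> it
  moves points along the field used in \<open>moment_rec\<close>.\<close>

definition shrink :: "'n option \<Rightarrow> real \<Rightarrow> real^'n \<Rightarrow> real^'n" where
  "shrink l e x = e *\<^sub>R a l + (1 - e) *\<^sub>R x"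

lemma bary_shrink: "lam i (shrink l e x) = (if i = l then lam l x + e * (1 - lam l x) else (1 - e) * lam i x)"
proof -
  have "lam i (shrink l e x) = (if i = l then e else 0) + (1 - e) * lam i x"
  proof (rule bary_unique)
    show "(\<Sum>j\<in>UNIV. (if j = l then e else 0) + (1 - e) * lam j x) = 1"
      by (simp add: sum.distrib sum_bary flip: sum_distrib_left)
    have "(\<Sum>j\<in>UNIV. ((if j = l then e else 0) + (1 - e) * lam j x) *\<^sub>R a j)
        = (\<Sum>j\<in>UNIV. (if j = l then e *\<^sub>R a j else 0) + (1 - e) *\<^sub>R (lam j x *\<^sub>R a j))"
      by (intro sum.cong) (simp_all add: scaleR_add_left)
    also have "\<dots> = e *\<^sub>R a l + (1 - e) *\<^sub>R (\<Sum>j\<in>UNIV. lam j x *\<^sub>R a j)"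
      unfolding sum.distrib scaleR_sum_right by simp
    finally show "(\<Sum>j\<in>UNIV. ((if j = l then e else 0) + (1 - e) * lam j x) *\<^sub>R a j) = shrink l e x"
      by (simp add: bary_comb shrink_def)
  qed
  then show ?thesis by (cases "i = l") (auto simp: algebra_simps)
qed

lemma integral_shrink:
  fixes G :: "real^'n \<Rightarrow> real"
  assumes "G \<in> borel_measurable borel" "e < 1"
  shows "(LINT x|lborel. G x) = (1 - e) ^ CARD('n) * (LINT x|lborel. G (shrink l e x))"
proof -
  have [measurable]: "G \<in> borel_measurable borel" by fact
  have [measurable]: "shrink l e \<in> borel_measurable borel"
    unfolding shrink_def[abs_def] by measurable
  have "lborel = density (distr lborel borel (shrink l e)) (\<lambda>_. (1 - e) ^ CARD('n))"
    using lborel_affine[of "1 - e" "e *\<^sub>R a l"] assms by (simp add: shrink_def[abs_def])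
  then have "(LINT x|lborel. G x) = (LINT x|density (distr lborel borel (shrink l e)) (\<lambda>_. (1 - e) ^ CARD('n)). G x)"
    by metis
  also have "\<dots> = (1 - e) ^ CARD('n) * (LINT x|lborel. G (shrink l e x))"
    using assms by (subst integral_density) (auto simp: integral_distr)
  finally show ?thesis .
qed

lemma cell_integral_lborel:
  fixes f :: "real^'n \<Rightarrow> real"
  assumes "f \<in> borel_measurable borel"
  shows "(LINT x|lebesgue_on (cell a). f x) = (LINT x|lborel. indicator (cell a) x * f x)"
proof -
  have [measurable]: "cell a \<in> sets borel" using compact_cell by (simp add: compact_imp_closed)
  have [measurable]: "f \<in> borel_measurable borel" by fact
  show ?thesis
    unfolding integral_lebesgue_on[OF cell_lebesgue] by (subst integral_completion) auto
qed

text \<open>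
  The part of the element outside its shrunken copy has volume \<open>O(e)\<close>, and there the factor
  \<open>\<lambda>\<^sub>l\<close> makes the monomial at most \<open>e\<close>: no first-order term in \<open>e\<close> survives.
\<close>

lemma shrink_estimate:
  assumes "\<delta> l \<ge> 1" "0 < e" "e < 1"
  shows "\<bar>moment \<delta> - (1 - e) ^ CARD('n) * (LINT x|lebesgue_on (cell a). mon lam \<delta> (shrink l e x))\<bar>
     \<le> real CARD('n) * vol * e\<^sup>2"
proof -
  define N where "N = CARD('n)"
  \<comment> \<open>\<open>D\<close> is the shrunken copy. The condition
    \<open>lam l \<ge> e\<close> is written with \<open>1 - lam l\<close> because the homothety just
    scales that quantity by \<open>1 - e\<close>.\<close>
  define D where "D = {x \<in> cell a. 1 - lam l x \<le> 1 - e}"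
  have sub: "D \<subseteq> cell a" by (auto simp: D_def)
  have cl: "closed (cell a)" using compact_cell by (rule compact_imp_closed)
  have D_eq: "shrink l e x \<in> D \<longleftrightarrow> x \<in> cell a" for x
  proof -
    have "lam i (shrink l e x) \<ge> 0" if "x \<in> cell a" for i
      using that assms bary_le_1[OF that] by (auto simp: bary_shrink cell_eq)
    moreover have "1 - lam l (shrink l e x) = (1 - e) * (1 - lam l x)"
      by (simp add: bary_shrink algebra_simps)
    moreover have "(1 - e) * (1 - lam l x) \<le> 1 - e \<longleftrightarrow> lam l x \<ge> 0"
      using assms by (simp add: mult_le_cancel_left2)
    moreover have "lam i x \<ge> 0" if "i \<noteq> l" "shrink l e x \<in> cell a" for i
    proof -
      have "(1 - e) * lam i x \<ge> 0" using that by (auto simp: cell_eq bary_shrink dest: spec[of _ i])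
      then show ?thesis using assms by (simp add: zero_le_mult_iff)
    qed
    ultimately show ?thesis by (auto simp: D_def cell_eq) metis
  qed
  have "D = cell a \<inter> {x. 1 - lam l x \<le> 1 - e}" by (auto simp: D_def)
  then have D_closed: "closed D"
    using cl by (auto intro!: closed_Collect_le continuous_intros continuous_bary)
  then have D_leb: "D \<in> sets lebesgue" and [measurable]: "D \<in> sets borel" by auto
  have [measurable]: "cell a \<in> sets borel" using cl by simp
  have [measurable]: "mon lam \<delta> \<in> borel_measurable borel" for \<delta>
    by (rule borel_measurable_continuous_onI[OF continuous_mon])
  have [measurable]: "shrink l e \<in> borel_measurable borel"
    unfolding shrink_def[abs_def] by measurable
  have bi: "integrable lborel (\<lambda>x. indicator S x * mon lam \<delta> x)" if "S \<in> sets borel" "S \<subseteq> cell a" for S \<delta>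
  proof (rule integrableI_bounded_set[where A = "cell a" and B = 1])
    show "emeasure lborel (cell a) < \<infinity>" using emeasure_compact_finite[OF compact_cell] .
    show "AE x in lborel. x \<in> cell a \<longrightarrow> norm (indicator S x * mon lam \<delta> x) \<le> 1"
      using mon_bounds by (auto simp: indicator_def)
  qed (use that in \<open>auto simp: indicator_def\<close>)
  have mon0: "mon lam (\<lambda>_. 0) x = 1" for x by (simp add: mon_def)
  have scaled: "(LINT x|lborel. indicator D x * mon lam \<gamma> x) =
      (1 - e) ^ N * (LINT x|lebesgue_on (cell a). mon lam \<gamma> (shrink l e x))" for \<gamma>
  proof -
    have "(LINT x|lborel. indicator D x * mon lam \<gamma> x)
        = (1 - e) ^ N * (LINT x|lborel. indicator D (shrink l e x) * mon lam \<gamma> (shrink l e x))"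
      unfolding N_def using assms by (intro integral_shrink) auto
    moreover have "indicator D (shrink l e x) = (indicator (cell a) x :: real)" for x
      using D_eq[of x] by (simp add: indicator_def)
    ultimately show ?thesis by (subst cell_integral_lborel) auto
  qed
  have vol_D: "(LINT x|lborel. indicator D x * mon lam (\<lambda>_. 0) x) = (1 - e) ^ N * vol"
    unfolding scaled unfolding mon0 integral_cell_const by simp
  have vol': "(LINT x|lborel. indicator (cell a) x * mon lam (\<lambda>_. 0) x) = vol"
    using cell_integral_lborel[of "mon lam (\<lambda>_. 0)"] unfolding mon0 integral_cell_const by simp
  have mom: "moment \<delta> = (LINT x|lborel. indicator (cell a) x * mon lam \<delta> x)"
    unfolding moment_def by (rule cell_integral_lborel) simp
  define E where "E x = indicator (cell a) x * mon lam \<delta> x - indicator D x * mon lam \<delta> x" for x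
  \<comment> \<open>Off \<open>D\<close> the monomial has a factor \<open>lam l < e\<close>, so
    \<open>E \<le> E0\<close>. The exponent 0 stands for the constant 1, so that
    \<open>scaled\<close> also yields the volume of \<open>D\<close>.\<close>
  define E0 where "E0 x = e * (indicator (cell a) x * mon lam (\<lambda>_. 0) x - indicator D x * mon lam (\<lambda>_. 0) x)" for x
  have iE: "integrable lborel E" "integrable lborel E0"
    unfolding E_def E0_def using sub by (auto intro!: bi)
  have E: "0 \<le> E x" "E x \<le> E0 x" for x
  proof -
    consider "x \<notin> cell a" | "x \<in> D" | "x \<in> cell a" "x \<notin> D" by blast
    then have "0 \<le> E x \<and> E x \<le> E0 x"
    proof cases
      case 3
      then have "lam l x < e" by (auto simp: D_def)
      have "mon lam \<delta> x = lam l x * mon lam (\<delta>(l := \<delta> l - 1)) x"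
      proof -
        have "\<delta> = (\<lambda>i. (if i = l then 1 else 0) + (\<delta>(l := \<delta> l - 1)) i)" using assms(1) by auto
        then have "mon lam \<delta> x = mon lam (\<lambda>i. (if i = l then 1 else 0) + (\<delta>(l := \<delta> l - 1)) i) x" by (rule arg_cong)
        then show ?thesis by (simp only: mon_add mon_single)
      qed
      also have "\<dots> \<le> lam l x * 1"
        using 3 mon_bounds by (intro mult_left_mono) (auto simp: cell_eq)
      finally show ?thesis using 3 mon_bounds[OF 3(1), of \<delta>] \<open>lam l x < e\<close> by (simp add: E_def E0_def mon0)
    qed (use sub assms in \<open>auto simp: E_def E0_def indicator_def subset_iff\<close>)
    then show "0 \<le> E x" "E x \<le> E0 x" by auto
  qed
  have "(LINT x|lborel. E x) = moment \<delta> - (1 - e) ^ N * (LINT x|lebesgue_on (cell a). mon lam \<delta> (shrink l e x))"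
    unfolding E_def mom scaled[symmetric] using sub by (intro Bochner_Integration.integral_diff bi) auto
  moreover have "0 \<le> (LINT x|lborel. E x)" using E by (intro Bochner_Integration.integral_nonneg) auto
  moreover have "(LINT x|lborel. E x) \<le> (LINT x|lborel. E0 x)"
    using E iE by (intro integral_mono) auto
  moreover have "(LINT x|lborel. E0 x) = e * (vol - (1 - e) ^ N * vol)"
  proof -
    have "(LINT x|lborel. indicator (cell a) x * mon lam (\<lambda>_. 0) x - indicator D x * mon lam (\<lambda>_. 0) x)
        = vol - (1 - e) ^ N * vol"
      unfolding vol'[symmetric] unfolding vol' vol_D[symmetric] using sub
      by (subst Bochner_Integration.integral_diff) (auto intro!: bi simp: vol')
    then show ?thesis unfolding E0_def by simp
  qed
  moreover have "e * (vol - (1 - e) ^ N * vol) \<le> real N * vol * e\<^sup>2"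
  proof -
    have "1 + real N * (- e) \<le> (1 + (- e)) ^ N" using assms by (intro Bernoulli_inequality) auto
    then have "e * vol * (1 - (1 - e) ^ N) \<le> e * vol * (real N * e)"
      using assms cell_measure_pos by (intro mult_left_mono) auto
    then show ?thesis by (simp add: algebra_simps power2_eq_square)
  qed
  ultimately show ?thesis unfolding N_def by linarith
qed

lemma cell_integral_bound:
  fixes f :: "real^'n \<Rightarrow> real"
  assumes "continuous_on UNIV f" "\<And>x. x \<in> cell a \<Longrightarrow> \<bar>f x\<bar> \<le> c"
  shows "\<bar>LINT x|lebesgue_on (cell a). f x\<bar> \<le> c * vol"
proof -
  have "\<bar>LINT x|lebesgue_on (cell a). f x\<bar> \<le> (LINT x|lebesgue_on (cell a). \<bar>f x\<bar>)"
    by (rule integral_abs_bound)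
  also have "\<dots> \<le> (LINT x|lebesgue_on (cell a). c)"
    using assms cell_lebesgue
    by (intro integral_mono integrable_cell continuous_intros) auto
  finally show ?thesis by (simp only: integral_cell_const)
qed

lemma continuous_shrink: "continuous_on S (shrink l e)"
  unfolding shrink_def[abs_def] by (intro continuous_intros)

text \<open>Divergence theorem for the field \<open>x - a\<^sub>l\<close>, obtained by comparing first-order terms in \<open>e\<close>.\<close>

lemma moment_rec:
  assumes "\<delta> l \<ge> 1"
  shows "real (\<delta> l) * moment (\<delta>(l := \<delta> l - 1)) = real ((\<Sum>i\<in>UNIV. \<delta> i) + CARD('n)) * moment \<delta>"
proof -
  define n where "n = \<delta> l"
  define \<delta>' where "\<delta>' = \<delta>(l := \<delta> l - 1)"
  define R0 where "R0 = (\<Sum>i\<in>UNIV - {l}. \<delta> i)"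
  \<comment> \<open>The power of \<open>1 - e\<close> picked up by the integrand: \<open>R0\<close>
    from the coordinates other than \<open>lam l\<close>, and N from the Jacobian of the
    homothety.\<close>
  define R where "R = R0 + CARD('n)"
  define w where "w x = (\<Prod>i\<in>UNIV - {l}. lam i x ^ \<delta> i)" for x
  have sumR: "(\<Sum>i\<in>UNIV. \<delta> i) + CARD('n) = n + R"
    by (simp add: R_def R0_def n_def sum.remove[of UNIV l])
  have mon_d: "mon lam \<delta> x = lam l x ^ n * w x" for x
    by (simp add: mon_def w_def n_def prod.remove[of UNIV l])
  have "(\<Prod>i\<in>UNIV - {l}. lam i x ^ \<delta>' i) = w x" for x
    unfolding w_def by (intro prod.cong) (auto simp: \<delta>'_def)
  then have mon_d': "mon lam \<delta>' x = lam l x ^ (n - 1) * w x" for x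
    by (simp add: mon_def n_def prod.remove[of UNIV l]) (simp add: \<delta>'_def)
  have mon_s: "mon lam \<delta> (shrink l e x) = (1 - e) ^ R0 * (lam l x + e * (1 - lam l x)) ^ n * w x" for e x
  proof -
    have "(\<Prod>i\<in>UNIV - {l}. lam i (shrink l e x) ^ \<delta> i) = (\<Prod>i\<in>UNIV - {l}. (1 - e) ^ \<delta> i * lam i x ^ \<delta> i)"
      by (intro prod.cong) (auto simp: bary_shrink power_mult_distrib)
    also have "\<dots> = (1 - e) ^ R0 * w x" by (simp add: prod.distrib R0_def w_def power_sum)
    finally show ?thesis by (simp add: mon_def n_def prod.remove[of UNIV l] bary_shrink)
  qed
  \<comment> \<open>The summands bound, in units of e^2: \<open>e2\<close>, then the two parts of
    \<open>R * e * (n * e * P + e2)\<close>, then \<open>e1 * B\<close>, with \<open>e1\<close> and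
    \<open>e2\<close> the Taylor remainders below.\<close>
  define C where "C = (real n)\<^sup>2 + real R * real n + real R * (real n)\<^sup>2 + (real R)\<^sup>2"
  define X where "X = real n * moment \<delta>' - real (n + R) * moment \<delta>"
  have main: "\<bar>X\<bar> \<le> (C + CARD('n)) * vol * e" if e: "0 < e" "e < 1" for e
  proof -
    \<comment> \<open>\<open>f\<close> is the transformed integrand minus the original one minus its
      first-order term in \<open>e\<close>; the integral of the bracket is \<open>X\<close>.\<close>
    define f where "f x = (1 - e) ^ CARD('n) * mon lam \<delta> (shrink l e x) - mon lam \<delta> x
       - e * (real n * mon lam \<delta>' x - real (n + R) * mon lam \<delta> x)" for x
    have cs: "continuous_on UNIV (\<lambda>x. mon lam \<delta> (shrink l e x))"
      by (rule continuous_on_compose2[OF continuous_mon continuous_shrink]) auto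
    have cf: "continuous_on UNIV f"
      unfolding f_def[abs_def] by (intro continuous_intros continuous_mon cs)
    have "\<bar>f x\<bar> \<le> C * e\<^sup>2" if x: "x \<in> cell a" for x
    proof -
      define L where "L = lam l x"
      have L: "0 \<le> L" "L \<le> 1" using x bary_le_1 by (auto simp: cell_eq L_def)
      have w: "0 \<le> w x" "w x \<le> 1"
        unfolding w_def using x bary_le_1[OF x] by (auto simp: cell_eq intro!: prod_nonneg prod_le_1 power_le_one)
      \<comment> \<open>\<open>n * P\<close> is the derivative of
        \<open>(L + e * (1 - L)) ^ n\<close> in \<open>e\<close> at 0.\<close>
      define P where "P = L ^ (n - 1) - L ^ n"
      define B where "B = (L + e * (1 - L)) ^ n"
      define A where "A = (1 - e) ^ R"
      define e1 where "e1 = A - 1 + real R * e"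
      define e2 where "e2 = B - L ^ n - real n * e * P"
      have "e * (1 - L) \<le> 1 * (1 - L)" using e L by (intro mult_right_mono) auto
      then have u: "0 \<le> L + e * (1 - L)" "L + e * (1 - L) \<le> 1" using e L by auto
      have B: "0 \<le> B" "B \<le> 1" unfolding B_def using u by (auto intro: power_le_one)
      have P: "0 \<le> P" "P \<le> 1"
      proof -
        have "P = L ^ (n - 1) * (1 - L)" using assms by (cases n) (simp_all add: P_def n_def algebra_simps)
        then show "0 \<le> P" "P \<le> 1" using L by (auto intro!: mult_le_one power_le_one)
      qed
      have e1: "\<bar>e1\<bar> \<le> (real R)\<^sup>2 * e\<^sup>2"
        using power_taylor[of 1 "-1" e R] e by (simp add: e1_def A_def)
      have P_eq: "real n * e * (1 - L) * L ^ (n - 1) = real n * e * P"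
        using assms by (cases n) (simp_all add: P_def n_def algebra_simps)
      have e2: "\<bar>e2\<bar> \<le> (real n)\<^sup>2 * e\<^sup>2"
        using power_taylor[of L "1 - L" e n] e L u unfolding e2_def B_def P_eq[symmetric] by simp
      have "f x = (A * B - L ^ n - e * (real n * P - real R * L ^ n)) * w x"
        unfolding f_def mon_s unfolding mon_d mon_d' A_def B_def P_def L_def[symmetric] R_def
        by (simp add: algebra_simps power_add)
      also have "A * B - L ^ n - e * (real n * P - real R * L ^ n)
          = e2 - real R * e * (real n * e * P + e2) + e1 * B"
        unfolding e1_def e2_def by (simp add: algebra_simps)
      finally have fx: "f x = (e2 - real R * e * (real n * e * P + e2) + e1 * B) * w x" .
      have "\<bar>real n * e * P + e2\<bar> \<le> real n * e + (real n)\<^sup>2 * e\<^sup>2"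
      proof -
        have "\<bar>real n * e * P\<bar> \<le> real n * e" using P e by (simp add: abs_mult mult_left_le)
        then show ?thesis using e2 by linarith
      qed
      then have "real R * e * \<bar>real n * e * P + e2\<bar> \<le> real R * e * (real n * e + (real n)\<^sup>2 * e\<^sup>2)"
        using e by (intro mult_left_mono) auto
      also have "\<dots> = real R * real n * e\<^sup>2 + real R * (real n)\<^sup>2 * (e * e\<^sup>2)"
        by (simp add: algebra_simps power2_eq_square)
      also have "\<dots> \<le> real R * real n * e\<^sup>2 + real R * (real n)\<^sup>2 * (1 * e\<^sup>2)"
        using e by (intro add_left_mono mult_left_mono mult_right_mono) auto
      finally have 2: "\<bar>real R * e * (real n * e * P + e2)\<bar> \<le> real R * real n * e\<^sup>2 + real R * (real n)\<^sup>2 * e\<^sup>2"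
        using e by (simp add: abs_mult)
      have 3: "\<bar>e1 * B\<bar> \<le> (real R)\<^sup>2 * e\<^sup>2"
        using mult_mono[OF e1 B(2)] B by (simp add: abs_mult)
      have "\<bar>e2 - real R * e * (real n * e * P + e2) + e1 * B\<bar> \<le> C * e\<^sup>2"
        using e2 2 3 by (simp add: C_def algebra_simps)
      then have "\<bar>e2 - real R * e * (real n * e * P + e2) + e1 * B\<bar> * w x \<le> C * e\<^sup>2 * 1"
        using w by (intro mult_mono) auto
      then show ?thesis using w by (simp add: fx abs_mult)
    qed
    then have "\<bar>LINT x|lebesgue_on (cell a). f x\<bar> \<le> C * e\<^sup>2 * vol"
      by (rule cell_integral_bound[OF cf])
    moreover have "(LINT x|lebesgue_on (cell a). f x) =
       (1 - e) ^ CARD('n) * (LINT x|lebesgue_on (cell a). mon lam \<delta> (shrink l e x)) - moment \<delta> - e * X"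
      unfolding f_def X_def moment_def using integrable_cell[OF cs] integrable_cell[OF continuous_mon]
      by simp
    moreover note shrink_estimate[of \<delta> l e]
    ultimately have "\<bar>e * X\<bar> \<le> C * e\<^sup>2 * vol + real CARD('n) * vol * e\<^sup>2"
      using assms e by linarith
    then have "e * \<bar>X\<bar> \<le> e * ((C + CARD('n)) * vol * e)"
      using e by (simp add: abs_mult power2_eq_square algebra_simps)
    then show ?thesis using e by simp
  qed
  have "\<bar>X\<bar> \<le> 0"
  proof (rule field_le_epsilon)
    fix r :: real assume "r > 0"
    define D where "D = (C + CARD('n)) * vol + 1"
    have "D > 0" using cell_measure_pos by (simp add: D_def C_def add_nonneg_pos)
    define e where "e = min (1 / 2) (r / D)"
    have e: "0 < e" "e < 1" "e \<le> r / D" using \<open>r > 0\<close> \<open>D > 0\<close> by (auto simp: e_def)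
    have "\<bar>X\<bar> \<le> (C + CARD('n)) * vol * e" by (rule main) (use e in auto)
    also have "\<dots> \<le> D * e" using e by (intro mult_right_mono) (auto simp: D_def)
    also have "\<dots> \<le> r" using e \<open>D > 0\<close> by (simp add: pos_le_divide_eq mult.commute)
    finally show "\<bar>X\<bar> \<le> 0 + r" by simp
  qed
  then show ?thesis unfolding sumR by (simp add: X_def n_def \<delta>'_def)
qed

end

text \<open>Dirichlet's formula for the mean value of a barycentric monomial over an
  N-simplex.\<close>

definition simplex_moment :: "nat \<Rightarrow> ('i::finite \<Rightarrow> nat) \<Rightarrow> real" where
  "simplex_moment N \<delta> = fact N * (\<Prod>i\<in>UNIV. fact (\<delta> i)) / fact ((\<Sum>i\<in>UNIV. \<delta> i) + N)"

context nondegenerate_element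
begin

text \<open>Both sides obey the recursion of \<open>moment_rec\<close>, which lowers one exponent,
  and they agree at exponent 0.\<close>

lemma moment_eq: "moment \<delta> = vol * simplex_moment CARD('n) \<delta>"
proof (induction "\<Sum>i\<in>UNIV. \<delta> i" arbitrary: \<delta>)
  case 0
  then have "\<delta> = (\<lambda>_. 0)" by (auto simp: fun_eq_iff)
  moreover have "mon lam (\<lambda>_. 0) = (\<lambda>x. 1)" by (simp add: mon_def fun_eq_iff)
  ultimately show ?case using integral_cell_const[of 1] by (simp add: moment_def simplex_moment_def)
next
  case (Suc s)
  have "\<exists>l. \<delta> l \<noteq> 0"
  proof (rule ccontr)
    assume "\<nexists>l. \<delta> l \<noteq> 0" then show False using Suc.hyps(2) by simp
  qed
  then obtain l where l: "\<delta> l \<ge> 1" by (auto simp: Suc_le_eq)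
  define \<delta>' where "\<delta>' = \<delta>(l := \<delta> l - 1)"
  have "(\<Sum>i\<in>UNIV - {l}. \<delta>' i) = (\<Sum>i\<in>UNIV - {l}. \<delta> i)"
    by (intro sum.cong) (auto simp: \<delta>'_def)
  then have s: "(\<Sum>i\<in>UNIV. \<delta>' i) = s"
    using Suc.hyps(2) l by (simp add: sum.remove[of UNIV l]) (simp add: \<delta>'_def)
  have "(\<Prod>i\<in>UNIV - {l}. fact (\<delta>' i)) = (\<Prod>i\<in>UNIV - {l}. fact (\<delta> i) :: real)"
    by (intro prod.cong) (auto simp: \<delta>'_def)
  moreover have "(fact (\<delta> l) :: real) = real (\<delta> l) * fact (\<delta>' l)"
    using l by (cases "\<delta> l") (simp_all add: \<delta>'_def)
  ultimately have P: "(\<Prod>i\<in>UNIV. fact (\<delta> i)) = real (\<delta> l) * (\<Prod>i\<in>UNIV. fact (\<delta>' i) :: real)"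
    by (simp add: prod.remove[of UNIV l])
  have simplex_moment: "real (Suc s + CARD('n)) * simplex_moment CARD('n) \<delta> = real (\<delta> l) * simplex_moment CARD('n) \<delta>'"
  proof -
    define r where "r = real (Suc s + CARD('n))"
    have "r \<noteq> 0" unfolding r_def by (metis add_Suc nat.distinct(1) of_nat_eq_0_iff)
    have "(fact ((\<Sum>i\<in>UNIV. \<delta> i) + CARD('n)) :: real) = r * fact (s + CARD('n))"
      unfolding Suc.hyps(2)[symmetric] r_def add_Suc fact_Suc by simp
    then show ?thesis
      unfolding r_def[symmetric] simplex_moment_def s P using \<open>r \<noteq> 0\<close> by simp
  qed
  have "real (Suc s + CARD('n)) * moment \<delta> = real (\<delta> l) * moment \<delta>'"
    using moment_rec[of \<delta> l] l Suc.hyps(2) by (simp add: \<delta>'_def)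
  also have "\<dots> = real (\<delta> l) * (vol * simplex_moment CARD('n) \<delta>')" using Suc.hyps(1)[of \<delta>'] s by simp
  also have "\<dots> = real (Suc s + CARD('n)) * (vol * simplex_moment CARD('n) \<delta>)"
    using arg_cong[OF simplex_moment, of "\<lambda>t. vol * t"] by (simp only: mult.left_commute)
  finally show ?case by (metis mult_left_cancel of_nat_eq_0_iff add_is_0 Suc_neq_Zero)
qed

text \<open>Where the exponent is positive, \<open>moment_rec\<close> turns each term into
  \<open>dlam l \<beta> * Z\<close> with one and the same \<open>Z\<close>. The numbers
  \<open>dlam l \<beta>\<close> sum to zero, so everything cancels except a missing term at
  \<open>i\<close>: a monomial containing all coordinates has no flux, and one missing only
  \<open>lam i\<close> has flux through facet i alone.\<close>

lemma integral_deriv_mon: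
  assumes "\<And>l. l \<noteq> i \<Longrightarrow> \<delta> l \<ge> 1"
  shows "(LINT x|lebesgue_on (cell a). (\<Sum>l\<in>UNIV. real (\<delta> l) * dlam l \<beta> * mon lam (\<delta>(l := \<delta> l - 1)) x))
    = (if \<delta> i = 0 then - dlam i \<beta> * (real ((\<Sum>i\<in>UNIV. \<delta> i) + CARD('n)) * (vol * simplex_moment CARD('n) \<delta>)) else 0)"
proof -
  define Z where "Z = real ((\<Sum>i\<in>UNIV. \<delta> i) + CARD('n)) * moment \<delta>"
  have "(LINT x|lebesgue_on (cell a). (\<Sum>l\<in>UNIV. real (\<delta> l) * dlam l \<beta> * mon lam (\<delta>(l := \<delta> l - 1)) x))
     = (\<Sum>l\<in>UNIV. dlam l \<beta> * (real (\<delta> l) * moment (\<delta>(l := \<delta> l - 1))))"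
    using integrable_cell[OF continuous_mon] by (simp add: moment_def mult_ac)
  also have "\<dots> = (\<Sum>l\<in>UNIV. dlam l \<beta> * Z - (if l = i \<and> \<delta> i = 0 then dlam l \<beta> * Z else 0))"
  proof (intro sum.cong refl)
    fix l
    show "dlam l \<beta> * (real (\<delta> l) * moment (\<delta>(l := \<delta> l - 1)))
        = dlam l \<beta> * Z - (if l = i \<and> \<delta> i = 0 then dlam l \<beta> * Z else 0)"
    proof (cases "\<delta> l = 0")
      case True
      then have "l = i" using assms[of l] by force
      then show ?thesis using True by simp
    next
      case False
      then show ?thesis using moment_rec[of \<delta> l] by (auto simp: Z_def)
    qed
  qed
  also have "\<dots> = (\<Sum>l\<in>UNIV. dlam l \<beta>) * Z - (if \<delta> i = 0 then dlam i \<beta> * Z else 0)"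
    by (cases "\<delta> i = 0") (simp_all add: sum_subtractf sum_distrib_right cong: if_cong)
  finally show ?thesis by (simp add: sum_dlam Z_def moment_eq)
qed

end

section \<open>Polynomials as forms in the barycentric coordinates\<close>

lemma has_derivative_mon_coord:
  fixes \<alpha> :: "'i::finite \<Rightarrow> nat"
  shows "((\<lambda>s. mon (\<lambda>i t. t i) \<alpha> (t(l := s))) has_real_derivative
    real (\<alpha> l) * mon (\<lambda>i t. t i) (\<alpha>(l := \<alpha> l - 1)) (t(l := s))) (at s)"
proof -
  define w where "w = (\<Prod>i\<in>UNIV - {l}. t i ^ \<alpha> i)"
  have "(\<Prod>i\<in>UNIV - {l}. (t(l := s)) i ^ \<alpha> i) = w" for s
    unfolding w_def by (intro prod.cong) auto
  then have "mon (\<lambda>i t. t i) \<alpha> (t(l := s)) = s ^ \<alpha> l * w" for s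
    by (simp add: mon_def prod.remove[of UNIV l])
  moreover have "(\<Prod>i\<in>UNIV - {l}. (t(l := s)) i ^ (\<alpha>(l := \<alpha> l - 1)) i) = w"
    unfolding w_def by (intro prod.cong) auto
  then have "mon (\<lambda>i t. t i) (\<alpha>(l := \<alpha> l - 1)) (t(l := s)) = s ^ (\<alpha> l - 1) * w"
    by (simp add: mon_def prod.remove[of UNIV l])
  moreover have "((\<lambda>s. s ^ \<alpha> l * w) has_real_derivative real (\<alpha> l) * (s ^ (\<alpha> l - 1) * w)) (at s)"
    by (auto intro!: derivative_eq_intros)
  ultimately show ?thesis by simp
qed

text \<open>By induction on the degree: a partial derivative of a vanishing form vanishes.\<close>

lemma form_coeffs_zero:
  fixes c :: "('i::finite \<Rightarrow> nat) \<Rightarrow> real"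
  assumes "\<And>t. (\<And>i. t i > 0) \<Longrightarrow> lincomb (mon (\<lambda>i t. t i)) (hidx (int k)) c t = 0"
    and "\<alpha> \<in> hidx (int k)"
  shows "c \<alpha> = 0"
  using assms
proof (induction k arbitrary: c \<alpha>)
  case 0
  have "hidx 0 = {\<lambda>_::'i. 0}"
    by (auto simp: hidx_def fun_eq_iff simp flip: of_nat_sum)
  then show ?case using "0.prems"(1)[of "\<lambda>_. 1"] "0.prems"(2) by (simp add: lincomb_def mon_def)
next
  case (Suc k)
  have sumS: "(\<Sum>i\<in>UNIV. \<alpha> i) = Suc k" using Suc.prems(2) by (simp add: hidx_def del: of_nat_sum)
  have "\<exists>l. \<alpha> l \<noteq> 0"
  proof (rule ccontr)
    assume "\<nexists>l. \<alpha> l \<noteq> 0" then show False using sumS by simp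
  qed
  then obtain l where l: "\<alpha> l \<noteq> 0" ..
  \<comment> \<open>The coefficients of the partial derivative of the form in the variable
    \<open>l\<close>.\<close>
  define c' where "c' \<gamma> = c (\<gamma>(l := \<gamma> l + 1)) * real (\<gamma> l + 1)" for \<gamma>
  have sum_upd: "(\<Sum>i\<in>UNIV. (\<gamma>(l := m)) i) + \<gamma> l = (\<Sum>i\<in>UNIV. \<gamma> i) + m" for \<gamma> :: "'i \<Rightarrow> nat" and m
  proof -
    have "(\<Sum>i\<in>UNIV - {l}. (\<gamma>(l := m)) i) = (\<Sum>i\<in>UNIV - {l}. \<gamma> i)" by (intro sum.cong) auto
    then show ?thesis by (simp add: sum.remove[of UNIV l])
  qed
  have zero: "lincomb (mon (\<lambda>i t. t i)) (hidx (int k)) c' t = 0" if t: "\<And>i. t i > 0" for t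
  proof -
    define f where "f s = lincomb (mon (\<lambda>i t. t i)) (hidx (int (Suc k))) c (t(l := s))" for s
    have "(f has_real_derivative (\<Sum>\<gamma>\<in>hidx (int (Suc k)).
        c \<gamma> * (real (\<gamma> l) * mon (\<lambda>i t. t i) (\<gamma>(l := \<gamma> l - 1)) (t(l := t l))))) (at (t l))"
      unfolding f_def[abs_def] lincomb_def
      by (intro DERIV_sum DERIV_cmult has_derivative_mon_coord)
    moreover have "(f has_real_derivative 0) (at (t l))"
    proof (rule has_field_derivative_transform_within_open)
      show "((\<lambda>s. 0) has_real_derivative 0) (at (t l))" by simp
      show "0 = f s" if "s \<in> {0<..}" for s
        unfolding f_def using that t by (intro Suc.prems(1)[symmetric]) auto
    qed (use t in auto)
    ultimately have "0 = (\<Sum>\<gamma>\<in>hidx (int (Suc k)). c \<gamma> * (real (\<gamma> l) * mon (\<lambda>i t. t i) (\<gamma>(l := \<gamma> l - 1)) t))"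
      using DERIV_unique by fastforce
    also have "\<dots> = (\<Sum>\<gamma>\<in>{\<gamma> \<in> hidx (int (Suc k)). \<gamma> l \<noteq> 0}. c \<gamma> * (real (\<gamma> l) * mon (\<lambda>i t. t i) (\<gamma>(l := \<gamma> l - 1)) t))"
      by (rule sum.mono_neutral_right) auto
    also have "\<dots> = (\<Sum>\<gamma>\<in>hidx (int k). c' \<gamma> * mon (\<lambda>i t. t i) \<gamma> t)"
    proof (rule sum.reindex_bij_witness[of _ "\<lambda>\<gamma>. \<gamma>(l := \<gamma> l + 1)" "\<lambda>\<gamma>. \<gamma>(l := \<gamma> l - 1)"])
      show "\<gamma>(l := \<gamma> l - 1) \<in> hidx (int k)" if "\<gamma> \<in> {\<gamma> \<in> hidx (int (Suc k)). \<gamma> l \<noteq> 0}" for \<gamma>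
        using that sum_upd[of \<gamma> "\<gamma> l - 1"] by (auto simp: hidx_def simp del: of_nat_sum)
      show "\<gamma>(l := \<gamma> l + 1) \<in> {\<gamma> \<in> hidx (int (Suc k)). \<gamma> l \<noteq> 0}" if "\<gamma> \<in> hidx (int k)" for \<gamma>
        using that sum_upd[of \<gamma> "\<gamma> l + 1"] by (auto simp: hidx_def simp del: of_nat_sum)
    qed (auto simp: c'_def)
    finally show ?thesis by (simp add: lincomb_def)
  qed
  have "\<alpha>(l := \<alpha> l - 1) \<in> hidx (int k)"
    using sum_upd[of \<alpha> "\<alpha> l - 1"] l sumS by (simp add: hidx_def del: of_nat_sum)
  from Suc.IH[OF zero this] have "c' (\<alpha>(l := \<alpha> l - 1)) = 0" .
  moreover have "(\<alpha>(l := \<alpha> l - 1))(l := (\<alpha>(l := \<alpha> l - 1)) l + 1) = \<alpha>" using l by auto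
  ultimately show ?case unfolding c'_def by auto
qed

lemma hidx_neg: "j < 0 \<Longrightarrow> hidx j = {}"
  by (auto simp: hidx_def simp del: of_nat_sum)

lemma hidx_1: "hidx 1 = range (\<lambda>(i::'i::finite) j. if j = i then 1 else 0)"
proof (intro equalityI subsetI)
  fix \<alpha> :: "'i \<Rightarrow> nat" assume "\<alpha> \<in> hidx 1"
  then have s: "(\<Sum>i\<in>UNIV. \<alpha> i) = 1" by (simp add: hidx_def del: of_nat_sum)
  then obtain l where "\<alpha> l = 1" "\<And>j. j \<noteq> l \<Longrightarrow> \<alpha> j = 0"
    using sum_eq_1_iff[of UNIV \<alpha>] by auto
  then have "\<alpha> = (\<lambda>j. if j = l then 1 else 0)" by auto
  then show "\<alpha> \<in> range (\<lambda>i j. if j = i then 1 else 0)" by (rule range_eqI)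
qed (auto simp: hidx_def simp del: of_nat_sum)

context nondegenerate_element
begin

abbreviation hp :: "int \<Rightarrow> (('n option \<Rightarrow> nat) \<Rightarrow> real) \<Rightarrow> real^'n \<Rightarrow> real" where
  "hp j \<equiv> lincomb (mon lam) (hidx j)"

text \<open>The constant 1 is the m-th power of the sum of the barycentric coordinates, hence a form
  of every degree.\<close>

lemma hspan_one: "(\<lambda>_. 1) \<in> mspan lam (hidx (int m))"
proof (induction m)
  case 0
  have "mon lam (\<lambda>_. 0) \<in> mspan lam (hidx 0)" by (rule span_base[OF finite_hidx]) (simp add: hidx_def)
  moreover have "mon lam (\<lambda>_. 0) = (\<lambda>_. 1)" by (simp add: mon_def fun_eq_iff)
  ultimately show ?case by simp
next
  case (Suc m)
  have "lam i \<in> mspan lam (hidx 1)" for i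
    using span_base[of "hidx 1" "\<lambda>j. if j = i then 1 else 0" "mon lam"] by (simp add: mon_single hidx_1)
  then have "(\<lambda>x. \<Sum>i\<in>UNIV. lam i x) \<in> mspan lam (hidx 1)" by (intro span_sum)
  then have "(\<lambda>x. 1) \<in> mspan lam (hidx 1)" by (simp add: sum_bary)
  have "(\<lambda>x. 1 * 1) \<in> mspan lam (hidx (int m + 1))"
    by (rule mspan_mult[OF finite_hidx _ Suc \<open>(\<lambda>x. 1) \<in> mspan lam (hidx 1)\<close>]) (rule hidx_add)
  then show ?case by (simp add: add.commute)
qed

lemma hspan_mult:
  assumes "f \<in> mspan lam (hidx (int i))" "g \<in> mspan lam (hidx (int j))"
  shows "(\<lambda>x. f x * g x) \<in> mspan lam (hidx (int (i + j)))"
  unfolding of_nat_add by (rule mspan_mult[OF finite_hidx _ assms]) (rule hidx_add)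

lemma hspan_mono:
  assumes "f \<in> mspan lam (hidx (int i))" "i \<le> j"
  shows "f \<in> mspan lam (hidx (int j))"
  using hspan_mult[OF assms(1) hspan_one[of "j - i"]] assms(2) by simp

lemma hspan_coord: "(\<lambda>x. x $ k) \<in> mspan lam (hidx (int 1))"
proof -
  have eq: "(\<lambda>x. x $ k) = (\<lambda>x. \<Sum>i\<in>UNIV. a i $ k * lam i x)"
  proof
    show "x $ k = (\<Sum>i\<in>UNIV. a i $ k * lam i x)" for x
      using arg_cong[OF bary_comb[of x], of "\<lambda>y. y $ k"] by (simp add: mult.commute)
  qed
  have "lam i \<in> mspan lam (hidx 1)" for i
    using span_base[of "hidx 1" "\<lambda>j. if j = i then 1 else 0" "mon lam"] by (simp add: mon_single hidx_1)
  then have "(\<lambda>x. \<Sum>i\<in>UNIV. a i $ k * lam i x) \<in> mspan lam (hidx 1)"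
    by (intro span_sum span_scale)
  then show ?thesis unfolding eq by simp
qed

lemma dlam_axis: "dlam i x = (\<Sum>k\<in>UNIV. dlam i (axis k 1) * x $ k)"
proof -
  have "x = (\<Sum>k\<in>UNIV. x $ k *\<^sub>R axis k 1)"
    using basis_expansion[of x] by (simp add: scalar_mult_eq_scaleR)
  then have "dlam i x = dlam i (\<Sum>k\<in>UNIV. x $ k *\<^sub>R axis k 1)" by (rule arg_cong)
  then show ?thesis
    using linear_dlam[of i] by (simp add: linear_sum linear_cmul mult.commute)
qed

text \<open>Degree at most \<open>j\<close> in Cartesian coordinates is degree exactly
  \<open>j\<close> in barycentric ones: forms of lower degree are raised by
  \<open>hspan_mono\<close>, and the coordinates of each kind are affine functions of the
  other.\<close>

lemma poly_space_eq_hspan: "poly_space j = mspan lam (hidx j)"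
proof (cases "j < 0")
  case True
  have "{\<alpha> :: 'n \<Rightarrow> nat. int (\<Sum>i\<in>UNIV. \<alpha> i) \<le> j} = {}"
    using True by (auto simp del: of_nat_sum)
  then show ?thesis using True by (simp add: poly_space_eq_mspan hidx_neg lincomb_def[abs_def])
next
  case False
  then obtain k where k: "j = int k" using zero_le_imp_eq_int[of j] by auto
  have "mon (\<lambda>i x. x $ i) \<alpha> \<in> mspan lam (hidx (int (\<Sum>i\<in>UNIV. \<alpha> i)))" for \<alpha> :: "'n \<Rightarrow> nat"
    by (rule graded_mon[where P = "\<lambda>m. mspan lam (hidx (int m))", OF _ hspan_mult hspan_coord])
       (use hspan_one[of 0] in simp)
  then have "mon (\<lambda>i x. x $ i) \<alpha> \<in> mspan lam (hidx j)" if "int (\<Sum>i\<in>UNIV. \<alpha> i) \<le> j" for \<alpha> :: "'n \<Rightarrow> nat"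
    using that hspan_mono unfolding k by (metis of_nat_le_iff)
  then have "poly_space j \<subseteq> mspan lam (hidx j)"
    unfolding poly_space_eq_mspan lincomb_def[of "mon (\<lambda>i x. x $ i)", abs_def]
    by (auto intro!: span_sum span_scale)
  moreover have ps: "lam i \<in> poly_space (int 1)" for i
  proof -
    have "(\<lambda>x. \<Sum>k\<in>UNIV. dlam i (axis k 1) * x $ k) \<in> poly_space 1"
      using poly_space_coord unfolding poly_space_eq_mspan by (intro span_sum span_scale) blast
    then have "(\<lambda>x. lam i 0 + (\<Sum>k\<in>UNIV. dlam i (axis k 1) * x $ k)) \<in> poly_space 1"
      using poly_space_const[of 1 "lam i 0"] unfolding poly_space_eq_mspan by (intro span_add) auto
    then show ?thesis unfolding dlam_axis[symmetric] bary_affine[symmetric] of_nat_1 .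
  qed
  have "mon lam \<alpha> \<in> poly_space (int (\<Sum>i\<in>UNIV. \<alpha> i))" for \<alpha>
    by (rule graded_mon[where P = "\<lambda>m. poly_space (int m)", OF _ _ ps])
       (use poly_space_const[of 0] in \<open>auto dest: poly_space_mult\<close>)
  then have "mon lam \<alpha> \<in> poly_space j" if "\<alpha> \<in> hidx j" for \<alpha>
    using that unfolding hidx_def mem_Collect_eq by metis
  then have "mspan lam (hidx j) \<subseteq> poly_space j"
    unfolding poly_space_eq_mspan lincomb_def[of "mon lam", abs_def]
    by (auto intro!: span_sum span_scale)
  ultimately show ?thesis by blast
qed

lemma mon_scaled:
  assumes "\<And>i. t i = S * lam i x" "\<alpha> \<in> hidx (int k)"
  shows "mon (\<lambda>i t. t i) \<alpha> t = S ^ k * mon lam \<alpha> x"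
proof -
  have "(\<Sum>i\<in>UNIV. \<alpha> i) = k" using assms(2) by (simp add: hidx_def del: of_nat_sum)
  then show ?thesis
    by (simp add: mon_def assms(1) power_mult_distrib prod.distrib flip: power_sum)
qed

text \<open>Each positive vector is a multiple of the coordinates of some interior point, so by
  homogeneity vanishing inside the cell means vanishing on the positive orthant.\<close>

lemma hp_zero:
  assumes "\<And>x. (\<And>i. lam i x > 0) \<Longrightarrow> hp j c x = 0" "\<alpha> \<in> hidx j"
  shows "c \<alpha> = 0"
proof -
  have "\<not> j < 0" using assms(2) hidx_neg by blast
  then obtain k where k: "j = int k" using zero_le_imp_eq_int[of j] by auto
  show ?thesis
  proof (rule form_coeffs_zero)
    show "\<alpha> \<in> hidx (int k)" using assms(2) k by simp
    fix t :: "'n option \<Rightarrow> real" assume t: "\<And>i. t i > 0"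
    define S where "S = (\<Sum>i\<in>UNIV. t i)"
    have "S > 0" unfolding S_def using t by (intro sum_pos) auto
    have "(\<Sum>i\<in>UNIV. t i / S) = 1" using \<open>S > 0\<close> by (simp add: S_def sum_divide_distrib[symmetric])
    from point_with_coords[OF this] obtain x where x: "\<forall>i. lam i x = t i / S" ..
    have "lincomb (mon (\<lambda>i t. t i)) (hidx (int k)) c t = S ^ k * hp (int k) c x"
      unfolding lincomb_def sum_distrib_left
      using mon_scaled[of t S x _ k] x \<open>S > 0\<close> by (intro sum.cong) auto
    also have "hp (int k) c x = 0" using assms(1)[of x] x t \<open>S > 0\<close> k by simp
    finally show "lincomb (mon (\<lambda>i t. t i)) (hidx (int k)) c t = 0" by simp
  qed
qed

text \<open>On facet i only the monomials without \<open>lam i\<close> survive, and they form a form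
  in the remaining coordinates. Taken over all i: a polynomial vanishing on the boundary contains
  every coordinate in each of its monomials.\<close>

lemma hp_frontier_zero:
  assumes "\<And>x. x \<in> frontier (cell a) \<Longrightarrow> hp j c x = 0" "\<alpha> \<in> hidx j" "\<alpha> i = 0"
  shows "c \<alpha> = 0"
proof -
  have "\<not> j < 0" using assms(2) hidx_neg by blast
  then obtain k where k: "j = int k" using zero_le_imp_eq_int[of j] by auto
  define c' where "c' \<gamma> = (if \<gamma> i = 0 then c \<gamma> else 0)" for \<gamma>
  have "c' \<alpha> = 0"
  proof (rule form_coeffs_zero)
    show "\<alpha> \<in> hidx (int k)" using assms(2) k by simp
    fix t :: "'n option \<Rightarrow> real" assume t: "\<And>i. t i > 0"
    \<comment> \<open>A second index keeps the sum \<open>S\<close> positive after the coordinate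
      \<open>i\<close> has been set to 0.\<close>
    obtain i' where "i' \<noteq> i" by (metis option.distinct(1))
    define u where "u = t(i := 0)"
    have u: "u l \<ge> 0" "u i' > 0" for l using t \<open>i' \<noteq> i\<close> by (auto simp: u_def less_imp_le)
    define S where "S = (\<Sum>i\<in>UNIV. u i)"
    have "S > 0" unfolding S_def using u by (intro sum_pos2[of _ i']) auto
    have "(\<Sum>i\<in>UNIV. u i / S) = 1" using \<open>S > 0\<close> by (simp add: S_def sum_divide_distrib[symmetric])
    from point_with_coords[OF this] obtain x where x: "\<forall>i. lam i x = u i / S" ..
    have "x \<in> frontier (cell a)"
      using x u \<open>S > 0\<close> by (intro frontier_cellI[of _ i]) (auto simp: cell_eq u_def)
    have "c' \<gamma> * mon (\<lambda>i t. t i) \<gamma> t = S ^ k * (c \<gamma> * mon lam \<gamma> x)" if "\<gamma> \<in> hidx (int k)" for \<gamma>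
    proof (cases "\<gamma> i = 0")
      case True
      then have "mon (\<lambda>i t. t i) \<gamma> t = mon (\<lambda>i t. t i) \<gamma> u"
        unfolding mon_def u_def by (intro prod.cong) auto
      then show ?thesis using mon_scaled[of u S x \<gamma> k] x \<open>S > 0\<close> that True by (simp add: c'_def)
    next
      case False
      then have "mon lam \<gamma> x = 0"
        unfolding mon_def using x by (intro prod_zero) (auto simp: u_def intro!: exI[of _ i])
      then show ?thesis using False by (simp add: c'_def)
    qed
    then have "lincomb (mon (\<lambda>i t. t i)) (hidx (int k)) c' t = S ^ k * hp (int k) c x"
      unfolding lincomb_def sum_distrib_left by (intro sum.cong) auto
    then show "lincomb (mon (\<lambda>i t. t i)) (hidx (int k)) c' t = 0"
      using assms(1)[OF \<open>x \<in> frontier (cell a)\<close>] k by simp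
  qed
  then show ?thesis using assms(3) by (simp add: c'_def)
qed

end

section \<open>Shape of the element\<close>

lemma sum_option: "(\<Sum>i\<in>UNIV. f i) = f None + (\<Sum>j\<in>UNIV. f (Some j))"
  for f :: "'i::finite option \<Rightarrow> 'b::comm_monoid_add"
  by (simp add: UNIV_option_conv sum.reindex)

context nondegenerate_element
begin

abbreviation h :: real where "h \<equiv> diameter (cell a)"

lemma vertex_in_cell: "a i \<in> cell a"
  by (simp add: cell_def hull_inc)

lemma edge_le_diameter: "norm (a i - a j) \<le> h"
  using diameter_bounded_bound[OF compact_imp_bounded[OF compact_cell] vertex_in_cell vertex_in_cell]
  by (simp add: dist_norm)

lemma diameter_pos: "h > 0"
proof -
  have "a None \<noteq> a (Some undefined)" using nondeg by (auto simp: nondegenerate_def inj_def)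
  then have "0 < norm (a None - a (Some undefined))" by simp
  then show ?thesis using edge_le_diameter by (rule less_le_trans)
qed

lemma norm_le_sum_dlam: "norm \<beta> \<le> h * (\<Sum>i\<in>UNIV. \<bar>dlam i \<beta>\<bar>)"
proof -
  have "\<beta> = (\<Sum>i\<in>UNIV. dlam i \<beta> *\<^sub>R (a i - a None))"
    by (simp add: scaleR_diff_right sum_subtractf dlam_comb sum_dlam flip: scaleR_sum_left)
  then have "norm \<beta> \<le> (\<Sum>i\<in>UNIV. norm (dlam i \<beta> *\<^sub>R (a i - a None)))"
    by (metis norm_sum)
  also have "\<dots> \<le> (\<Sum>i\<in>UNIV. \<bar>dlam i \<beta>\<bar> * h)"
    by (intro sum_mono) (simp add: mult_left_mono edge_le_diameter)
  finally show ?thesis by (simp add: sum_distrib_left mult.commute)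
qed

text \<open>The numbers \<open>dlam i \<beta>\<close> sum to zero. The largest is at least
  \<open>M * \<rho>\<close> with M = N + 1, by \<open>norm_le_sum_dlam\<close>; the other N numbers
  could not balance it if all were below \<open>\<rho>\<close>.\<close>

lemma two_large_dlam:
  assumes "\<beta> \<noteq> 0"
  defines "\<rho> \<equiv> norm \<beta> / h / (real CARD('n option))\<^sup>2"
  shows "\<exists>i j. i \<noteq> j \<and> \<rho> \<le> \<bar>dlam i \<beta>\<bar> \<and> \<rho> \<le> \<bar>dlam j \<beta>\<bar>"
proof -
  define M where "M = real CARD('n option)"
  have "M \<ge> 1" by (simp add: M_def)
  have "\<rho> > 0" unfolding \<rho>_def M_def[symmetric] using assms(1) diameter_pos \<open>M \<ge> 1\<close> by simp
  have "Max (range (\<lambda>i. \<bar>dlam i \<beta>\<bar>)) \<in> range (\<lambda>i. \<bar>dlam i \<beta>\<bar>)" by (intro Max_in) auto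
  then obtain i where "Max (range (\<lambda>i. \<bar>dlam i \<beta>\<bar>)) = \<bar>dlam i \<beta>\<bar>" by (elim rangeE)
  then have i: "\<bar>dlam j \<beta>\<bar> \<le> \<bar>dlam i \<beta>\<bar>" for j
    by (metis Max_ge finite_imageI finite rangeI)
  have "(\<Sum>j\<in>UNIV. \<bar>dlam j \<beta>\<bar>) \<le> (\<Sum>j\<in>(UNIV :: 'n option set). \<bar>dlam i \<beta>\<bar>)"
    by (intro sum_mono i)
  also have "\<dots> = M * \<bar>dlam i \<beta>\<bar>" by (simp add: M_def)
  finally have "norm \<beta> \<le> h * (M * \<bar>dlam i \<beta>\<bar>)"
    using norm_le_sum_dlam[of \<beta>] diameter_pos by (meson mult_left_mono less_imp_le order_trans)
  then have "norm \<beta> / h / M \<le> \<bar>dlam i \<beta>\<bar>"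
    using diameter_pos \<open>M \<ge> 1\<close> by (simp add: divide_le_eq mult_ac)
  moreover have "norm \<beta> / h / M = M * \<rho>"
    using \<open>M \<ge> 1\<close> unfolding \<rho>_def M_def[symmetric] by (simp add: power2_eq_square)
  ultimately have large: "M * \<rho> \<le> \<bar>dlam i \<beta>\<bar>" by simp
  have "\<exists>j. j \<noteq> i \<and> \<rho> \<le> \<bar>dlam j \<beta>\<bar>"
  proof (rule ccontr)
    assume "\<not> ?thesis"
    then have small: "\<bar>dlam j \<beta>\<bar> \<le> \<rho>" if "j \<noteq> i" for j using that by force
    have "dlam i \<beta> + (\<Sum>j\<in>UNIV - {i}. dlam j \<beta>) = 0"
      using sum_dlam[of \<beta>] by (simp add: sum.remove[of UNIV i])
    then have "\<bar>dlam i \<beta>\<bar> = \<bar>\<Sum>j\<in>UNIV - {i}. dlam j \<beta>\<bar>" by linarith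
    also have "\<dots> \<le> (\<Sum>j\<in>UNIV - {i}. \<bar>dlam j \<beta>\<bar>)" by (rule sum_abs)
    also have "\<dots> \<le> (\<Sum>j\<in>UNIV - {i}. \<rho>)" using small by (intro sum_mono) auto
    also have "\<dots> = (M - 1) * \<rho>" by (simp add: M_def card_Diff_singleton)
    finally show False using large \<open>\<rho> > 0\<close> by (simp add: algebra_simps)
  qed
  moreover have "\<rho> \<le> M * \<rho>" using \<open>M \<ge> 1\<close> \<open>\<rho> > 0\<close> by simp
  ultimately show ?thesis using large by (metis order_trans)
qed

lemma elem_matrix_mult: "elem_matrix a *v v = (\<Sum>j\<in>UNIV. v $ j *\<^sub>R (a (Some j) - a None))"
  by (simp add: vec_eq_iff matrix_vector_mult_def elem_matrix_def mult.commute)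

lemma elem_matrix_dlam: "elem_matrix a *v (\<chi> j. dlam (Some j) \<beta>) = \<beta>"
proof -
  have "dlam None \<beta> = - (\<Sum>j\<in>UNIV. dlam (Some j) \<beta>)"
    using sum_dlam[of \<beta>] by (simp add: sum_option)
  moreover have "\<beta> = dlam None \<beta> *\<^sub>R a None + (\<Sum>j\<in>UNIV. dlam (Some j) \<beta> *\<^sub>R a (Some j))"
    using dlam_comb[of \<beta>] by (simp add: sum_option)
  ultimately show ?thesis
    by (simp add: elem_matrix_mult scaleR_diff_right sum_subtractf flip: scaleR_sum_left)
qed

lemma matrix_inv_dlam: "matrix_inv (elem_matrix a) *v \<beta> = (\<chi> j. dlam (Some j) \<beta>)"
proof -
  have "surj ((*v) (elem_matrix a))" using elem_matrix_dlam by (metis surjI)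
  then have "\<exists>B. elem_matrix a ** B = mat 1" by (simp add: matrix_right_invertible_surjective)
  then have "invertible (elem_matrix a)" by (simp add: invertible_right_inverse)
  from someI_ex[OF this[unfolded invertible_def]]
  have "matrix_inv (elem_matrix a) ** elem_matrix a = mat 1" unfolding matrix_inv_def by blast
  then have "matrix_inv (elem_matrix a) *v (elem_matrix a *v v) = v" for v
    by (simp add: matrix_vector_mul_assoc)
  from this[of "\<chi> j. dlam (Some j) \<beta>"] show ?thesis by (simp add: elem_matrix_dlam)
qed

lemma norm_matrix_mult_le: "norm (M *v x) \<le> matrix_norm M * norm x"
  unfolding matrix_norm_def by (rule onorm) (simp add: matrix_vector_mul_bounded_linear)

text \<open>The columns of the matrix are the edges at \<open>a None\<close>, so the cell lies in
  the ball about that vertex whose radius is the matrix norm.\<close>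

lemma diameter_le_matrix_norm: "h \<le> 2 * matrix_norm (elem_matrix a)"
proof -
  define r where "r = matrix_norm (elem_matrix a)"
  have "norm (a (Some j) - a None) \<le> r" for j
  proof -
    have "elem_matrix a *v axis j 1 = a (Some j) - a None"
      by (simp add: elem_matrix_mult axis_def if_distrib if_distribR cong: if_cong)
    then show ?thesis using norm_matrix_mult_le[of "elem_matrix a" "axis j 1"] by (simp add: r_def norm_axis_1)
  qed
  moreover have "0 \<le> r" unfolding r_def matrix_norm_def
    by (rule onorm_pos_le) (simp add: matrix_vector_mul_bounded_linear)
  ultimately have "a i \<in> cball (a None) r" for i
    by (cases i) (simp_all add: dist_norm norm_minus_commute)
  then have "cell a \<subseteq> cball (a None) r"
    unfolding cell_def by (intro hull_minimal) auto
  then have "dist x y \<le> 2 * r" if "x \<in> cell a" "y \<in> cell a" for x y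
  proof -
    have "dist (a None) x \<le> r" "dist (a None) y \<le> r"
      using that \<open>cell a \<subseteq> cball (a None) r\<close> by (auto simp: mem_cball)
    then show ?thesis using dist_triangle3[of x y "a None"] by linarith
  qed
  then show ?thesis unfolding r_def[symmetric] using \<open>0 \<le> r\<close>
    by (intro diameter_le) (auto simp: dist_norm)
qed

text \<open>The inverse matrix sends \<open>\<beta>\<close> to the numbers
  \<open>dlam (Some j) \<beta>\<close>, and its norm is at most 2 kappa / h by
  \<open>diameter_le_matrix_norm\<close>. The remaining index \<open>None\<close> is minus the sum
  of the N others, whence the factor, rounded up to N + 1.\<close>

lemma dlam_upper:
  assumes "matrix_norm (elem_matrix a) * matrix_norm (matrix_inv (elem_matrix a)) \<le> \<kappa>"
  shows "\<bar>dlam i \<beta>\<bar> \<le> 2 * \<kappa> * real CARD('n option) * (norm \<beta> / h)"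
proof -
  define r where "r = matrix_norm (matrix_inv (elem_matrix a))"
  have "0 \<le> r" unfolding r_def matrix_norm_def
    by (rule onorm_pos_le) (simp add: matrix_vector_mul_bounded_linear)
  have "h * r \<le> 2 * matrix_norm (elem_matrix a) * r"
    using diameter_le_matrix_norm \<open>0 \<le> r\<close> by (rule mult_right_mono)
  then have "h * r \<le> 2 * \<kappa>" using assms unfolding r_def by linarith
  then have "r * h \<le> 2 * \<kappa>" by (simp add: mult.commute)
  then have "r \<le> 2 * \<kappa> / h" using diameter_pos by (simp add: pos_le_divide_eq)
  then have "r * norm \<beta> \<le> 2 * \<kappa> / h * norm \<beta>" by (rule mult_right_mono) simp
  then have "r * norm \<beta> \<le> 2 * \<kappa> * (norm \<beta> / h)" by simp
  moreover have "\<bar>dlam (Some j) \<beta>\<bar> \<le> r * norm \<beta>" for j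
    using component_le_norm_cart[of "\<chi> j. dlam (Some j) \<beta>" j]
      norm_matrix_mult_le[of "matrix_inv (elem_matrix a)" \<beta>]
    by (simp add: matrix_inv_dlam r_def)
  ultimately have some: "\<bar>dlam (Some j) \<beta>\<bar> \<le> 2 * \<kappa> * (norm \<beta> / h)" for j
    by (meson order_trans)
  define X where "X = 2 * \<kappa> * (norm \<beta> / h)"
  have "X \<ge> 0" using some[of undefined] unfolding X_def by linarith
  have "\<bar>dlam i \<beta>\<bar> \<le> X * real CARD('n option)"
  proof (cases i)
    case None
    have "dlam None \<beta> = - (\<Sum>j\<in>UNIV. dlam (Some j) \<beta>)"
      using sum_dlam[of \<beta>] by (simp add: sum_option)
    then have "\<bar>dlam i \<beta>\<bar> \<le> (\<Sum>j\<in>UNIV. \<bar>dlam (Some j) \<beta>\<bar>)" using None by (simp add: sum_abs)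
    also have "\<dots> \<le> (\<Sum>j\<in>(UNIV::'n set). X)" unfolding X_def by (intro sum_mono some)
    also have "\<dots> \<le> X * real CARD('n option)" using \<open>X \<ge> 0\<close> by (simp add: algebra_simps card_UNIV_option)
    finally show ?thesis .
  next
    case (Some j)
    then have "\<bar>dlam i \<beta>\<bar> \<le> X * 1" using some[of j] by (simp add: X_def)
    also have "\<dots> \<le> X * real CARD('n option)" using \<open>X \<ge> 0\<close> by (intro mult_left_mono) (simp_all add: card_UNIV_option)
    finally show ?thesis .
  qed
  then show ?thesis by (simp add: X_def mult_ac)
qed

section \<open>Gradients of the barycentric coordinates and facet normals\<close>

definition grad :: "'n option \<Rightarrow> real^'n" where
  "grad i = (\<chi> k. dlam i (axis k 1))"

lemma grad_inner: "grad i \<bullet> v = dlam i v"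
proof -
  have "v = (\<Sum>k\<in>UNIV. v $ k *\<^sub>R axis k 1)"
    using basis_expansion[of v] by (simp add: scalar_mult_eq_scaleR)
  then have "dlam i v = dlam i (\<Sum>k\<in>UNIV. v $ k *\<^sub>R axis k 1)" by (rule arg_cong)
  also have "\<dots> = grad i \<bullet> v"
    using linear_dlam[of i] by (simp add: linear_sum linear_cmul grad_def inner_vec_def mult.commute)
  finally show ?thesis by simp
qed

lemma bary_diff: "lam i x - lam i y = grad i \<bullet> (x - y)"
  using bary_add[of i y 1 "x - y"] by (simp add: grad_inner)

lemma grad_edge: "i \<noteq> j \<Longrightarrow> grad i \<bullet> (a i - a j) = 1"
  using bary_diff[of i "a i" "a j"] by (simp add: bary_vertex)

lemma other_index: "\<exists>j :: 'n option. j \<noteq> i"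
  by (cases i) auto

text \<open>The gradient has length one over the altitude on facet i; here it is tested against an
  edge, whose length is at most the diameter.\<close>

lemma norm_grad_ge: "1 / h \<le> norm (grad i)"
proof -
  obtain j where "j \<noteq> i" using other_index by blast
  then have "1 \<le> norm (grad i) * norm (a i - a j)"
    using grad_edge[of i j] Cauchy_Schwarz_ineq2[of "grad i" "a i - a j"] by auto
  also have "\<dots> \<le> norm (grad i) * h" by (intro mult_left_mono edge_le_diameter) simp
  finally show ?thesis using diameter_pos by (simp add: divide_le_eq)
qed

lemma norm_grad_pos: "norm (grad i) > 0"
  by (rule less_le_trans[OF divide_pos_pos[OF zero_less_one diameter_pos] norm_grad_ge])

lemma facet_bary: "x \<in> facet a i \<Longrightarrow> lam i x = 0"
proof -
  have "convex {x. lam i x = 0}"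
  proof (rule convexI)
    fix x y :: "real^'n" and u v :: real
    assume *: "x \<in> {x. lam i x = 0}" "y \<in> {x. lam i x = 0}" "u + v = 1"
    have "lam i (x + v *\<^sub>R (y - x)) = lam i x + v * dlam i (y - x)" by (rule bary_add)
    moreover have "dlam i (y - x) = 0" using * bary_diff[of i y x] by (simp add: grad_inner)
    moreover have "x + v *\<^sub>R (y - x) = u *\<^sub>R x + v *\<^sub>R y"
      using *(3) by (simp add: algebra_simps flip: scaleR_add_left)
    ultimately show "u *\<^sub>R x + v *\<^sub>R y \<in> {x. lam i x = 0}" using * by simp
  qed
  then have "facet a i \<subseteq> {x. lam i x = 0}"
    unfolding facet_def by (intro hull_minimal) (auto simp: bary_vertex)
  then show "x \<in> facet a i \<Longrightarrow> lam i x = 0" by blast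
qed

lemma vertex_in_facet: "j \<noteq> i \<Longrightarrow> a j \<in> facet a i"
  unfolding facet_def by (intro hull_inc) auto

text \<open>Uniqueness: a candidate is orthogonal to all edges within the facet, so it is determined
  by its value on one edge leaving it, as the gradient is; length and sign then fix the
  factor.\<close>

lemma normal_eq: "normal a i = - (1 / norm (grad i)) *\<^sub>R grad i"
  unfolding normal_def
proof (rule the_equality)
  have "grad i \<bullet> (x - y) = 0" if "x \<in> facet a i" "y \<in> facet a i" for x y
    using that facet_bary bary_diff[of i x y] by simp
  moreover have "grad i \<bullet> (a i - x) > 0" if "x \<in> facet a i" for x
    using that facet_bary bary_diff[of i "a i" x] by (simp add: bary_vertex)
  ultimately show "norm (- (1 / norm (grad i)) *\<^sub>R grad i) = 1
      \<and> (\<forall>x\<in>facet a i. \<forall>y\<in>facet a i. - (1 / norm (grad i)) *\<^sub>R grad i \<bullet> (x - y) = 0)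
      \<and> (\<forall>x\<in>facet a i. - (1 / norm (grad i)) *\<^sub>R grad i \<bullet> (a i - x) < 0)"
    using norm_grad_pos[of i] by simp
next
  fix n :: "real^'n"
  assume n: "norm n = 1 \<and> (\<forall>x\<in>facet a i. \<forall>y\<in>facet a i. n \<bullet> (x - y) = 0)
      \<and> (\<forall>x\<in>facet a i. n \<bullet> (a i - x) < 0)"
  obtain j where j: "j \<noteq> i" using other_index by blast
  define c where "c = n \<bullet> (a i - a j)"
  have "c < 0" using n vertex_in_facet[OF j] by (simp add: c_def)
  have "n \<bullet> v = (c *\<^sub>R grad i) \<bullet> v" for v
  proof -
    have "v = (\<Sum>l\<in>UNIV. dlam l v *\<^sub>R (a l - a j))"
      by (simp add: scaleR_diff_right sum_subtractf dlam_comb sum_dlam flip: scaleR_sum_left)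
    then have "n \<bullet> v = n \<bullet> (\<Sum>l\<in>UNIV. dlam l v *\<^sub>R (a l - a j))" by (rule arg_cong)
    also have "\<dots> = (\<Sum>l\<in>UNIV. dlam l v * (n \<bullet> (a l - a j)))" by (simp add: inner_sum_right)
    also have "\<dots> = (\<Sum>l\<in>UNIV. if l = i then dlam l v * c else 0)"
      using n vertex_in_facet j by (intro sum.cong) (auto simp: c_def)
    finally show ?thesis by (simp add: grad_inner)
  qed
  then have nc: "n = c *\<^sub>R grad i" by (metis vector_eq_rdot)
  then have "1 = - c * norm (grad i)" using n \<open>c < 0\<close> by simp
  then have "c = - (1 / norm (grad i))" using norm_grad_pos[of i] by (simp add: field_simps)
  then show "n = - (1 / norm (grad i)) *\<^sub>R grad i" using nc by simp
qed

text \<open>\<open>lam i\<close> grows from facet i towards \<open>a i\<close>, against the outward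
  normal. This is where the minus sign in \<open>signed_bubble_eq\<close> comes from.\<close>

lemma sgn_normal: "sgn (\<beta> \<bullet> normal a i) = - sgn (dlam i \<beta>)"
proof -
  have "\<beta> \<bullet> normal a i = - (1 / norm (grad i)) * dlam i \<beta>"
    by (simp add: normal_eq inner_commute grad_inner[symmetric])
  then show ?thesis using norm_grad_pos[of i] by (simp add: sgn_mult)
qed

lemma dlam_lower:
  assumes "\<bar>\<beta> \<bullet> normal a i\<bar> \<ge> \<theta> * norm \<beta>" "\<theta> \<ge> 0"
  shows "\<bar>dlam i \<beta>\<bar> \<ge> \<theta> * (norm \<beta> / h)"
proof -
  have "\<beta> \<bullet> normal a i = - (1 / norm (grad i)) * dlam i \<beta>"
    by (simp add: normal_eq inner_commute grad_inner[symmetric])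
  then have "\<bar>dlam i \<beta>\<bar> = \<bar>\<beta> \<bullet> normal a i\<bar> * norm (grad i)"
    using norm_grad_pos[of i] by (simp add: abs_mult)
  also have "\<dots> \<ge> (\<theta> * norm \<beta>) * (1 / h)"
    using assms norm_grad_ge diameter_pos by (intro mult_mono) auto
  finally show ?thesis by simp
qed

end

section \<open>The boundary form\<close>

lemma bform_weighted:
  "bform A (\<lambda>a b. \<Sum>i\<in>I. w i * m i a b) c d = (\<Sum>i\<in>I. w i * bform A (m i) c d)"
proof -
  have "bform A (\<lambda>a b. \<Sum>i\<in>I. w i * m i a b) c d = (\<Sum>a\<in>A. \<Sum>b\<in>A. \<Sum>i\<in>I. w i * (c a * d b * m i a b))"
    by (simp add: bform_def sum_distrib_left mult_ac)
  also have "\<dots> = (\<Sum>i\<in>I. \<Sum>a\<in>A. \<Sum>b\<in>A. w i * (c a * d b * m i a b))"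
    by (subst sum.swap[of _ I]) (simp add: sum.swap[of _ _ I])
  finally show ?thesis by (simp add: bform_def sum_distrib_left)
qed

text \<open>The exponent vector of the facet bubble b_i; its degree is N.\<close>

definition facet_idx :: "'i \<Rightarrow> 'i \<Rightarrow> nat" where
  "facet_idx i l = (if l = i then 0 else 1)"

text \<open>The boundary form \<open>\<integral>\<^bsub>F\<^sub>i\<^esub> b\<^sub>i w y\<close> in barycentric coefficients: on the facet only monomials without
  \<open>\<lambda>\<^sub>i\<close> survive, and facet moments are volume moments up to a factor.\<close>

definition facet_form :: "nat \<Rightarrow> 'i::finite \<Rightarrow> ('i \<Rightarrow> nat) \<Rightarrow> ('i \<Rightarrow> nat) \<Rightarrow> real" where
  "facet_form N i \<alpha> \<gamma> = (if \<alpha> i = 0 \<and> \<gamma> i = 0 then simplex_moment N (\<lambda>l. \<alpha> l + \<gamma> l + facet_idx i l) else 0)"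

text \<open>Restriction to facet i at the level of coefficients. It lets \<open>facet_form\<close>
  be written as the integral of a weighted square.\<close>

definition facet_part :: "'i \<Rightarrow> (('i \<Rightarrow> nat) \<Rightarrow> real) \<Rightarrow> ('i \<Rightarrow> nat) \<Rightarrow> real" where
  "facet_part i c \<alpha> = (if \<alpha> i = 0 then c \<alpha> else 0)"

text \<open>The form (z', b z)_K divided by the volume; the shift of every exponent by 1 is the
  bubble.\<close>

definition bubble_form :: "nat \<Rightarrow> ('i::finite \<Rightarrow> nat) \<Rightarrow> ('i \<Rightarrow> nat) \<Rightarrow> real" where
  "bubble_form N \<alpha> \<gamma> = simplex_moment N (\<lambda>l. \<alpha> l + \<gamma> l + 1)"

text \<open>The polynomials vanishing on the boundary are spanned by the monomials with all
  exponents positive. Orthogonality to these is a condition on moments, where the volume is a common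
  factor, so the set is the same for every element.\<close>

definition perp_coefs :: "nat \<Rightarrow> int \<Rightarrow> (('i::finite \<Rightarrow> nat) \<Rightarrow> real) set" where
  "perp_coefs N j = coefs (hidx j) ((\<lambda>t \<gamma>. simplex_moment N (\<lambda>l. t l + \<gamma> l)) ` {t \<in> hidx j. \<forall>l. t l \<ge> 1})"

text \<open>Sets of facets on which a zero trace forces an element of P_j^perp to vanish. For degree
  1 two facets suffice: each single coordinate survives on at least one of them.\<close>

definition unisolvent :: "int \<Rightarrow> 'i set \<Rightarrow> bool" where
  "unisolvent j I \<longleftrightarrow> I = UNIV \<or> (j = 1 \<and> (\<exists>i\<in>I. \<exists>l\<in>I. i \<noteq> l))"

text \<open>No element occurs, only the index type, so one \<open>\<kappa>\<close> can be fixed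
  before any mesh is given. It covers all admissible sets \<open>I\<close> and both blocks of the
  system.\<close>

definition coercive :: "'i::finite itself \<Rightarrow> nat \<Rightarrow> int \<Rightarrow> real \<Rightarrow> bool" where
  "coercive T N j \<kappa> \<longleftrightarrow> \<kappa> > 0 \<and>
     (\<forall>I :: 'i set. unisolvent j I \<longrightarrow> (\<forall>c\<in>perp_coefs N j.
        \<kappa> * (l1_norm (hidx j) c)\<^sup>2 \<le> (\<Sum>i\<in>I. bform (hidx j) (facet_form N i) c c))) \<and>
     (\<forall>c :: ('i \<Rightarrow> nat) \<Rightarrow> real. c \<in> coefs (hidx (j - 2)) {} \<longrightarrow>
        \<kappa> * (l1_norm (hidx (j - 2)) c)\<^sup>2 \<le> bform (hidx (j - 2)) (bubble_form N) c c)"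

lemma facet_form_sym: "facet_form N i \<alpha> \<gamma> = facet_form N i \<gamma> \<alpha>"
  by (simp add: facet_form_def add.commute)

lemma bubble_form_sym: "bubble_form N \<alpha> \<gamma> = bubble_form N \<gamma> \<alpha>"
  by (simp add: bubble_form_def add.commute)

lemma perp_coefs_outside: "c \<in> perp_coefs N j \<Longrightarrow> \<alpha> \<notin> hidx j \<Longrightarrow> c \<alpha> = 0"
  by (simp add: perp_coefs_def coefs_def)

context nondegenerate_element
begin

lemma continuous_hp: "continuous_on S (hp j c)"
  unfolding lincomb_def[abs_def] by (intro continuous_intros continuous_mon)

lemma integral_mon3:
  "(LINT x|lebesgue_on (cell a). hp j c x * hp j' d x * mon lam \<delta> x)
    = vol * (\<Sum>\<alpha>\<in>hidx j. \<Sum>\<gamma>\<in>hidx j'. c \<alpha> * d \<gamma> * simplex_moment CARD('n) (\<lambda>l. \<alpha> l + \<gamma> l + \<delta> l))"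
proof -
  have "hp j c x * hp j' d x * mon lam \<delta> x
     = (\<Sum>\<alpha>\<in>hidx j. \<Sum>\<gamma>\<in>hidx j'. c \<alpha> * d \<gamma> * mon lam (\<lambda>l. \<alpha> l + \<gamma> l + \<delta> l) x)" for x
    unfolding lincomb_mult sum_distrib_right mon_add by (simp add: mult_ac)
  then have "(LINT x|lebesgue_on (cell a). hp j c x * hp j' d x * mon lam \<delta> x)
     = (\<Sum>\<alpha>\<in>hidx j. \<Sum>\<gamma>\<in>hidx j'. c \<alpha> * d \<gamma> * moment (\<lambda>l. \<alpha> l + \<gamma> l + \<delta> l))"
    using integrable_cell[OF continuous_mon] by (simp add: moment_def)
  then show ?thesis by (simp add: moment_eq sum_distrib_left mult_ac)
qed

lemma mon_zero [simp]: "mon lam (\<lambda>_. 0) x = 1"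
  by (simp add: mon_def)

lemma integral_mon2:
  "(LINT x|lebesgue_on (cell a). hp j c x * hp j' d x)
    = vol * (\<Sum>\<alpha>\<in>hidx j. \<Sum>\<gamma>\<in>hidx j'. c \<alpha> * d \<gamma> * simplex_moment CARD('n) (\<lambda>l. \<alpha> l + \<gamma> l))"
  using integral_mon3[of j c j' d "\<lambda>_. 0"] by simp

lemma hspan_coefs:
  assumes "f \<in> poly_space j"
  obtains c where "f = hp j c" "\<And>\<alpha>. \<alpha> \<notin> hidx j \<Longrightarrow> c \<alpha> = 0"
proof -
  obtain c where "f = hp j c" using assms unfolding poly_space_eq_hspan by blast
  then show ?thesis
    using that[of "\<lambda>\<alpha>. if \<alpha> \<in> hidx j then c \<alpha> else 0"] by (simp add: lincomb_zero_outside)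
qed

lemma hp_poly_space: "hp j c \<in> poly_space j"
  unfolding poly_space_eq_hspan by simp

text \<open>Both inclusions rest on the description of the polynomials vanishing on the frontier as
  combinations of monomials containing every coordinate; testing with those monomials
  suffices.\<close>

lemma poly_space_perp_eq: "poly_space_perp j (cell a) = hp j ` perp_coefs CARD('n) j"
proof (intro equalityI subsetI)
  fix y assume y: "y \<in> poly_space_perp j (cell a)"
  then have "y \<in> poly_space j" by (simp add: poly_space_perp_def)
  then obtain c where c: "y = hp j c" "\<And>\<alpha>. \<alpha> \<notin> hidx j \<Longrightarrow> c \<alpha> = 0" using hspan_coefs by blast
  have "(\<Sum>\<gamma>\<in>hidx j. c \<gamma> * simplex_moment CARD('n) (\<lambda>l. t l + \<gamma> l)) = 0" if t: "t \<in> hidx j" "\<forall>l. t l \<ge> 1" for t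
  proof -
    define d where "d = (\<lambda>\<alpha>. if \<alpha> = t then 1 else 0 :: real)"
    have d: "hp j d = mon lam t" unfolding d_def by (rule ext) (rule lincomb_single[OF finite_hidx t(1)])
    have "mon lam t x = 0" if "x \<in> frontier (cell a)" for x
      using frontier_cellD(2)[OF that] t(2) unfolding mon_def
      by (auto intro!: prod_zero simp: Suc_le_eq)
    then have "hp j d \<in> poly_space0 j (cell a)"
      using hp_poly_space[of j d] by (simp add: poly_space0_def d)
    then have "pairing (cell a) y (hp j d) = 0" using y by (simp add: poly_space_perp_def)
    then have "(\<Sum>\<gamma>\<in>hidx j. \<Sum>\<alpha>\<in>hidx j. c \<gamma> * d \<alpha> * simplex_moment CARD('n) (\<lambda>l. \<gamma> l + \<alpha> l)) = 0"
      using cell_measure_pos by (simp add: pairing_def c(1) integral_mon2)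
    moreover have "(\<Sum>\<alpha>\<in>hidx j. c \<gamma> * d \<alpha> * simplex_moment CARD('n) (\<lambda>l. \<gamma> l + \<alpha> l)) = c \<gamma> * simplex_moment CARD('n) (\<lambda>l. \<gamma> l + t l)" for \<gamma>
      using t(1) by (simp add: d_def if_distrib if_distribR cong: if_cong)
    ultimately show ?thesis by (simp add: add.commute)
  qed
  then have "c \<in> perp_coefs CARD('n) j" using c(2) by (auto simp: perp_coefs_def coefs_def)
  then show "y \<in> hp j ` perp_coefs CARD('n) j" using c(1) by blast
next
  fix y assume "y \<in> hp j ` perp_coefs CARD('n) j"
  then obtain c where c: "c \<in> perp_coefs CARD('n) j" "y = hp j c" by blast
  have "pairing (cell a) y z = 0" if z: "z \<in> poly_space0 j (cell a)" for z
  proof -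
    have "z \<in> poly_space j" using z by (simp add: poly_space0_def)
    then obtain d where d: "z = hp j d" by (rule hspan_coefs)
    have 0: "d \<alpha> = 0" if \<alpha>: "\<alpha> \<in> hidx j" "\<not> (\<forall>l. \<alpha> l \<ge> 1)" for \<alpha>
    proof -
      obtain i where "\<alpha> i = 0" using \<alpha>(2) by (auto simp: not_le)
      show ?thesis
        by (rule hp_frontier_zero[of j d, OF _ \<alpha>(1) \<open>\<alpha> i = 0\<close>])
           (use z in \<open>simp add: poly_space0_def d\<close>)
    qed
    have "(\<Sum>\<gamma>\<in>hidx j. c \<gamma> * d \<alpha> * simplex_moment CARD('n) (\<lambda>l. \<gamma> l + \<alpha> l)) = 0" if "\<alpha> \<in> hidx j" for \<alpha>
    proof (cases "\<forall>l. \<alpha> l \<ge> 1")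
      case True
      then have "(\<Sum>\<gamma>\<in>hidx j. c \<gamma> * simplex_moment CARD('n) (\<lambda>l. \<alpha> l + \<gamma> l)) = 0"
        using c(1) that by (auto simp: perp_coefs_def coefs_def)
      then have "d \<alpha> * (\<Sum>\<gamma>\<in>hidx j. c \<gamma> * simplex_moment CARD('n) (\<lambda>l. \<gamma> l + \<alpha> l)) = 0" by (simp add: add.commute)
      then show ?thesis by (simp only: sum_distrib_left mult_ac)
    qed (use 0 that in simp)
    then show ?thesis
      unfolding pairing_def c(2) d integral_mon2 by (subst sum.swap) simp
  qed
  then show "y \<in> poly_space_perp j (cell a)"
    using hp_poly_space c(2) by (simp add: poly_space_perp_def)
qed

lemma mon_pos: "(\<And>i. lam i x > 0) \<Longrightarrow> mon lam \<delta> x > 0"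
  by (simp add: mon_def prod_pos)

lemma hp_square_nonneg: "0 \<le> (LINT x|lebesgue_on (cell a). hp j c x * hp j c x * mon lam \<delta> x)"
  using cell_lebesgue
  by (intro Bochner_Integration.integral_nonneg_AE AE_I2 mult_nonneg_nonneg[OF zero_le_square] mon_bounds) auto

lemma hp_square_zero:
  assumes "(LINT x|lebesgue_on (cell a). hp j c x * hp j c x * mon lam \<delta> x) = 0" "\<alpha> \<in> hidx j"
  shows "c \<alpha> = 0"
proof (rule hp_zero[OF _ assms(2)])
  fix x assume x: "\<And>i. lam i x > 0"
  have "hp j c x * hp j c x * mon lam \<delta> x = 0"
    by (rule set_nonneg_integral_zero[OF compact_cell _ _ assms(1) interior_cellI[OF x]])
       (intro continuous_intros continuous_hp continuous_mon mult_nonneg_nonneg[OF zero_le_square] mon_bounds)+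
  then show "hp j c x = 0" using mon_pos[OF x, of \<delta>] by simp
qed

text \<open>A square against the nonnegative weight b_i: the form is semidefinite, and it vanishes
  only if no monomial without \<open>lam i\<close> is present.\<close>

lemma facet_form_integral:
  "vol * bform (hidx j) (facet_form CARD('n) i) c c = (LINT x|lebesgue_on (cell a).
     hp j (facet_part i c) x * hp j (facet_part i c) x * mon lam (facet_idx i) x)"
  unfolding integral_mon3 bform_def
  by (intro arg_cong[where f = "\<lambda>t. vol * t"] sum.cong) (auto simp: facet_form_def facet_part_def)

lemma facet_form_nonneg: "bform (hidx j) (facet_form CARD('n) (i :: 'n option)) c c \<ge> 0"
proof -
  have "vol * bform (hidx j) (facet_form CARD('n) i) c c \<ge> 0"
    unfolding facet_form_integral by (rule hp_square_nonneg)
  then show ?thesis using cell_measure_pos by (simp add: zero_le_mult_iff)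
qed

lemma facet_form_zero:
  fixes i :: "'n option"
  assumes "bform (hidx j) (facet_form CARD('n) i) c c = 0" "\<alpha> \<in> hidx j" "\<alpha> i = 0"
  shows "c \<alpha> = 0"
proof -
  have "facet_part i c \<alpha> = 0"
    by (rule hp_square_zero[OF _ assms(2)]) (use assms(1) facet_form_integral[of j i c] in simp)
  then show ?thesis using assms by (simp add: facet_part_def)
qed

text \<open>If the sum vanishes, each single form does, and every monomial missing some coordinate
  of \<open>I\<close> has coefficient zero. By unisolvence the remaining monomials contain all
  coordinates, so the polynomial lies in the space to which it is orthogonal, and is zero.\<close>

lemma facet_forms_pos:
  fixes I :: "'n option set"
  assumes c: "c \<in> perp_coefs CARD('n) j" "c \<noteq> (\<lambda>_. 0)" and I: "unisolvent j I"
  shows "(\<Sum>i\<in>I. bform (hidx j) (facet_form CARD('n) i) c c) > 0"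
proof (rule ccontr)
  assume "\<not> ?thesis"
  then have "(\<Sum>i\<in>I. bform (hidx j) (facet_form CARD('n) i) c c) = 0"
    using sum_nonneg[of I "\<lambda>i. bform (hidx j) (facet_form CARD('n) i) c c"] facet_form_nonneg by force
  then have z: "\<forall>i\<in>I. bform (hidx j) (facet_form CARD('n) i) c c = 0"
    using facet_form_nonneg by (subst (asm) sum_nonneg_eq_0_iff) auto
  have supp: "c \<alpha> = 0" if "\<alpha> \<in> hidx j" "\<not> (\<forall>l. \<alpha> l \<ge> 1)" for \<alpha>
  proof -
    have "\<exists>i\<in>I. \<alpha> i = 0"
    proof (cases "I = UNIV")
      case True then show ?thesis using that(2) by (auto simp: not_le)
    next
      case False
      then obtain i l where il: "j = 1" "i \<in> I" "l \<in> I" "i \<noteq> l" using I by (auto simp: unisolvent_def)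
      then have "\<alpha> i = 0 \<or> \<alpha> l = 0" using that(1) by (auto simp: hidx_1)
      then show ?thesis using il by auto
    qed
    then show ?thesis using facet_form_zero z that(1) by blast
  qed
  have "(\<Sum>\<gamma>\<in>hidx j. c \<alpha> * c \<gamma> * simplex_moment CARD('n) (\<lambda>l. \<alpha> l + \<gamma> l)) = 0" if "\<alpha> \<in> hidx j" for \<alpha>
  proof (cases "\<forall>l. \<alpha> l \<ge> 1")
    case True
    then have "c \<alpha> * (\<Sum>\<gamma>\<in>hidx j. c \<gamma> * simplex_moment CARD('n) (\<lambda>l. \<alpha> l + \<gamma> l)) = 0"
      using c(1) that by (auto simp: perp_coefs_def coefs_def)
    then show ?thesis by (simp only: sum_distrib_left mult_ac)
  qed (use supp that in simp)
  then have "(LINT x|lebesgue_on (cell a). hp j c x * hp j c x * mon lam (\<lambda>_. 0) x) = 0"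
    by (simp add: integral_mon2)
  then have "c \<alpha> = 0" if "\<alpha> \<in> hidx j" for \<alpha> using that by (rule hp_square_zero)
  moreover have "c \<alpha> = 0" if "\<alpha> \<notin> hidx j" for \<alpha> using c(1) that by (rule perp_coefs_outside)
  ultimately show False using c(2) by blast
qed

lemma bubble_form_pos:
  fixes c :: "('n option \<Rightarrow> nat) \<Rightarrow> real"
  assumes c: "c \<in> coefs (hidx j) {}" "c \<noteq> (\<lambda>_. 0)"
  shows "bform (hidx j) (bubble_form CARD('n)) c c > 0"
proof (rule ccontr)
  assume *: "\<not> ?thesis"
  have eq: "vol * bform (hidx j) (bubble_form CARD('n)) c c
    = (LINT x|lebesgue_on (cell a). hp j c x * hp j c x * mon lam (\<lambda>_. 1) x)"
    unfolding integral_mon3 bform_def bubble_form_def by simp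
  have "0 \<le> vol * bform (hidx j) (bubble_form CARD('n)) c c"
    unfolding eq by (rule hp_square_nonneg)
  then have "vol * bform (hidx j) (bubble_form CARD('n)) c c = 0"
    using * cell_measure_pos by (simp add: zero_le_mult_iff)
  then have "(LINT x|lebesgue_on (cell a). hp j c x * hp j c x * mon lam (\<lambda>_. 1) x) = 0"
    unfolding eq .
  then have "c \<alpha> = 0" if "\<alpha> \<in> hidx j" for \<alpha> using that by (rule hp_square_zero)
  moreover have "c \<alpha> = 0" if "\<alpha> \<notin> hidx j" for \<alpha> using c that by (simp add: coefs_def)
  ultimately show False using c(2) by blast
qed

lemma coercive_exists: "\<exists>\<kappa>. coercive TYPE('n option) CARD('n) j \<kappa>"
proof -
  have "\<exists>\<kappa>>0. \<forall>c\<in>perp_coefs CARD('n) j. \<kappa> * (l1_norm (hidx j) c)\<^sup>2 \<le> (\<Sum>i\<in>I. bform (hidx j) (facet_form CARD('n) i) c c)"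
    if I: "unisolvent j I" for I :: "'n option set"
  proof -
    have eq: "bform (hidx j) (\<lambda>\<alpha> \<gamma>. \<Sum>i\<in>I. facet_form CARD('n) i \<alpha> \<gamma>) c c
        = (\<Sum>i\<in>I. bform (hidx j) (facet_form CARD('n) i) c c)" for c
      using bform_weighted[where A = "hidx j" and I = I and w = "\<lambda>_. 1" and m = "facet_form CARD('n)"] by simp
    obtain \<kappa> where "\<kappa> > 0" "\<And>c. c \<in> perp_coefs CARD('n) j \<Longrightarrow>
        \<kappa> * (l1_norm (hidx j) c)\<^sup>2 \<le> bform (hidx j) (\<lambda>\<alpha> \<gamma>. \<Sum>i\<in>I. facet_form CARD('n) i \<alpha> \<gamma>) c c"
      unfolding perp_coefs_def
      by (rule bform_coercive[OF finite_hidx, of j _ "\<lambda>\<alpha> \<gamma>. \<Sum>i\<in>I. facet_form CARD('n) i \<alpha> \<gamma>"])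
         (use facet_forms_pos I in \<open>auto simp: eq perp_coefs_def\<close>)
    then show ?thesis unfolding eq by blast
  qed
  then have "\<forall>I :: 'n option set. \<exists>\<kappa>. unisolvent j I \<longrightarrow> \<kappa> > 0 \<and> (\<forall>c\<in>perp_coefs CARD('n) j.
      \<kappa> * (l1_norm (hidx j) c)\<^sup>2 \<le> (\<Sum>i\<in>I. bform (hidx j) (facet_form CARD('n) i) c c))"
    by blast
  from choice[OF this] obtain f where f: "\<forall>I :: 'n option set. unisolvent j I \<longrightarrow> f I > 0 \<and>
      (\<forall>c\<in>perp_coefs CARD('n) j. f I * (l1_norm (hidx j) c)\<^sup>2 \<le> (\<Sum>i\<in>I. bform (hidx j) (facet_form CARD('n) i) c c))" ..
  obtain \<kappa>2 where \<kappa>2: "\<kappa>2 > 0" "\<And>c. c \<in> coefs (hidx (j - 2)) {} \<Longrightarrow>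
      \<kappa>2 * (l1_norm (hidx (j - 2)) c)\<^sup>2 \<le> bform (hidx (j - 2)) (bubble_form CARD('n) :: ('n option \<Rightarrow> nat) \<Rightarrow> _) c c"
    by (rule bform_coercive[OF finite_hidx, of "j - 2" "{}" "bubble_form CARD('n)"]) (use bubble_form_pos in auto)
  \<comment> \<open>There are finitely many index sets \<open>I\<close>, so the minimum is
    positive.\<close>
  define \<kappa> where "\<kappa> = Min (insert \<kappa>2 (f ` {I. unisolvent j I}))"
  have "\<kappa> > 0" unfolding \<kappa>_def using f \<kappa>2 by (subst Min_gr_iff) auto
  have le: "\<kappa> \<le> \<kappa>2" "\<And>I. unisolvent j I \<Longrightarrow> \<kappa> \<le> f I" unfolding \<kappa>_def by (auto intro!: Min_le)
  show ?thesis unfolding coercive_def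
  proof (intro exI[of _ \<kappa>] conjI \<open>\<kappa> > 0\<close> allI impI ballI)
    fix I :: "'n option set" and c :: "('n option \<Rightarrow> nat) \<Rightarrow> real"
    assume "unisolvent j I" "c \<in> perp_coefs CARD('n) j"
    then show "\<kappa> * (l1_norm (hidx j) c)\<^sup>2 \<le> (\<Sum>i\<in>I. bform (hidx j) (facet_form CARD('n) i) c c)"
      using f le(2)[of I] by (meson mult_right_mono order_trans zero_le_power2)
  next
    fix c :: "('n option \<Rightarrow> nat) \<Rightarrow> real" assume "c \<in> coefs (hidx (j - 2)) {}"
    then show "\<kappa> * (l1_norm (hidx (j - 2)) c)\<^sup>2 \<le> bform (hidx (j - 2)) (bubble_form CARD('n)) c c"
      using \<kappa>2(2)[of c] le(1) by (meson mult_right_mono order_trans zero_le_power2)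
  qed
qed

section \<open>Test functions and their derivatives along the advection field\<close>

definition Dmon :: "real^'n \<Rightarrow> ('n option \<Rightarrow> nat) \<Rightarrow> real^'n \<Rightarrow> real" where
  "Dmon \<beta> \<delta> x = (\<Sum>l\<in>UNIV. real (\<delta> l) * dlam l \<beta> * mon lam (\<delta>(l := \<delta> l - 1)) x)"

lemma dirC1_Dmon: "dirC1 \<beta> (mon lam \<delta>) (Dmon \<beta> \<delta>)"
  using dirC1_mon[of \<beta> \<delta>] by (simp add: Dmon_def[abs_def])

lemma continuous_Dmon: "continuous_on UNIV (Dmon \<beta> \<delta>)"
  using dirC1_Dmon by (simp add: dirC1_def)

definition Dhp :: "real^'n \<Rightarrow> int \<Rightarrow> (('n option \<Rightarrow> nat) \<Rightarrow> real) \<Rightarrow> real^'n \<Rightarrow> real" where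
  "Dhp \<beta> j c x = (\<Sum>\<alpha>\<in>hidx j. c \<alpha> * Dmon \<beta> \<alpha> x)"

lemma dirC1_hp: "dirC1 \<beta> (hp j c) (Dhp \<beta> j c)"
  unfolding lincomb_def[abs_def] Dhp_def[abs_def] by (intro dirC1_sum dirC1_scale dirC1_Dmon)

lemma facet_bubble_eq: "facet_bubble a i = mon lam (facet_idx i)"
proof
  fix x
  have "(\<Prod>j\<in>UNIV - {i}. lam j x ^ facet_idx i j) = (\<Prod>j\<in>UNIV - {i}. lam j x)"
    by (intro prod.cong) (auto simp: facet_idx_def)
  then show "facet_bubble a i x = mon lam (facet_idx i) x"
    by (simp add: facet_bubble_def mon_def prod.remove[of UNIV i] Compl_eq_Diff_UNIV) (simp add: facet_idx_def)
qed

lemma bubble_eq: "bubble a = mon lam (\<lambda>_. 1)"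
  by (simp add: fun_eq_iff bubble_def mon_def)

lemma signed_bubble_eq: "signed_bubble a \<beta> x = (\<Sum>i\<in>UNIV. - sgn (dlam i \<beta>) * mon lam (facet_idx i) x)"
  by (simp add: signed_bubble_def sgn_normal facet_bubble_eq)

definition test_fun :: "real^'n \<Rightarrow> int \<Rightarrow> (('n option \<Rightarrow> nat) \<Rightarrow> real) \<Rightarrow> (('n option \<Rightarrow> nat) \<Rightarrow> real) \<Rightarrow> real^'n \<Rightarrow> real" where
  "test_fun \<beta> j c e x = signed_bubble a \<beta> x * hp j c x + bubble a x * hp (j - 2) e x"

text \<open>The derivative of the expansion \<open>test_fun_expand\<close>, taken monomial by
  monomial. This avoids the product rule and gives bounds term by term.\<close>

definition test_fun' :: "real^'n \<Rightarrow> int \<Rightarrow> (('n option \<Rightarrow> nat) \<Rightarrow> real) \<Rightarrow> (('n option \<Rightarrow> nat) \<Rightarrow> real) \<Rightarrow> real^'n \<Rightarrow> real" where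
  "test_fun' \<beta> j c e x = (\<Sum>i\<in>UNIV. - sgn (dlam i \<beta>) * (\<Sum>\<alpha>\<in>hidx j. c \<alpha> * Dmon \<beta> (\<lambda>l. \<alpha> l + facet_idx i l) x))
     + (\<Sum>\<gamma>\<in>hidx (j - 2). e \<gamma> * Dmon \<beta> (\<lambda>l. \<gamma> l + 1) x)"

lemma test_fun_expand: "test_fun \<beta> j c e x =
   (\<Sum>i\<in>UNIV. - sgn (dlam i \<beta>) * (\<Sum>\<alpha>\<in>hidx j. c \<alpha> * mon lam (\<lambda>l. \<alpha> l + facet_idx i l) x))
     + (\<Sum>\<gamma>\<in>hidx (j - 2). e \<gamma> * mon lam (\<lambda>l. \<gamma> l + 1) x)"
  unfolding test_fun_def signed_bubble_eq bubble_eq sum_distrib_right mon_add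
  by (simp add: lincomb_def sum_distrib_left sum_negf mult_ac)

lemma dirC1_test_fun: "dirC1 \<beta> (test_fun \<beta> j c e) (test_fun' \<beta> j c e)"
  unfolding test_fun_expand[abs_def] test_fun'_def[abs_def]
  by (intro dirC1_add dirC1_sum dirC1_scale dirC1_Dmon)

lemma continuous_test_fun: "continuous_on UNIV (test_fun \<beta> j c e)" "continuous_on UNIV (test_fun' \<beta> j c e)"
  using dirC1_test_fun by (auto simp: dirC1_def)

lemma sum_facet_idx: "(\<Sum>l\<in>UNIV. facet_idx (i :: 'n option) l) = CARD('n)"
proof -
  have "(\<Sum>l\<in>UNIV - {i}. facet_idx i l) = (\<Sum>l\<in>UNIV - {i}. 1)"
    by (intro sum.cong) (auto simp: facet_idx_def)
  then show ?thesis
    by (simp add: sum.remove[of UNIV i] card_Diff_singleton) (simp add: facet_idx_def)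
qed

text \<open>The factor is the total degree j + j + N plus the N of \<open>moment_rec\<close>. If
  \<open>\<gamma>\<close> or \<open>\<alpha>\<close> contains the coordinate i, all exponents are
  positive and both sides are zero.\<close>

lemma integral_Dmon_facet:
  assumes "\<gamma> \<in> hidx j" "\<alpha> \<in> hidx j"
  shows "(LINT x|lebesgue_on (cell a). Dmon \<beta> (\<lambda>l. \<gamma> l + (\<alpha> l + facet_idx i l)) x)
    = - dlam i \<beta> * (2 * (real_of_int j + CARD('n)) * vol * facet_form CARD('n) i \<gamma> \<alpha>)"
proof -
  have "real (\<Sum>l\<in>UNIV. \<gamma> l) = j" "real (\<Sum>l\<in>UNIV. \<alpha> l) = j"
    using assms unfolding hidx_def mem_Collect_eq by (metis of_int_of_nat_eq)+
  then have "real ((\<Sum>l\<in>UNIV. \<gamma> l + (\<alpha> l + facet_idx i l)) + CARD('n)) = 2 * (real_of_int j + CARD('n))"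
    by (simp add: sum.distrib sum_facet_idx del: of_nat_sum)
  moreover have "1 \<le> \<gamma> l + (\<alpha> l + facet_idx i l)" if "l \<noteq> i" for l
    using that by (simp add: facet_idx_def)
  moreover have "facet_idx i i = 0" by (simp add: facet_idx_def)
  ultimately show ?thesis
    unfolding Dmon_def by (subst integral_deriv_mon[of i]) (auto simp: facet_form_def add.assoc)
qed

text \<open>All exponents are positive, so there is no flux. This removes \<open>e\<close> from the
  pairing with D_K and makes the system triangular.\<close>

lemma integral_Dmon_bubble:
  "(LINT x|lebesgue_on (cell a). Dmon \<beta> (\<lambda>l. \<gamma> l + (\<epsilon> l + 1)) x) = 0"
  unfolding Dmon_def by (subst integral_deriv_mon[of None]) auto

text \<open>The boundary identity behind the test space: \<open>\<integral>\<^bsub>K\<^esub> \<beta> \<cdot> \<nabla>(w u) = \<integral>\<^bsub>\<partial>K\<^esub> \<beta> \<cdot> n w u\<close>, where on \<open>\<partial>K\<close> only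
  the signed facet bubbles contribute, with positive weights.\<close>

lemma integral_test_fun:
  "(LINT x|lebesgue_on (cell a). Dhp \<beta> j w x * test_fun \<beta> j c e x + hp j w x * test_fun' \<beta> j c e x)
    = 2 * (real_of_int j + CARD('n)) * vol * (\<Sum>i\<in>UNIV. \<bar>dlam i \<beta>\<bar> * bform (hidx j) (facet_form CARD('n) i) w c)"
proof -
  \<comment> \<open>The expanded product of \<open>w\<close> with the test function, linear in a
    placeholder \<open>D\<close>: inserting \<open>mon lam\<close> gives the product, inserting
    \<open>Dmon \<beta>\<close> its derivative.\<close>
  define W where "W D x = (\<Sum>i\<in>UNIV. - sgn (dlam i \<beta>) * (\<Sum>\<gamma>\<in>hidx j. \<Sum>\<alpha>\<in>hidx j. w \<gamma> * c \<alpha> * D (\<lambda>l. \<gamma> l + (\<alpha> l + facet_idx i l)) x))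
      + (\<Sum>\<gamma>\<in>hidx j. \<Sum>\<epsilon>\<in>hidx (j - 2). w \<gamma> * e \<epsilon> * D (\<lambda>l. \<gamma> l + (\<epsilon> l + 1)) x)"
    for D :: "('n option \<Rightarrow> nat) \<Rightarrow> real^'n \<Rightarrow> real" and x
  have expand: "hp j w x * (\<Sum>\<alpha>\<in>A. d \<alpha> * mon lam (f \<alpha>) x)
      = (\<Sum>\<gamma>\<in>hidx j. \<Sum>\<alpha>\<in>A. w \<gamma> * d \<alpha> * mon lam (\<lambda>l. \<gamma> l + f \<alpha> l) x)"
    for x d and A :: "('n option \<Rightarrow> nat) set" and f
    by (simp add: lincomb_def sum_product mon_add mult_ac)
  have prod: "hp j w x * test_fun \<beta> j c e x = W (mon lam) x" for x
  proof -
    have "hp j w x * test_fun \<beta> j c e x = (\<Sum>i\<in>UNIV. - sgn (dlam i \<beta>) * (hp j w x * (\<Sum>\<alpha>\<in>hidx j. c \<alpha> * mon lam (\<lambda>l. \<alpha> l + facet_idx i l) x)))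
       + hp j w x * (\<Sum>\<gamma>\<in>hidx (j - 2). e \<gamma> * mon lam (\<lambda>l. \<gamma> l + 1) x)"
      unfolding test_fun_expand distrib_left sum_distrib_left[of "hp j w x" _ "UNIV :: 'n option set"]
        mult.left_commute[of "hp j w x"] ..
    then show ?thesis unfolding W_def expand .
  qed
  have 1: "dirC1 \<beta> (W (mon lam)) (W (Dmon \<beta>))"
    unfolding W_def[abs_def] by (intro dirC1_add dirC1_sum dirC1_scale dirC1_Dmon)
  \<comment> \<open>The product rule gives a second derivative of the same function; by uniqueness
    it equals the termwise one.\<close>
  have 2: "dirC1 \<beta> (W (mon lam)) (\<lambda>x. Dhp \<beta> j w x * test_fun \<beta> j c e x + hp j w x * test_fun' \<beta> j c e x)"
    using dirC1_mult[OF dirC1_hp dirC1_test_fun, of \<beta> j w j c e] by (simp add: prod)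
  have "(LINT x|lebesgue_on (cell a). Dhp \<beta> j w x * test_fun \<beta> j c e x + hp j w x * test_fun' \<beta> j c e x)
     = (LINT x|lebesgue_on (cell a). W (Dmon \<beta>) x)"
    unfolding dirC1_unique[OF 2 1] ..
  also have "\<dots> = (\<Sum>i\<in>UNIV. - sgn (dlam i \<beta>) * (\<Sum>\<gamma>\<in>hidx j. \<Sum>\<alpha>\<in>hidx j. w \<gamma> * c \<alpha> *
        (LINT x|lebesgue_on (cell a). Dmon \<beta> (\<lambda>l. \<gamma> l + (\<alpha> l + facet_idx i l)) x)))"
    unfolding W_def using integrable_cell[OF continuous_Dmon] by (simp add: integral_Dmon_bubble[simplified])
  also have "\<dots> = (\<Sum>i\<in>UNIV. - sgn (dlam i \<beta>) * (\<Sum>\<gamma>\<in>hidx j. \<Sum>\<alpha>\<in>hidx j. w \<gamma> * c \<alpha> *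
        (- dlam i \<beta> * (2 * (real_of_int j + CARD('n)) * vol * facet_form CARD('n) i \<gamma> \<alpha>))))"
    by (intro sum.cong refl arg_cong2[where f = times] integral_Dmon_facet)
  also have "\<dots> = (\<Sum>i\<in>UNIV. 2 * (real_of_int j + CARD('n)) * vol * (\<bar>dlam i \<beta>\<bar> * bform (hidx j) (facet_form CARD('n) i) w c))"
  proof (intro sum.cong refl)
    fix i :: "'n option"
    define X where "X = 2 * (real_of_int j + CARD('n)) * vol"
    have "(\<Sum>\<gamma>\<in>hidx j. \<Sum>\<alpha>\<in>hidx j. w \<gamma> * c \<alpha> * (- dlam i \<beta> * (X * facet_form CARD('n) i \<gamma> \<alpha>)))
        = - dlam i \<beta> * X * bform (hidx j) (facet_form CARD('n) i) w c"
      by (simp add: bform_def sum_distrib_left mult_ac sum_negf)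
    \<comment> \<open>The sign built into the test space meets the sign of the flux, so that every
      facet enters with a nonnegative weight.\<close>
    moreover have "sgn (dlam i \<beta>) * dlam i \<beta> = \<bar>dlam i \<beta>\<bar>" by (simp add: abs_sgn mult.commute)
    ultimately show "- sgn (dlam i \<beta>) * (\<Sum>\<gamma>\<in>hidx j. \<Sum>\<alpha>\<in>hidx j. w \<gamma> * c \<alpha> * (- dlam i \<beta> * (X * facet_form CARD('n) i \<gamma> \<alpha>)))
        = X * (\<bar>dlam i \<beta>\<bar> * bform (hidx j) (facet_form CARD('n) i) w c)"
    proof -
      assume 1: "(\<Sum>\<gamma>\<in>hidx j. \<Sum>\<alpha>\<in>hidx j. w \<gamma> * c \<alpha> * (- dlam i \<beta> * (X * facet_form CARD('n) i \<gamma> \<alpha>)))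
        = - dlam i \<beta> * X * bform (hidx j) (facet_form CARD('n) i) w c"
        and 2: "sgn (dlam i \<beta>) * dlam i \<beta> = \<bar>dlam i \<beta>\<bar>"
      show ?thesis unfolding 1 2[symmetric] by (simp add: mult_ac)
    qed
  qed
  finally show ?thesis by (simp add: sum_distrib_left)
qed

lemma integral_bubble_pairing:
  "(LINT x|lebesgue_on (cell a). hp (j - 2) e' x * (bubble a x * hp (j - 2) e x))
     = vol * bform (hidx (j - 2)) (bubble_form CARD('n)) e' e"
  using integral_mon3[of "j - 2" e' "j - 2" e "\<lambda>_. 1"]
  by (simp add: bubble_eq bform_def bubble_form_def mult_ac)

section \<open>The defining equations of the operator in coefficients\<close>

lemma test_space_eq: "test_space k a \<beta> = {test_fun \<beta> (int k) c e | c e. c \<in> perp_coefs CARD('n) (int k) \<and> e \<in> coefs (hidx (int k - 2)) {}}"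
proof (intro equalityI subsetI)
  fix u assume "u \<in> test_space k a \<beta>"
  then obtain y z where u: "u = (\<lambda>x. signed_bubble a \<beta> x * y x + bubble a x * z x)"
    and y: "y \<in> poly_space_perp (int k) (cell a)" and z: "z \<in> poly_space (int k - 2)"
    by (auto simp: test_space_def)
  obtain c where c: "c \<in> perp_coefs CARD('n) (int k)" "y = hp (int k) c" using y unfolding poly_space_perp_eq by blast
  obtain e where e: "z = hp (int k - 2) e" "\<And>\<alpha>. \<alpha> \<notin> hidx (int k - 2) \<Longrightarrow> e \<alpha> = 0"
    using hspan_coefs[OF z] by blast
  have "u = test_fun \<beta> (int k) c e" by (simp add: u test_fun_def fun_eq_iff c(2) e(1))
  moreover have "e \<in> coefs (hidx (int k - 2)) {}" using e(2) by (simp add: coefs_def)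
  ultimately show "u \<in> {test_fun \<beta> (int k) c e | c e. c \<in> perp_coefs CARD('n) (int k) \<and> e \<in> coefs (hidx (int k - 2)) {}}"
    using c(1) by blast
next
  fix u assume "u \<in> {test_fun \<beta> (int k) c e | c e. c \<in> perp_coefs CARD('n) (int k) \<and> e \<in> coefs (hidx (int k - 2)) {}}"
  then obtain c e where ce: "u = test_fun \<beta> (int k) c e" "c \<in> perp_coefs CARD('n) (int k)" by blast
  have "hp (int k) c \<in> poly_space_perp (int k) (cell a)" using ce(2) by (simp add: poly_space_perp_eq)
  then show "u \<in> test_space k a \<beta>"
    unfolding test_space_def ce(1) test_fun_def[abs_def] using hp_poly_space by blast
qed

text \<open>The right-hand side <D_K w, v> for the monomial w with exponent \<open>\<alpha>\<close>,
  where \<open>g\<close> stands for the derivative of \<open>v\<close> along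
  \<open>\<beta>\<close>.\<close>

definition flux :: "real^'n \<Rightarrow> (real^'n \<Rightarrow> real) \<Rightarrow> (real^'n \<Rightarrow> real) \<Rightarrow> ('n option \<Rightarrow> nat) \<Rightarrow> real" where
  "flux \<beta> v g \<alpha> = (LINT x|lebesgue_on (cell a). Dmon \<beta> \<alpha> x * v x + mon lam \<alpha> x * g x)"

text \<open>The right-hand side for \<open>e\<close> once \<open>c\<close> is known: moments of what
  the signed-bubble part leaves of \<open>v\<close>.\<close>

definition load :: "real^'n \<Rightarrow> (real^'n \<Rightarrow> real) \<Rightarrow> int \<Rightarrow> (('n option \<Rightarrow> nat) \<Rightarrow> real) \<Rightarrow> ('n option \<Rightarrow> nat) \<Rightarrow> real" where
  "load \<beta> v j c \<alpha> = (LINT x|lebesgue_on (cell a). mon lam \<alpha> x * (v x - signed_bubble a \<beta> x * hp j c x))"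

lemma continuous_signed_bubble: "continuous_on UNIV (signed_bubble a \<beta>)"
  unfolding signed_bubble_eq[abs_def] by (intro continuous_intros continuous_mon)

lemma continuous_bubble: "continuous_on UNIV (bubble a)"
  unfolding bubble_eq by (rule continuous_mon)

text \<open>The right-hand side is free of \<open>e\<close>, so the flux conditions alone determine
  \<open>c\<close>.\<close>

lemma flux_condition:
  assumes v: "integrable (lebesgue_on (cell a)) v" "has_dir_deriv (cell a) \<beta> v g"
  shows "Dpairing (cell a) \<beta> (hp j w) (\<lambda>x. test_fun \<beta> j c e x - v x)
    = 2 * (real_of_int j + CARD('n)) * vol * (\<Sum>i\<in>UNIV. \<bar>dlam i \<beta>\<bar> * bform (hidx j) (facet_form CARD('n) i) w c)
      - (\<Sum>\<alpha>\<in>hidx j. w \<alpha> * flux \<beta> v g \<alpha>)"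
proof -
  have g: "integrable (lebesgue_on (cell a)) g" using v by (simp add: has_dir_deriv_def)
  have int: "integrable (lebesgue_on (cell a)) (\<lambda>x. Dmon \<beta> \<alpha> x * v x + mon lam \<alpha> x * g x)" for \<alpha>
    by (intro Bochner_Integration.integrable_add integrable_mult_continuous[OF compact_cell] continuous_Dmon continuous_mon v g)
  have "Dhp \<beta> j w x * v x + hp j w x * g x = (\<Sum>\<alpha>\<in>hidx j. w \<alpha> * (Dmon \<beta> \<alpha> x * v x + mon lam \<alpha> x * g x))" for x
    by (simp add: Dhp_def lincomb_def sum_distrib_right sum_distrib_left sum.distrib algebra_simps)
  then have "(LINT x|lebesgue_on (cell a). Dhp \<beta> j w x * v x + hp j w x * g x) = (\<Sum>\<alpha>\<in>hidx j. w \<alpha> * flux \<beta> v g \<alpha>)"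
    using int by (simp add: flux_def)
  then show ?thesis
    by (simp add: Dpairing_diff[OF compact_cell negligible_frontier_cell dirC1_hp dirC1_test_fun v] integral_test_fun)
qed

lemma load_condition:
  assumes v: "integrable (lebesgue_on (cell a)) v"
  shows "pairing (cell a) (hp (j - 2) e') (\<lambda>x. test_fun \<beta> j c e x - v x)
    = vol * bform (hidx (j - 2)) (bubble_form CARD('n)) e' e - (\<Sum>\<alpha>\<in>hidx (j - 2). e' \<alpha> * load \<beta> v j c \<alpha>)"
proof -
  define r where "r x = v x - signed_bubble a \<beta> x * hp j c x" for x
  have r: "integrable (lebesgue_on (cell a)) r"
    unfolding r_def[abs_def]
    by (intro Bochner_Integration.integrable_diff v integrable_cell continuous_on_mult continuous_signed_bubble continuous_hp)
  have int: "integrable (lebesgue_on (cell a)) (\<lambda>x. mon lam \<alpha> x * r x)" for \<alpha>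
    by (intro integrable_mult_continuous[OF compact_cell] continuous_mon r)
  have "hp (j - 2) e' x * r x = (\<Sum>\<alpha>\<in>hidx (j - 2). e' \<alpha> * (mon lam \<alpha> x * r x))" for x
    by (simp add: lincomb_def sum_distrib_right sum_distrib_left mult_ac)
  then have 1: "(LINT x|lebesgue_on (cell a). hp (j - 2) e' x * r x) = (\<Sum>\<alpha>\<in>hidx (j - 2). e' \<alpha> * load \<beta> v j c \<alpha>)"
    using int by (simp add: load_def r_def)
  have "hp (j - 2) e' x * (test_fun \<beta> j c e x - v x) = hp (j - 2) e' x * (bubble a x * hp (j - 2) e x) - hp (j - 2) e' x * r x" for x
    by (simp add: test_fun_def r_def algebra_simps)
  then have "pairing (cell a) (hp (j - 2) e') (\<lambda>x. test_fun \<beta> j c e x - v x)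
     = (LINT x|lebesgue_on (cell a). hp (j - 2) e' x * (bubble a x * hp (j - 2) e x)) - (LINT x|lebesgue_on (cell a). hp (j - 2) e' x * r x)"
    unfolding pairing_def
    using integrable_cell[OF continuous_on_mult[OF continuous_hp continuous_on_mult[OF continuous_bubble continuous_hp]]]
      integrable_mult_continuous[OF compact_cell continuous_hp r]
    by simp
  then show ?thesis by (simp add: 1 integral_bubble_pairing)
qed

end

section \<open>The operator and its bounds\<close>

lemma bform_diff: "bform A m d (\<lambda>a. c a - c' a) = bform A m d c - bform A m d c'"
  by (simp add: bform_def algebra_simps sum_subtractf)

lemma quadratic_bound: "0 \<le> t \<Longrightarrow> 0 < A \<Longrightarrow> 0 \<le> F \<Longrightarrow> A * t\<^sup>2 \<le> t * F \<Longrightarrow> t \<le> F / A" for t A F :: real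
  by (cases "t = 0") (simp_all add: power2_eq_square pos_le_divide_eq mult_ac)

text \<open>What unisolvence and the bounds require of an element: a unisolvent set \<open>I\<close>
  of facets whose weights are at least \<open>\<rho>\<close>. The angle condition supplies
  \<open>I = UNIV\<close>; for k = 1 \<open>two_large_dlam\<close> supplies a pair. One argument
  then covers both cases.\<close>

locale advected_element = nondegenerate_element a for a :: "'n::finite element" +
  fixes \<beta> :: "real^'n" and k :: nat and I :: "'n option set" and \<rho> \<kappa> :: real
  assumes uni: "unisolvent (int k) I"
    and \<rho>: "\<rho> > 0" "\<And>i. i \<in> I \<Longrightarrow> \<rho> \<le> \<bar>dlam i \<beta>\<bar>"
    and coer: "coercive TYPE('n option) CARD('n) (int k) \<kappa>"
begin

lemma \<kappa>_pos: "\<kappa> > 0"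
  using coer by (simp add: coercive_def)

lemma weighted_coercive:
  assumes "c \<in> perp_coefs CARD('n) (int k)"
  shows "\<rho> * \<kappa> * (l1_norm (hidx (int k)) c)\<^sup>2
    \<le> (\<Sum>i\<in>UNIV. \<bar>dlam i \<beta>\<bar> * bform (hidx (int k)) (facet_form CARD('n) i) c c)"
proof -
  have "\<kappa> * (l1_norm (hidx (int k)) c)\<^sup>2 \<le> (\<Sum>i\<in>I. bform (hidx (int k)) (facet_form CARD('n) i) c c)"
    using coer uni assms by (simp add: coercive_def)
  then have "\<rho> * (\<kappa> * (l1_norm (hidx (int k)) c)\<^sup>2) \<le> \<rho> * (\<Sum>i\<in>I. bform (hidx (int k)) (facet_form CARD('n) i) c c)"
    using \<rho>(1) by (intro mult_left_mono) auto
  also have "\<dots> = (\<Sum>i\<in>I. \<rho> * bform (hidx (int k)) (facet_form CARD('n) i) c c)" by (rule sum_distrib_left)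
  also have "\<dots> \<le> (\<Sum>i\<in>I. \<bar>dlam i \<beta>\<bar> * bform (hidx (int k)) (facet_form CARD('n) i) c c)"
    using \<rho>(2) by (intro sum_mono mult_right_mono facet_form_nonneg)
  \<comment> \<open>Facets outside \<open>I\<close>, possibly tangential, only add nonnegative
    terms.\<close>
  also have "\<dots> \<le> (\<Sum>i\<in>UNIV. \<bar>dlam i \<beta>\<bar> * bform (hidx (int k)) (facet_form CARD('n) i) c c)"
    by (intro sum_mono2) (auto intro!: mult_nonneg_nonneg facet_form_nonneg)
  finally show ?thesis by (simp add: mult.assoc)
qed

lemma bubble_coercive:
  assumes "e \<in> coefs (hidx (int k - 2)) {}"
  shows "\<kappa> * (l1_norm (hidx (int k - 2)) e)\<^sup>2 \<le> bform (hidx (int k - 2)) (bubble_form CARD('n) :: ('n option \<Rightarrow> nat) \<Rightarrow> _) e e"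
  using coer assms by (simp add: coercive_def)

definition bdry :: "(('n option \<Rightarrow> nat) \<Rightarrow> real) \<Rightarrow> (('n option \<Rightarrow> nat) \<Rightarrow> real) \<Rightarrow> real" where
  "bdry w c = (\<Sum>i\<in>UNIV. \<bar>dlam i \<beta>\<bar> * bform (hidx (int k)) (facet_form CARD('n) i) w c)"

definition scale :: real where "scale = 2 * (real k + CARD('n)) * vol"

lemma scale_pos: "scale > 0"
  unfolding scale_def by (intro mult_pos_pos add_nonneg_pos cell_measure_pos) simp_all

lemma bdry_eq: "bdry w c = bform (hidx (int k)) (\<lambda>\<alpha> \<gamma>. \<Sum>i\<in>UNIV. \<bar>dlam i \<beta>\<bar> * facet_form CARD('n) i \<alpha> \<gamma>) w c"
  by (simp add: bdry_def bform_weighted)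

definition solves :: "(real^'n \<Rightarrow> real) \<Rightarrow> (real^'n \<Rightarrow> real) \<Rightarrow> (('n option \<Rightarrow> nat) \<Rightarrow> real) \<Rightarrow> (('n option \<Rightarrow> nat) \<Rightarrow> real) \<Rightarrow> bool" where
  "solves v g c e \<longleftrightarrow> c \<in> perp_coefs CARD('n) (int k) \<and> e \<in> coefs (hidx (int k - 2)) {} \<and>
     (\<forall>w\<in>perp_coefs CARD('n) (int k). scale * bdry w c = (\<Sum>\<alpha>\<in>hidx (int k). w \<alpha> * flux \<beta> v g \<alpha>)) \<and>
     (\<forall>e'\<in>coefs (hidx (int k - 2)) {}. vol * bform (hidx (int k - 2)) (bubble_form CARD('n)) e' e
        = (\<Sum>\<alpha>\<in>hidx (int k - 2). e' \<alpha> * load \<beta> v (int k) c \<alpha>))"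

lemma solves_exists: "\<exists>c e. solves v g c e"
proof -
  define L where "L = (\<lambda>t \<gamma>. simplex_moment CARD('n) (\<lambda>l. t l + \<gamma> l)) ` {t \<in> hidx (int k) :: ('n option \<Rightarrow> nat) set. \<forall>l. t l \<ge> 1}"
  have L: "perp_coefs CARD('n) (int k) = coefs (hidx (int k)) L" by (simp add: perp_coefs_def L_def)
  define m where "m = (\<lambda>\<alpha> \<gamma>. \<Sum>i\<in>UNIV. \<bar>dlam i \<beta>\<bar> * facet_form CARD('n) i \<alpha> \<gamma>)"
  have m: "m \<alpha> \<gamma> = m \<gamma> \<alpha>" for \<alpha> \<gamma> unfolding m_def by (simp add: facet_form_sym)
  have pos: "\<rho> * \<kappa> > 0" using \<rho>(1) \<kappa>_pos by simp
  have "\<rho> * \<kappa> * (l1_norm (hidx (int k)) c)\<^sup>2 \<le> bform (hidx (int k)) m c c" if "c \<in> coefs (hidx (int k)) L" for c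
    using weighted_coercive[of c] that by (simp add: m_def L bform_weighted)
  from bform_solve[OF finite_hidx m pos this, where ff = "\<lambda>\<alpha>. flux \<beta> v g \<alpha> / scale"]
  obtain c where c: "c \<in> perp_coefs CARD('n) (int k)"
    "\<And>d. d \<in> perp_coefs CARD('n) (int k) \<Longrightarrow> bdry d c = (\<Sum>\<alpha>\<in>hidx (int k). d \<alpha> * (flux \<beta> v g \<alpha> / scale))"
    unfolding L bdry_eq m_def by blast
  have "\<exists>e. e \<in> coefs (hidx (int k - 2)) {} \<and> (\<forall>d\<in>coefs (hidx (int k - 2)) {}.
      bform (hidx (int k - 2)) (bubble_form CARD('n)) d e = (\<Sum>\<alpha>\<in>hidx (int k - 2). d \<alpha> * (load \<beta> v (int k) c \<alpha> / vol)))"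
    by (rule bform_solve[where A = "hidx (int k - 2)" and L = "{}" and m = "bubble_form CARD('n)" and \<kappa> = \<kappa>
          and ff = "\<lambda>\<alpha>. load \<beta> v (int k) c \<alpha> / vol", OF finite_hidx bubble_form_sym \<kappa>_pos bubble_coercive])
       (assumption, blast)
  then obtain e where e: "e \<in> coefs (hidx (int k - 2)) {}"
    "\<forall>d\<in>coefs (hidx (int k - 2)) {}. bform (hidx (int k - 2)) (bubble_form CARD('n)) d e
       = (\<Sum>\<alpha>\<in>hidx (int k - 2). d \<alpha> * (load \<beta> v (int k) c \<alpha> / vol))" by (elim exE conjE)
  have "solves v g c e"
    unfolding solves_def using c e scale_pos cell_measure_pos
    by (auto simp: sum_distrib_left)
  then show ?thesis by blast
qed

lemma solves_unique:
  assumes 1: "solves v g c e" and 2: "solves v g c' e'"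
  shows "c = c'" "e = e'"
proof -
  define d where "d = (\<lambda>\<alpha>. c \<alpha> - c' \<alpha>)"
  have d: "d \<in> perp_coefs CARD('n) (int k)"
    using 1 2 coefs_diff unfolding d_def solves_def perp_coefs_def by blast
  have "scale * bdry d c = scale * bdry d c'" using 1 2 d by (simp add: solves_def)
  then have "bdry d c = bdry d c'" using scale_pos by simp
  moreover have "bdry d d = bdry d c - bdry d c'"
    unfolding bdry_eq bform_diff[symmetric] by (simp add: d_def)
  ultimately have "\<rho> * \<kappa> * (l1_norm (hidx (int k)) d)\<^sup>2 \<le> 0"
    using weighted_coercive[OF d] by (simp add: bdry_def)
  then have "l1_norm (hidx (int k)) d = 0" using \<rho>(1) \<kappa>_pos by (simp add: mult_le_0_iff)
  then have "d = (\<lambda>_. 0)" using l1_norm_eq_0[OF finite_hidx] d unfolding perp_coefs_def by blast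
  then show c: "c = c'" by (simp add: d_def fun_eq_iff)
  define f where "f = (\<lambda>\<alpha>. e \<alpha> - e' \<alpha>)"
  have f: "f \<in> coefs (hidx (int k - 2)) {}"
    using 1 2 coefs_diff unfolding f_def solves_def by blast
  have "vol * bform (hidx (int k - 2)) (bubble_form CARD('n)) f e = vol * bform (hidx (int k - 2)) (bubble_form CARD('n)) f e'"
    using 1 2 f c by (simp add: solves_def)
  then have "bform (hidx (int k - 2)) (bubble_form CARD('n)) f e = bform (hidx (int k - 2)) (bubble_form CARD('n)) f e'"
    using cell_measure_pos by simp
  moreover have "bform (hidx (int k - 2)) (bubble_form CARD('n)) f f
      = bform (hidx (int k - 2)) (bubble_form CARD('n)) f e - bform (hidx (int k - 2)) (bubble_form CARD('n)) f e'"
    unfolding bform_diff[symmetric] by (simp add: f_def)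
  ultimately have "\<kappa> * (l1_norm (hidx (int k - 2)) f)\<^sup>2 \<le> 0"
    using bubble_coercive[OF f] by simp
  then have "l1_norm (hidx (int k - 2)) f = 0" using \<kappa>_pos by (simp add: mult_le_0_iff)
  then have "f = (\<lambda>_. 0)" using l1_norm_eq_0[OF finite_hidx f] by blast
  then show "e = e'" by (simp add: f_def fun_eq_iff)
qed

lemma solves_iff:
  assumes v: "integrable (lebesgue_on (cell a)) v" "has_dir_deriv (cell a) \<beta> v g"
    and c: "c \<in> perp_coefs CARD('n) (int k)" and e: "e \<in> coefs (hidx (int k - 2)) {}"
  shows "solves v g c e \<longleftrightarrow>
    (\<forall>w\<in>poly_space_perp (int k) (cell a). Dpairing (cell a) \<beta> w (\<lambda>x. test_fun \<beta> (int k) c e x - v x) = 0) \<and>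
    (\<forall>z\<in>poly_space (int k - 2). pairing (cell a) z (\<lambda>x. test_fun \<beta> (int k) c e x - v x) = 0)"
proof -
  have "poly_space (int k - 2) = hp (int k - 2) ` coefs (hidx (int k - 2)) {}"
  proof (intro equalityI subsetI)
    fix z :: "real^'n \<Rightarrow> real" assume "z \<in> poly_space (int k - 2)"
    then obtain e where "z = hp (int k - 2) e" "\<And>\<alpha>. \<alpha> \<notin> hidx (int k - 2) \<Longrightarrow> e \<alpha> = 0"
      using hspan_coefs by blast
    then show "z \<in> hp (int k - 2) ` coefs (hidx (int k - 2)) {}" by (auto simp: coefs_def)
  qed (auto intro: hp_poly_space)
  then show ?thesis
    unfolding poly_space_perp_eq using c e
    by (simp add: solves_def flux_condition[OF v] load_condition[OF v(1)] bdry_def scale_def)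
qed

lemma fortin_solves:
  assumes v: "integrable (lebesgue_on (cell a)) v" "has_dir_deriv (cell a) \<beta> v g"
    and s: "solves v g c e"
  shows "fortin k a \<beta> v = test_fun \<beta> (int k) c e"
  unfolding fortin_def
proof (rule the_equality)
  have ce: "c \<in> perp_coefs CARD('n) (int k)" "e \<in> coefs (hidx (int k - 2)) {}" using s by (auto simp: solves_def)
  then show "test_fun \<beta> (int k) c e \<in> test_space k a \<beta> \<and>
    (\<forall>w\<in>poly_space_perp (int k) (cell a). Dpairing (cell a) \<beta> w (\<lambda>x. test_fun \<beta> (int k) c e x - v x) = 0) \<and>
    (\<forall>z\<in>poly_space (int k - 2). pairing (cell a) z (\<lambda>x. test_fun \<beta> (int k) c e x - v x) = 0)"
    using s solves_iff[OF v ce] by (auto simp: test_space_eq)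
next
  fix u assume u: "u \<in> test_space k a \<beta> \<and>
    (\<forall>w\<in>poly_space_perp (int k) (cell a). Dpairing (cell a) \<beta> w (\<lambda>x. u x - v x) = 0) \<and>
    (\<forall>z\<in>poly_space (int k - 2). pairing (cell a) z (\<lambda>x. u x - v x) = 0)"
  then obtain c' e' where ce': "u = test_fun \<beta> (int k) c' e'" "c' \<in> perp_coefs CARD('n) (int k)"
    "e' \<in> coefs (hidx (int k - 2)) {}" by (auto simp: test_space_eq)
  then have "solves v g c' e'" using u solves_iff[OF v ce'(2,3)] by simp
  then show "u = test_fun \<beta> (int k) c e" using solves_unique[OF s] ce'(1) by simp
qed

text \<open>The flux equation tested with \<open>c\<close> itself. As 2 (k + N) is at least 1,
  \<open>scale\<close> may be lowered to \<open>vol\<close>, and the volume cancels on both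
  sides.\<close>

lemma coef_bound:
  assumes s: "solves v g c e" and F: "\<And>\<alpha>. \<alpha> \<in> hidx (int k) \<Longrightarrow> \<bar>flux \<beta> v g \<alpha>\<bar> \<le> vol * F" "F \<ge> 0"
  shows "l1_norm (hidx (int k)) c \<le> F / (\<rho> * \<kappa>)"
proof (rule quadratic_bound)
  let ?t = "l1_norm (hidx (int k)) c"
  have c: "c \<in> perp_coefs CARD('n) (int k)" using s by (simp add: solves_def)
  have "vol * (\<rho> * \<kappa> * ?t\<^sup>2) \<le> scale * (\<rho> * \<kappa> * ?t\<^sup>2)"
  proof (rule mult_right_mono)
    have "1 \<le> real CARD('n)" by (simp add: Suc_le_eq)
    then have "1 \<le> real k + real CARD('n)" by (rule add_increasing[rotated]) simp
    then have "1 * 1 \<le> 2 * (real k + real CARD('n))" by (intro mult_mono) simp_all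
    then have "1 * 1 * vol \<le> 2 * (real k + real CARD('n)) * vol"
      using cell_measure_pos by (intro mult_right_mono) auto
    then show "vol \<le> scale" by (simp add: scale_def)
  qed (use \<rho>(1) \<kappa>_pos in simp)
  also have "\<dots> \<le> scale * bdry c c"
    using weighted_coercive[OF c] scale_pos by (simp add: bdry_def)
  also have "\<dots> = (\<Sum>\<alpha>\<in>hidx (int k). c \<alpha> * flux \<beta> v g \<alpha>)" using s c by (simp add: solves_def)
  also have "\<dots> \<le> \<bar>\<Sum>\<alpha>\<in>hidx (int k). c \<alpha> * flux \<beta> v g \<alpha>\<bar>" by (rule abs_ge_self)
  also have "\<dots> \<le> ?t * (vol * F)" by (rule l1_norm_sum_bound) (rule F(1))
  finally have "vol * (\<rho> * \<kappa> * ?t\<^sup>2) \<le> vol * (?t * F)" by (simp add: mult_ac)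
  then show "\<rho> * \<kappa> * ?t\<^sup>2 \<le> ?t * F" using cell_measure_pos by simp
qed (use \<rho>(1) \<kappa>_pos F l1_norm_nonneg in auto)

lemma coef_bound':
  assumes s: "solves v g c e" and F: "\<And>\<alpha>. \<alpha> \<in> hidx (int k - 2) \<Longrightarrow> \<bar>load \<beta> v (int k) c \<alpha>\<bar> \<le> vol * F" "F \<ge> 0"
  shows "l1_norm (hidx (int k - 2)) e \<le> F / \<kappa>"
proof (rule quadratic_bound)
  let ?t = "l1_norm (hidx (int k - 2)) e"
  have e: "e \<in> coefs (hidx (int k - 2)) {}" using s by (simp add: solves_def)
  have "vol * (\<kappa> * ?t\<^sup>2) \<le> vol * bform (hidx (int k - 2)) (bubble_form CARD('n)) e e"
    using bubble_coercive[OF e] cell_measure_pos by simp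
  also have "\<dots> = (\<Sum>\<alpha>\<in>hidx (int k - 2). e \<alpha> * load \<beta> v (int k) c \<alpha>)" using s e by (simp add: solves_def)
  also have "\<dots> \<le> \<bar>\<Sum>\<alpha>\<in>hidx (int k - 2). e \<alpha> * load \<beta> v (int k) c \<alpha>\<bar>" by (rule abs_ge_self)
  also have "\<dots> \<le> ?t * (vol * F)" by (rule l1_norm_sum_bound) (rule F(1))
  finally have "vol * (\<kappa> * ?t\<^sup>2) \<le> vol * (?t * F)" by (simp add: mult_ac)
  then show "\<kappa> * ?t\<^sup>2 \<le> ?t * F" using cell_measure_pos by simp
qed (use \<kappa>_pos F l1_norm_nonneg in auto)

end

section \<open>Bounds for test functions and right-hand sides by coefficients and averages\<close>

context nondegenerate_element
begin

lemma abs_mon_le: "x \<in> cell a \<Longrightarrow> \<bar>mon lam \<delta> x\<bar> \<le> 1"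
  using mon_bounds[of x \<delta>] by simp

lemma abs_Dmon_le:
  assumes x: "x \<in> cell a" and D: "\<And>i. \<bar>dlam i \<beta>\<bar> \<le> D"
  shows "\<bar>Dmon \<beta> \<delta> x\<bar> \<le> real (\<Sum>l\<in>UNIV. \<delta> l) * D"
proof -
  have "\<bar>Dmon \<beta> \<delta> x\<bar> \<le> (\<Sum>l\<in>UNIV. \<bar>real (\<delta> l) * dlam l \<beta> * mon lam (\<delta>(l := \<delta> l - 1)) x\<bar>)"
    unfolding Dmon_def by (rule sum_abs)
  also have "\<dots> \<le> (\<Sum>l\<in>UNIV. real (\<delta> l) * D * 1)"
    unfolding abs_mult using D abs_mon_le[OF x] order_trans[OF abs_ge_zero D]
    by (intro sum_mono mult_mono) auto
  finally show ?thesis by (simp add: sum_distrib_right)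
qed

lemma abs_hp_le:
  assumes "x \<in> cell a"
  shows "\<bar>hp j c x\<bar> \<le> l1_norm (hidx j) c"
  using l1_norm_sum_bound[of "hidx j" "\<lambda>\<alpha>. mon lam \<alpha> x" 1 c] abs_mon_le[OF assms]
  by (simp add: lincomb_def)

lemma abs_signed_bubble_le:
  assumes "x \<in> cell a"
  shows "\<bar>signed_bubble a \<beta> x\<bar> \<le> real CARD('n option)"
proof -
  have "\<bar>signed_bubble a \<beta> x\<bar> \<le> (\<Sum>i\<in>UNIV. \<bar>- sgn (dlam i \<beta>) * mon lam (facet_idx i) x\<bar>)"
    unfolding signed_bubble_eq by (rule sum_abs)
  also have "\<dots> \<le> (\<Sum>i\<in>(UNIV :: 'n option set). 1)"
    using abs_mon_le[OF assms] by (intro sum_mono) (auto simp: abs_mult sgn_if)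
  finally show ?thesis by simp
qed

lemma abs_test_fun_le:
  assumes x: "x \<in> cell a"
  shows "\<bar>test_fun \<beta> j c e x\<bar> \<le> real CARD('n option) * l1_norm (hidx j) c + l1_norm (hidx (j - 2)) e"
proof -
  have "\<bar>signed_bubble a \<beta> x * hp j c x\<bar> \<le> real CARD('n option) * l1_norm (hidx j) c"
    unfolding abs_mult by (intro mult_mono abs_signed_bubble_le abs_hp_le x) auto
  moreover have "\<bar>bubble a x * hp (j - 2) e x\<bar> \<le> 1 * l1_norm (hidx (j - 2)) e"
    unfolding abs_mult bubble_eq by (intro mult_mono abs_mon_le abs_hp_le x) auto
  ultimately show ?thesis unfolding test_fun_def by linarith
qed

lemma abs_test_fun'_le:
  assumes x: "x \<in> cell a" and D: "\<And>i. \<bar>dlam i \<beta>\<bar> \<le> D"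
  shows "\<bar>test_fun' \<beta> (int k) c e x\<bar> \<le> D * (real k + CARD('n)) *
     (real CARD('n option) * l1_norm (hidx (int k)) c + l1_norm (hidx (int k - 2)) e)"
proof -
  define B where "B = D * (real k + CARD('n))"
  have "D \<ge> 0" using order_trans[OF abs_ge_zero D] .
  have 1: "\<bar>Dmon \<beta> (\<lambda>l. \<alpha> l + facet_idx i l) x\<bar> \<le> B" if "\<alpha> \<in> hidx (int k)" for \<alpha> i
  proof -
    have "(\<Sum>l\<in>UNIV. \<alpha> l + facet_idx i l) = k + CARD('n)"
      using that by (simp add: hidx_def sum.distrib sum_facet_idx del: of_nat_sum)
    then show ?thesis using abs_Dmon_le[OF x D, of "\<lambda>l. \<alpha> l + facet_idx i l"] by (simp add: B_def mult.commute)
  qed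
  have 2: "\<bar>Dmon \<beta> (\<lambda>l. \<gamma> l + 1) x\<bar> \<le> B" if "\<gamma> \<in> hidx (int k - 2)" for \<gamma>
  proof -
    have "int (\<Sum>l\<in>UNIV. \<gamma> l) = int k - 2" using that by (simp add: hidx_def del: of_nat_sum)
    \<comment> \<open>The bubble part has degree (k - 2) + (N + 1) = k + N - 1, one less than the
      signed-bubble part.\<close>
    then have "(\<Sum>l\<in>UNIV. \<gamma> l + 1) \<le> k + CARD('n)"
      unfolding sum.distrib by (simp del: of_nat_sum)
    then have "real (\<Sum>l\<in>UNIV. \<gamma> l + 1) * D \<le> real (k + CARD('n)) * D"
      using \<open>D \<ge> 0\<close> by (intro mult_right_mono) (simp_all only: of_nat_le_iff)
    then show ?thesis using abs_Dmon_le[OF x D, of "\<lambda>l. \<gamma> l + 1"] by (simp add: B_def mult.commute)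
  qed
  have "\<bar>\<Sum>i\<in>UNIV. - sgn (dlam i \<beta>) * (\<Sum>\<alpha>\<in>hidx (int k). c \<alpha> * Dmon \<beta> (\<lambda>l. \<alpha> l + facet_idx i l) x)\<bar>
      \<le> (\<Sum>i\<in>UNIV. \<bar>- sgn (dlam i \<beta>) * (\<Sum>\<alpha>\<in>hidx (int k). c \<alpha> * Dmon \<beta> (\<lambda>l. \<alpha> l + facet_idx i l) x)\<bar>)"
    by (rule sum_abs)
  also have "\<dots> \<le> (\<Sum>i\<in>(UNIV :: 'n option set). 1 * (l1_norm (hidx (int k)) c * B))"
    unfolding abs_mult by (intro sum_mono mult_mono l1_norm_sum_bound 1) (auto simp: sgn_if)
  finally have "\<bar>\<Sum>i\<in>UNIV. - sgn (dlam i \<beta>) * (\<Sum>\<alpha>\<in>hidx (int k). c \<alpha> * Dmon \<beta> (\<lambda>l. \<alpha> l + facet_idx i l) x)\<bar>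
      \<le> B * (real CARD('n option) * l1_norm (hidx (int k)) c)" by (simp add: mult_ac)
  moreover have "\<bar>\<Sum>\<gamma>\<in>hidx (int k - 2). e \<gamma> * Dmon \<beta> (\<lambda>l. \<gamma> l + 1) x\<bar> \<le> B * l1_norm (hidx (int k - 2)) e"
    using l1_norm_sum_bound[of "hidx (int k - 2)" "\<lambda>\<gamma>. Dmon \<beta> (\<lambda>l. \<gamma> l + 1) x" B e] 2 by (simp add: mult.commute)
  ultimately show ?thesis unfolding test_fun'_def B_def[symmetric] by (simp only: distrib_left)
qed

lemma abs_integral_le:
  assumes f: "integrable (lebesgue_on (cell a)) f" and v: "integrable (lebesgue_on (cell a)) v"
    and g: "integrable (lebesgue_on (cell a)) g"
    and le: "\<And>x. x \<in> cell a \<Longrightarrow> \<bar>f x\<bar> \<le> A * \<bar>v x\<bar> + B * \<bar>g x\<bar> + C"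
  shows "\<bar>LINT x|lebesgue_on (cell a). f x\<bar> \<le> vol * (A * mean_abs (cell a) v + B * mean_abs (cell a) g + C)"
proof -
  have "\<bar>LINT x|lebesgue_on (cell a). f x\<bar> \<le> (LINT x|lebesgue_on (cell a). \<bar>f x\<bar>)"
    by (rule integral_abs_bound)
  also have "\<dots> \<le> (LINT x|lebesgue_on (cell a). A * \<bar>v x\<bar> + B * \<bar>g x\<bar> + C)"
    using f v g le cell_lebesgue
    by (intro integral_mono Bochner_Integration.integrable_add integrable_mult_right integrable_abs
        integrable_const_compact[OF compact_cell]) auto
  also have "\<dots> = A * (LINT x|lebesgue_on (cell a). \<bar>v x\<bar>) + B * (LINT x|lebesgue_on (cell a). \<bar>g x\<bar>) + C * vol"
    using v g integrable_const_compact[OF compact_cell, of C]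
    by (subst Bochner_Integration.integral_add, simp, simp)+ (simp add: cell_lebesgue measure_restrict_space)
  finally show ?thesis using cell_measure_pos by (simp add: mean_abs_def algebra_simps)
qed

lemma flux_le:
  assumes v: "integrable (lebesgue_on (cell a)) v" and g: "integrable (lebesgue_on (cell a)) g"
    and D: "\<And>i. \<bar>dlam i \<beta>\<bar> \<le> D" and \<alpha>: "\<alpha> \<in> hidx (int k)"
  shows "\<bar>flux \<beta> v g \<alpha>\<bar> \<le> vol * (real k * D * mean_abs (cell a) v + mean_abs (cell a) g)"
proof -
  have "\<bar>flux \<beta> v g \<alpha>\<bar> \<le> vol * ((real k * D) * mean_abs (cell a) v + 1 * mean_abs (cell a) g + 0)"
    unfolding flux_def
  proof (rule abs_integral_le[OF _ v g])
    show "integrable (lebesgue_on (cell a)) (\<lambda>x. Dmon \<beta> \<alpha> x * v x + mon lam \<alpha> x * g x)"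
      by (intro Bochner_Integration.integrable_add integrable_mult_continuous[OF compact_cell] continuous_Dmon continuous_mon v g)
    fix x assume x: "x \<in> cell a"
    have "(\<Sum>l\<in>UNIV. \<alpha> l) = k" using \<alpha> by (simp add: hidx_def del: of_nat_sum)
    then have "\<bar>Dmon \<beta> \<alpha> x\<bar> \<le> real k * D" using abs_Dmon_le[OF x D, of \<alpha>] by simp
    then have "\<bar>Dmon \<beta> \<alpha> x * v x\<bar> \<le> real k * D * \<bar>v x\<bar>" unfolding abs_mult by (rule mult_right_mono) simp
    moreover have "\<bar>mon lam \<alpha> x * g x\<bar> \<le> 1 * \<bar>g x\<bar>"
      unfolding abs_mult by (intro mult_right_mono abs_mon_le x) simp
    ultimately show "\<bar>Dmon \<beta> \<alpha> x * v x + mon lam \<alpha> x * g x\<bar> \<le> real k * D * \<bar>v x\<bar> + 1 * \<bar>g x\<bar> + 0"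
      by linarith
  qed
  then show ?thesis by simp
qed

text \<open>For linear \<open>w\<close> the derivative is constant, so a mean-free \<open>v\<close> enters the flux only through its derivative.\<close>

lemma flux_linear_le:
  assumes v: "integrable (lebesgue_on (cell a)) v" "(LINT x|lebesgue_on (cell a). v x) = 0"
    and g: "integrable (lebesgue_on (cell a)) g" and \<alpha>: "\<alpha> \<in> hidx 1"
  shows "\<bar>flux \<beta> v g \<alpha>\<bar> \<le> vol * mean_abs (cell a) g"
proof -
  obtain i where i: "\<alpha> = (\<lambda>j. if j = i then 1 else 0)" using \<alpha> unfolding hidx_1 by blast
  have "Dmon \<beta> \<alpha> = (\<lambda>_. dlam i \<beta>)"
    using dirC1_unique[OF dirC1_Dmon[of \<beta> \<alpha>]] dirC1_bary[of \<beta> i] by (simp add: i mon_single)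
  then have "flux \<beta> v g \<alpha> = (LINT x|lebesgue_on (cell a). mon lam \<alpha> x * g x)"
    unfolding flux_def using v integrable_mult_continuous[OF compact_cell continuous_mon g] by simp
  also have "\<bar>\<dots>\<bar> \<le> vol * (0 * mean_abs (cell a) v + 1 * mean_abs (cell a) g + 0)"
  proof (rule abs_integral_le[OF integrable_mult_continuous[OF compact_cell continuous_mon g] v(1) g])
    fix x assume "x \<in> cell a"
    then show "\<bar>mon lam \<alpha> x * g x\<bar> \<le> 0 * \<bar>v x\<bar> + 1 * \<bar>g x\<bar> + 0"
      using mult_right_mono[OF abs_mon_le[of x \<alpha>], of "\<bar>g x\<bar>"] by (simp add: abs_mult)
  qed
  finally show ?thesis by simp
qed

lemma load_le:
  assumes v: "integrable (lebesgue_on (cell a)) v"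
  shows "\<bar>load \<beta> v j c \<alpha>\<bar> \<le> vol * (mean_abs (cell a) v + real CARD('n option) * l1_norm (hidx j) c)"
proof -
  have "\<bar>load \<beta> v j c \<alpha>\<bar> \<le> vol * (1 * mean_abs (cell a) v + 0 * mean_abs (cell a) v + real CARD('n option) * l1_norm (hidx j) c)"
    unfolding load_def
  proof (rule abs_integral_le[OF _ v v])
    show "integrable (lebesgue_on (cell a)) (\<lambda>x. mon lam \<alpha> x * (v x - signed_bubble a \<beta> x * hp j c x))"
      by (intro integrable_mult_continuous[OF compact_cell] continuous_mon Bochner_Integration.integrable_diff v
          integrable_cell continuous_on_mult continuous_signed_bubble continuous_hp)
    fix x assume x: "x \<in> cell a"
    have "\<bar>signed_bubble a \<beta> x * hp j c x\<bar> \<le> real CARD('n option) * l1_norm (hidx j) c"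
      unfolding abs_mult by (intro mult_mono abs_signed_bubble_le abs_hp_le x) auto
    then have "\<bar>v x - signed_bubble a \<beta> x * hp j c x\<bar> \<le> \<bar>v x\<bar> + real CARD('n option) * l1_norm (hidx j) c"
      by linarith
    moreover have "\<bar>mon lam \<alpha> x * (v x - signed_bubble a \<beta> x * hp j c x)\<bar> \<le> 1 * \<bar>v x - signed_bubble a \<beta> x * hp j c x\<bar>"
      unfolding abs_mult by (intro mult_right_mono abs_mon_le x) simp
    ultimately show "\<bar>mon lam \<alpha> x * (v x - signed_bubble a \<beta> x * hp j c x)\<bar>
        \<le> 1 * \<bar>v x\<bar> + 0 * \<bar>v x\<bar> + real CARD('n option) * l1_norm (hidx j) c"
      by (simp only: mult_1 mult_zero_left add_0_right)
  qed
  then show ?thesis by simp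
qed

end

text \<open>\<open>Wspace\<close> promises some derivative in L_q; the chosen one agrees with it
  almost everywhere and inherits the integrability.\<close>

lemma (in nondegenerate_element) Wspace_facts:
  assumes v: "v \<in> Wspace q \<beta> (cell a)" and q: "q > 1"
  shows "v \<in> Lspace q (cell a)" "integrable (lebesgue_on (cell a)) v"
    "has_dir_deriv (cell a) \<beta> v (dir_deriv (cell a) \<beta> v)"
    "integrable (lebesgue_on (cell a)) (dir_deriv (cell a) \<beta> v)"
    "dir_deriv (cell a) \<beta> v \<in> Lspace q (cell a)"
proof -
  define d where "d = dir_deriv (cell a) \<beta> v"
  obtain g where g: "v \<in> Lspace q (cell a)" "g \<in> Lspace q (cell a)" "has_dir_deriv (cell a) \<beta> v g"
    using v by (auto simp: Wspace_def)
  show "v \<in> Lspace q (cell a)" by fact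
  show "integrable (lebesgue_on (cell a)) v" by (rule Lspace_integrable[OF compact_cell g(1) q])
  show hd: "has_dir_deriv (cell a) \<beta> v (dir_deriv (cell a) \<beta> v)" by (rule dir_deriv_works[OF g(3)])
  then show int: "integrable (lebesgue_on (cell a)) (dir_deriv (cell a) \<beta> v)" by (simp add: has_dir_deriv_def)
  have [measurable]: "d \<in> borel_measurable (lebesgue_on (cell a))" "g \<in> borel_measurable (lebesgue_on (cell a))"
    using int g(2) by (auto simp: d_def Lspace_def)
  have "AE x in lebesgue_on (cell a). d x = g x"
    unfolding d_def by (rule dir_deriv_eq_AE[OF compact_cell negligible_frontier_cell g(3)])
  then have "AE x in lebesgue_on (cell a). \<bar>d x\<bar> powr q = \<bar>g x\<bar> powr q" by eventually_elim simp
  then have "integrable (lebesgue_on (cell a)) (\<lambda>x. \<bar>d x\<bar> powr q) \<longleftrightarrow> integrable (lebesgue_on (cell a)) (\<lambda>x. \<bar>g x\<bar> powr q)"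
    by (intro integrable_cong_AE) measurable
  then show "dir_deriv (cell a) \<beta> v \<in> Lspace q (cell a)"
    using g(2) by (simp add: Lspace_def d_def[symmetric])
qed

context nondegenerate_element
begin

text \<open>Subtracting the mean leaves the derivative as it is, so the chosen derivative of
  \<open>v\<close> is kept for the centred function. The average of the modulus at most
  doubles.\<close>

lemma centred_facts:
  assumes v: "v \<in> Wspace q \<beta> (cell a)" and q: "q > 1"
  defines "m \<equiv> mean (cell a) v"
  shows "integrable (lebesgue_on (cell a)) (\<lambda>x. v x - m)"
    "has_dir_deriv (cell a) \<beta> (\<lambda>x. v x - m) (dir_deriv (cell a) \<beta> v)"
    "(LINT x|lebesgue_on (cell a). v x - m) = 0"
    "\<bar>m\<bar> \<le> mean_abs (cell a) v" "mean_abs (cell a) (\<lambda>x. v x - m) \<le> 2 * mean_abs (cell a) v"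
proof -
  note f = Wspace_facts[OF v q]
  note c = integrable_const_compact[OF compact_cell, of m]
  show 1: "integrable (lebesgue_on (cell a)) (\<lambda>x. v x - m)" using f(2) c by simp
  show "has_dir_deriv (cell a) \<beta> (\<lambda>x. v x - m) (dir_deriv (cell a) \<beta> v)"
    using has_dir_deriv_diff[OF compact_cell f(3) f(2) has_dir_deriv_dirC1[OF compact_cell dirC1_const] c] by simp
  have m: "m * vol = (LINT x|lebesgue_on (cell a). v x)" using cell_measure_pos by (simp add: m_def mean_def)
  show "(LINT x|lebesgue_on (cell a). v x - m) = 0"
    using f(2) c by (simp only: Bochner_Integration.integral_diff integral_cell_const m)
  show m_le: "\<bar>m\<bar> \<le> mean_abs (cell a) v"
    using cell_measure_pos unfolding m_def mean_def mean_abs_def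
    by (simp add: abs_divide divide_right_mono integral_abs_bound)
  have "(LINT x|lebesgue_on (cell a). \<bar>v x - m\<bar>) \<le> (LINT x|lebesgue_on (cell a). \<bar>v x\<bar> + \<bar>m\<bar>)"
    using 1 f(2) integrable_const_compact[OF compact_cell, of "\<bar>m\<bar>"]
    by (intro integral_mono) auto
  also have "\<dots> = (LINT x|lebesgue_on (cell a). \<bar>v x\<bar>) + \<bar>m\<bar> * vol"
    using f(2) integrable_const_compact[OF compact_cell, of "\<bar>m\<bar>"]
    by (simp only: Bochner_Integration.integral_add integrable_abs integral_cell_const)
  finally have "mean_abs (cell a) (\<lambda>x. v x - m) \<le> mean_abs (cell a) v + \<bar>m\<bar>"
    using cell_measure_pos by (simp add: mean_abs_def divide_le_eq distrib_right)
  then show "mean_abs (cell a) (\<lambda>x. v x - m) \<le> 2 * mean_abs (cell a) v" using m_le by simp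
qed

end

context advected_element
begin

lemma fortin_plus_eq:
  assumes v: "v \<in> Wspace q \<beta> (cell a)" and q: "q > 1"
  obtains c e where "solves (\<lambda>x. v x - mean (cell a) v) (dir_deriv (cell a) \<beta> v) c e"
    "fortin k a \<beta> (\<lambda>x. v x - mean (cell a) v) = test_fun \<beta> (int k) c e"
    "fortin_plus k a \<beta> v = (\<lambda>x. mean (cell a) v + test_fun \<beta> (int k) c e x)"
proof -
  obtain c e where s: "solves (\<lambda>x. v x - mean (cell a) v) (dir_deriv (cell a) \<beta> v) c e"
    using solves_exists by blast
  from fortin_solves[OF centred_facts(1,2)[OF v q] this] show ?thesis
    using that[OF s] by (simp add: fortin_plus_def)
qed

lemma fortin_plus_conditions:
  assumes v: "v \<in> Wspace q \<beta> (cell a)" and q: "q > 1"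
  shows "fortin_plus k a \<beta> v \<in> test_space_plus k a \<beta>"
    "\<forall>w\<in>poly_space_perp (int k) (cell a). Dpairing (cell a) \<beta> w (\<lambda>x. fortin_plus k a \<beta> v x - v x) = 0"
    "\<forall>z\<in>poly_space (int k - 2). pairing (cell a) z (\<lambda>x. fortin_plus k a \<beta> v x - v x) = 0"
proof -
  obtain c e where ce: "solves (\<lambda>x. v x - mean (cell a) v) (dir_deriv (cell a) \<beta> v) c e"
    "fortin_plus k a \<beta> v = (\<lambda>x. mean (cell a) v + test_fun \<beta> (int k) c e x)"
    using fortin_plus_eq[OF v q] by metis
  have c: "c \<in> perp_coefs CARD('n) (int k)" "e \<in> coefs (hidx (int k - 2)) {}" using ce(1) by (auto simp: solves_def)
  have "fortin_plus k a \<beta> v = (\<lambda>x. test_fun \<beta> (int k) c e x + (\<lambda>_. mean (cell a) v) x)"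
    unfolding ce(2) by (simp add: add.commute)
  moreover have "test_fun \<beta> (int k) c e \<in> test_space k a \<beta>" using c by (auto simp: test_space_eq)
  moreover have "(\<lambda>_. mean (cell a) v) \<in> poly_space 0" by (rule poly_space_const) simp
  ultimately show "fortin_plus k a \<beta> v \<in> test_space_plus k a \<beta>"
    unfolding test_space_plus_def mem_Collect_eq by (intro exI conjI)
  \<comment> \<open>The mean cancels in the error, so the conditions for the centred function are
    those for \<open>v\<close>.\<close>
  have eq: "(\<lambda>x. fortin_plus k a \<beta> v x - v x) = (\<lambda>x. test_fun \<beta> (int k) c e x - (v x - mean (cell a) v))"
    unfolding ce(2) by (simp add: fun_eq_iff)
  show "\<forall>w\<in>poly_space_perp (int k) (cell a). Dpairing (cell a) \<beta> w (\<lambda>x. fortin_plus k a \<beta> v x - v x) = 0"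
    "\<forall>z\<in>poly_space (int k - 2). pairing (cell a) z (\<lambda>x. fortin_plus k a \<beta> v x - v x) = 0"
    unfolding eq using solves_iff[OF centred_facts(1,2)[OF v q] c] ce(1) by blast+
qed

lemma fortin_plus_const:
  assumes "c \<in> poly_space 0"
  shows "fortin_plus k a \<beta> c = c"
proof -
  obtain r where r: "c = (\<lambda>_. r)" using assms by (auto simp: poly_space_0)
  have "mean (cell a) c = r" using cell_measure_pos by (simp only: r mean_def integral_cell_const) simp
  then have v: "(\<lambda>x. c x - mean (cell a) c) = (\<lambda>_. 0)" by (simp add: r)
  have 0: "integrable (lebesgue_on (cell a)) (\<lambda>_. 0 :: real)" "has_dir_deriv (cell a) \<beta> (\<lambda>_. 0) (\<lambda>_. 0)"
    using has_dir_deriv_dirC1[OF compact_cell dirC1_const[of \<beta> 0]] by auto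
  have "solves (\<lambda>_. 0) (\<lambda>_. 0) (\<lambda>_. 0) (\<lambda>_. 0)"
    by (simp add: solves_def perp_coefs_def coefs_zero bdry_def bform_def flux_def load_def lincomb_def)
  from fortin_solves[OF 0 this] have "fortin k a \<beta> (\<lambda>_. 0) = (\<lambda>_. 0)"
    by (simp add: fun_eq_iff test_fun_def lincomb_def)
  then show ?thesis unfolding fortin_plus_def v using \<open>mean (cell a) c = r\<close> by (simp add: r)
qed

text \<open>Both norms reduce to the bound \<open>S\<close> on the coefficients. The mean costs at
  most the norm of \<open>v\<close> in the first estimate and nothing in the second; a derivative
  costs \<open>D\<close> times the degree k + N.\<close>

lemma fortin_plus_norms:
  assumes v: "v \<in> Wspace q \<beta> (cell a)" and q: "q > 1" and D: "\<And>i. \<bar>dlam i \<beta>\<bar> \<le> D"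
    and s: "solves (\<lambda>x. v x - mean (cell a) v) (dir_deriv (cell a) \<beta> v) c e"
    and S: "real CARD('n option) * l1_norm (hidx (int k)) c + l1_norm (hidx (int k - 2)) e \<le> S"
  shows "Lnorm q (cell a) (fortin_plus k a \<beta> v) \<le> Lnorm q (cell a) v + S * vol powr (1 / q)"
    "Lnorm q (cell a) (dir_deriv (cell a) \<beta> (fortin_plus k a \<beta> v)) \<le> D * (real k + CARD('n)) * S * vol powr (1 / q)"
proof -
  let ?u = "\<lambda>x. mean (cell a) v + test_fun \<beta> (int k) c e x"
  have u: "fortin_plus k a \<beta> v = ?u"
    using fortin_solves[OF centred_facts(1,2)[OF v q] s] by (simp add: fortin_plus_def)
  have "D \<ge> 0" using order_trans[OF abs_ge_zero D] .
  have "0 \<le> real CARD('n option) * l1_norm (hidx (int k)) c + l1_norm (hidx (int k - 2)) e"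
    by (intro add_nonneg_nonneg mult_nonneg_nonneg l1_norm_nonneg) simp
  then have "S \<ge> 0" using S by linarith
  have du: "dirC1 \<beta> ?u (test_fun' \<beta> (int k) c e)"
    using dirC1_add[OF dirC1_const dirC1_test_fun] by simp
  then have cu: "continuous_on UNIV ?u" by (simp add: dirC1_def)
  have "\<bar>?u x\<bar> \<le> mean_abs (cell a) v + S" if "x \<in> cell a" for x
    using abs_test_fun_le[OF that, of \<beta> "int k" c e] S centred_facts(4)[OF v q] by linarith
  then have "Lnorm q (cell a) ?u \<le> (mean_abs (cell a) v + S) * vol powr (1 / q)"
    using integrable_cell[OF cu] q \<open>S \<ge> 0\<close> mean_abs_nonneg[of "cell a" v]
    by (intro Lnorm_bound[OF compact_cell cu]) auto
  also have "\<dots> \<le> Lnorm q (cell a) v + S * vol powr (1 / q)"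
    using mean_abs_le_Lnorm[OF compact_cell cell_measure_pos Wspace_facts(1)[OF v q] q] by (simp add: algebra_simps)
  finally show "Lnorm q (cell a) (fortin_plus k a \<beta> v) \<le> Lnorm q (cell a) v + S * vol powr (1 / q)" by (simp add: u)
  have hd: "has_dir_deriv (cell a) \<beta> ?u (test_fun' \<beta> (int k) c e)" by (rule has_dir_deriv_dirC1[OF compact_cell du])
  have "integrable (lebesgue_on (cell a)) (dir_deriv (cell a) \<beta> ?u)"
    using dir_deriv_works[OF hd] by (simp add: has_dir_deriv_def)
  moreover have "\<bar>test_fun' \<beta> (int k) c e x\<bar> \<le> D * (real k + CARD('n)) * S" if "x \<in> cell a" for x
    using abs_test_fun'_le[OF that D, of k c e] mult_left_mono[OF S, of "D * (real k + CARD('n))"] \<open>D \<ge> 0\<close> by simp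
  ultimately show "Lnorm q (cell a) (dir_deriv (cell a) \<beta> (fortin_plus k a \<beta> v)) \<le> D * (real k + CARD('n)) * S * vol powr (1 / q)"
    unfolding u using \<open>D \<ge> 0\<close> \<open>S \<ge> 0\<close> q
    by (intro Lnorm_bound[OF compact_cell continuous_test_fun(2) _ _ dir_deriv_eq_AE[OF compact_cell negligible_frontier_cell hd]])
       (auto intro: borel_measurable_integrable)
qed

end

text \<open>Dimensionless: s = |beta| / h is divided out of \<open>\<rho> = \<rho>0 * s\<close> and
  of the bound \<open>D0 * s\<close> on the weights. The quotient comes from the coefficient bound,
  the summand 1 from the function itself, and the other summand from its derivative, of degree at
  most 1 + N in the coordinates before differentiation.\<close>

definition lin_const :: "nat \<Rightarrow> real \<Rightarrow> real \<Rightarrow> real \<Rightarrow> real" where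
  "lin_const N \<rho>0 D0 \<kappa> = real (Suc N) / (\<rho>0 * \<kappa>) * (1 + D0 * (1 + real N))"

text \<open>\<open>c1\<close> bounds the coefficients \<open>c\<close>. In \<open>c0\<close> the
  second summand bounds \<open>e\<close>, whose load contains \<open>c\<close> again. The final sum
  is: norm of the mean, function, derivative.\<close>

definition gen_const :: "nat \<Rightarrow> nat \<Rightarrow> real \<Rightarrow> real \<Rightarrow> real \<Rightarrow> real" where
  "gen_const N k \<rho>0 D0 \<kappa> = (let c1 = (2 * real k * D0 + 1) / (\<rho>0 * \<kappa>);
      c0 = real (Suc N) * c1 + (2 + real (Suc N) * c1) / \<kappa>
    in 1 + c0 + D0 * (real k + real N) * c0)"

lemma lin_const_nonneg: "\<rho>0 > 0 \<Longrightarrow> D0 \<ge> 0 \<Longrightarrow> \<kappa> > 0 \<Longrightarrow> lin_const N \<rho>0 D0 \<kappa> \<ge> 0"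
  by (simp add: lin_const_def)

context advected_element
begin

lemma linear_bounds:
  assumes v: "v \<in> Wspace q \<beta> (cell a)" and q: "q > 1" and k: "k = 1"
    and s: "s > 0" "\<rho> = \<rho>0 * s" and D: "\<And>i. \<bar>dlam i \<beta>\<bar> \<le> D0 * s"
  shows "Lnorm q (cell a) (fortin_plus 1 a \<beta> v) \<le> Lnorm q (cell a) v
        + lin_const CARD('n) \<rho>0 D0 \<kappa> * (Lnorm q (cell a) (dir_deriv (cell a) \<beta> v) / s)"
    "Lnorm q (cell a) (dir_deriv (cell a) \<beta> (fortin_plus 1 a \<beta> v))
        \<le> lin_const CARD('n) \<rho>0 D0 \<kappa> * Lnorm q (cell a) (dir_deriv (cell a) \<beta> v)"
proof -
  define g where "g = dir_deriv (cell a) \<beta> v"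
  define M where "M = real (Suc CARD('n))"
  define G where "G = Lnorm q (cell a) g"
  define p where "p = vol powr (1 / q)"
  note W = Wspace_facts[OF v q]
  have "\<rho>0 > 0" using \<rho>(1) s by (simp add: zero_less_mult_iff)
  have "0 \<le> D0 * s" using order_trans[OF abs_ge_zero D] .
  then have "D0 \<ge> 0" using s by (simp add: zero_le_mult_iff)
  have p: "p * mean_abs (cell a) g \<le> G" "p \<ge> 0"
    using mean_abs_le_Lnorm[OF compact_cell cell_measure_pos W(5) q] by (simp_all add: p_def G_def g_def)
  obtain c e where ce: "solves (\<lambda>x. v x - mean (cell a) v) g c e"
    using solves_exists by blast
  have c: "l1_norm (hidx (int k)) c \<le> mean_abs (cell a) g / (\<rho> * \<kappa>)"
    using flux_linear_le[OF centred_facts(1,3)[OF v q] W(4)] k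
    by (intro coef_bound[OF ce] mean_abs_nonneg) (simp add: g_def)
  \<comment> \<open>For k = 1 the index set has degree -1 and is empty, so there is no bubble
    part.\<close>
  have e: "l1_norm (hidx (int k - 2)) e = 0" by (simp add: k l1_norm_def hidx_neg)
  define S where "S = M * (mean_abs (cell a) g / (\<rho> * \<kappa>))"
  have S: "real CARD('n option) * l1_norm (hidx (int k)) c + l1_norm (hidx (int k - 2)) e \<le> S"
    using mult_left_mono[OF c, of M] by (simp add: S_def M_def e card_UNIV_option)
  have Sp: "S * p \<le> M / (\<rho>0 * \<kappa>) * (G / s)"
  proof -
    have "S * p = M / (\<rho>0 * \<kappa>) * ((p * mean_abs (cell a) g) / s)" by (simp add: S_def s(2) mult_ac)
    also have "\<dots> \<le> M / (\<rho>0 * \<kappa>) * (G / s)"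
      using p s \<open>\<rho>0 > 0\<close> \<kappa>_pos by (intro mult_left_mono divide_right_mono) (auto simp: M_def)
    finally show ?thesis .
  qed
  have G: "G \<ge> 0" by (simp add: G_def Lnorm_nonneg)
  have lc: "lin_const CARD('n) \<rho>0 D0 \<kappa> = M / (\<rho>0 * \<kappa>) + D0 * (1 + real CARD('n)) * (M / (\<rho>0 * \<kappa>))"
    unfolding lin_const_def M_def[symmetric] by (simp only: distrib_left mult_1_right mult.commute)
  have Mpos: "0 \<le> M / (\<rho>0 * \<kappa>)" using \<open>\<rho>0 > 0\<close> \<kappa>_pos by (simp add: M_def)
  have "0 \<le> D0 * (1 + real CARD('n)) * (M / (\<rho>0 * \<kappa>))"
    using \<open>D0 \<ge> 0\<close> Mpos by (intro mult_nonneg_nonneg) auto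
  then have "M / (\<rho>0 * \<kappa>) * (G / s) \<le> lin_const CARD('n) \<rho>0 D0 \<kappa> * (G / s)"
    using G s by (intro mult_right_mono) (auto simp: lc)
  then show "Lnorm q (cell a) (fortin_plus 1 a \<beta> v) \<le> Lnorm q (cell a) v
        + lin_const CARD('n) \<rho>0 D0 \<kappa> * (Lnorm q (cell a) (dir_deriv (cell a) \<beta> v) / s)"
    using fortin_plus_norms(1)[OF v q D ce[unfolded g_def] S] Sp k by (simp add: G_def g_def p_def)
  have "Lnorm q (cell a) (dir_deriv (cell a) \<beta> (fortin_plus 1 a \<beta> v)) \<le> D0 * s * (1 + CARD('n)) * S * p"
    using fortin_plus_norms(2)[OF v q D ce[unfolded g_def] S] k by (simp add: p_def)
  also have "\<dots> = D0 * s * (1 + CARD('n)) * (S * p)" by simp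
  also have "\<dots> \<le> D0 * s * (1 + CARD('n)) * (M / (\<rho>0 * \<kappa>) * (G / s))"
    using Sp \<open>0 \<le> D0 * s\<close> by (intro mult_left_mono) auto
  also have "\<dots> = D0 * (1 + real CARD('n)) * (M / (\<rho>0 * \<kappa>)) * G" using s by simp
  also have "\<dots> \<le> lin_const CARD('n) \<rho>0 D0 \<kappa> * G"
    using G Mpos by (intro mult_right_mono) (auto simp: lc)
  finally show "Lnorm q (cell a) (dir_deriv (cell a) \<beta> (fortin_plus 1 a \<beta> v))
        \<le> lin_const CARD('n) \<rho>0 D0 \<kappa> * Lnorm q (cell a) (dir_deriv (cell a) \<beta> v)" by (simp add: G_def g_def)
qed

lemma general_bound:
  assumes v: "v \<in> Wspace q \<beta> (cell a)" and q: "q > 1"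
    and s: "s > 0" "\<rho> = \<rho>0 * s" "crossing_time a \<beta> = 1 / s" and D: "\<And>i. \<bar>dlam i \<beta>\<bar> \<le> D0 * s"
  shows "tnorm q a \<beta> (fortin_plus k a \<beta> v) \<le> gen_const CARD('n) k \<rho>0 D0 \<kappa> * tnorm q a \<beta> v"
proof -
  define g where "g = dir_deriv (cell a) \<beta> v"
  define M where "M = real (Suc CARD('n))"
  define V where "V = Lnorm q (cell a) v"
  define G where "G = Lnorm q (cell a) g"
  define p where "p = vol powr (1 / q)"
  \<comment> \<open>The averaged counterpart of the triple norm: 1/s is the crossing time.\<close>
  define A where "A = mean_abs (cell a) v + mean_abs (cell a) g / s"
  define c1 where "c1 = (2 * real k * D0 + 1) / (\<rho>0 * \<kappa>)"
  define c0 where "c0 = M * c1 + (2 + M * c1) / \<kappa>"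
  note W = Wspace_facts[OF v q]
  have "\<rho>0 > 0" using \<rho>(1) s by (simp add: zero_less_mult_iff)
  have Ds: "0 \<le> D0 * s" using order_trans[OF abs_ge_zero D] .
  then have "D0 \<ge> 0" using s by (simp add: zero_le_mult_iff)
  have p: "p * mean_abs (cell a) v \<le> V" "p * mean_abs (cell a) g \<le> G" "p \<ge> 0"
    using mean_abs_le_Lnorm[OF compact_cell cell_measure_pos W(5) q] mean_abs_le_Lnorm[OF compact_cell cell_measure_pos W(1) q]
    by (simp_all add: p_def G_def V_def g_def)
  have pA: "A * p \<le> V + G / s"
  proof -
    have "(p * mean_abs (cell a) g) / s \<le> G / s" using p s by (intro divide_right_mono) auto
    then show ?thesis using p(1) by (simp add: A_def algebra_simps)
  qed
  have A: "mean_abs (cell a) v \<le> A" "mean_abs (cell a) g / s \<le> A" "A \<ge> 0"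
    using s mean_abs_nonneg[of "cell a" v] mean_abs_nonneg[of "cell a" g] by (auto simp: A_def)
  obtain c e where ce: "solves (\<lambda>x. v x - mean (cell a) v) g c e"
    using solves_exists by blast
  let ?v0 = "\<lambda>x. v x - mean (cell a) v"
  have v0: "mean_abs (cell a) ?v0 \<le> 2 * mean_abs (cell a) v" using centred_facts(5)[OF v q] .
  have "l1_norm (hidx (int k)) c \<le> (real k * (D0 * s) * mean_abs (cell a) ?v0 + mean_abs (cell a) g) / (\<rho> * \<kappa>)"
    using flux_le[OF centred_facts(1)[OF v q] W(4) D] \<open>D0 \<ge> 0\<close> s(1)
    by (intro coef_bound[OF ce] add_nonneg_nonneg mult_nonneg_nonneg mean_abs_nonneg) (auto simp: g_def)
  also have "\<dots> \<le> (real k * (D0 * s) * (2 * A) + s * A) / (\<rho> * \<kappa>)"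
  proof (intro divide_right_mono add_mono mult_left_mono)
    show "mean_abs (cell a) ?v0 \<le> 2 * A" using v0 A(1) by simp
    show "mean_abs (cell a) g \<le> s * A" using A(2) s by (simp add: divide_le_eq mult.commute)
  qed (use Ds \<rho>(1) \<kappa>_pos in auto)
  also have "\<dots> = c1 * A" using s \<open>\<rho>0 > 0\<close> \<kappa>_pos by (simp add: c1_def s(2) field_simps)
  finally have c: "l1_norm (hidx (int k)) c \<le> c1 * A" .
  then have Mc: "M * l1_norm (hidx (int k)) c \<le> M * (c1 * A)" by (intro mult_left_mono) (auto simp: M_def)
  have "l1_norm (hidx (int k - 2)) e \<le> (mean_abs (cell a) ?v0 + M * l1_norm (hidx (int k)) c) / \<kappa>"
    using load_le[OF centred_facts(1)[OF v q], of \<beta> "int k" c]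
    by (intro coef_bound'[OF ce] add_nonneg_nonneg mult_nonneg_nonneg mean_abs_nonneg l1_norm_nonneg) (auto simp: M_def card_UNIV_option)
  also have "\<dots> \<le> (2 * A + M * (c1 * A)) / \<kappa>"
    using v0 A(1) Mc \<kappa>_pos by (intro divide_right_mono) auto
  finally have e: "l1_norm (hidx (int k - 2)) e \<le> (2 + M * c1) / \<kappa> * A" by (simp add: distrib_right mult.assoc)
  have S: "real CARD('n option) * l1_norm (hidx (int k)) c + l1_norm (hidx (int k - 2)) e \<le> c0 * A"
    using Mc e by (simp add: c0_def M_def distrib_right card_UNIV_option mult.assoc)
  have "c1 \<ge> 0" unfolding c1_def using \<open>D0 \<ge> 0\<close> \<open>\<rho>0 > 0\<close> \<kappa>_pos by simp
  then have "c0 \<ge> 0" unfolding c0_def using \<kappa>_pos by (simp add: M_def)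
  define T where "T = V + G / s"
  have "c0 * A * p \<le> c0 * T" using mult_left_mono[OF pA \<open>c0 \<ge> 0\<close>] by (simp add: T_def mult.assoc)
  have "G / s \<ge> 0" using s by (simp add: G_def Lnorm_nonneg)
  have 1: "Lnorm q (cell a) (fortin_plus k a \<beta> v) \<le> T + c0 * T"
    using fortin_plus_norms(1)[OF v q D ce[unfolded g_def] S] \<open>c0 * A * p \<le> c0 * T\<close> \<open>G / s \<ge> 0\<close>
    by (simp add: p_def V_def T_def)
  have "Lnorm q (cell a) (dir_deriv (cell a) \<beta> (fortin_plus k a \<beta> v)) \<le> D0 * s * (real k + CARD('n)) * (c0 * A * p)"
    using fortin_plus_norms(2)[OF v q D ce[unfolded g_def] S] by (simp add: p_def mult.assoc)
  also have "\<dots> \<le> D0 * s * (real k + CARD('n)) * (c0 * T)"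
    using \<open>c0 * A * p \<le> c0 * T\<close> Ds by (intro mult_left_mono) auto
  finally have "1 / s * Lnorm q (cell a) (dir_deriv (cell a) \<beta> (fortin_plus k a \<beta> v)) \<le> 1 / s * (D0 * s * (real k + CARD('n)) * (c0 * T))"
    using s by (intro mult_left_mono) auto
  also have "\<dots> = D0 * (real k + CARD('n)) * c0 * T" using s by simp
  finally have 2: "1 / s * Lnorm q (cell a) (dir_deriv (cell a) \<beta> (fortin_plus k a \<beta> v)) \<le> D0 * (real k + CARD('n)) * c0 * T" .
  have g: "gen_const CARD('n) k \<rho>0 D0 \<kappa> * T = T + c0 * T + D0 * (real k + CARD('n)) * c0 * T"
    unfolding gen_const_def Let_def M_def[symmetric] c1_def[symmetric] c0_def[symmetric] by (simp add: distrib_right)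
  have t: "tnorm q a \<beta> v = T" by (simp add: tnorm_def s(3) T_def V_def G_def g_def)
  have "tnorm q a \<beta> (fortin_plus k a \<beta> v) \<le> T + c0 * T + D0 * (real k + CARD('n)) * c0 * T"
    using 1 2 unfolding tnorm_def s(3) by linarith
  then show ?thesis unfolding t g .
qed

end

text \<open>With at least three vertices each facet bubble has a factor \<open>lam l\<close> with
  \<open>l \<noteq> None\<close>, which vanishes at \<open>a None\<close>; so does the full bubble.
  Every test function is therefore zero at that vertex, and a constant one is zero
  everywhere.\<close>

lemma (in nondegenerate_element) test_space_constants:
  assumes "CARD('n) \<ge> 2"
  shows "test_space k a \<beta> \<inter> poly_space 0 = {\<lambda>x. 0}"
proof (intro equalityI subsetI)
  fix u assume u: "u \<in> test_space k a \<beta> \<inter> poly_space 0"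
  then obtain r where r: "u = (\<lambda>_. r)" by (auto simp: poly_space_0)
  obtain c e where ce: "u = test_fun \<beta> (int k) c e" using u by (auto simp: test_space_eq)
  have "mon lam (facet_idx i) (a None) = 0" for i
  proof -
    have "card {i, None} < CARD('n option)"
      using assms card_insert_le_m1[of 2 "{None}" i] by (simp add: card_UNIV_option)
    then have "\<not> UNIV \<subseteq> {i, None}" using card_mono[of "{i, None}" UNIV] by auto
    then obtain l where "l \<noteq> i" "l \<noteq> None" by blast
    then show ?thesis
      unfolding mon_def by (intro prod_zero bexI[of _ l]) (auto simp: bary_vertex facet_idx_def)
  qed
  moreover have "bubble a (a None) = 0"
    unfolding bubble_def by (intro prod_zero bexI[of _ "Some undefined"]) (auto simp: bary_vertex)
  ultimately have "u (a None) = 0" by (simp add: ce test_fun_def signed_bubble_eq)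
  then show "u \<in> {\<lambda>x. 0}" using r by simp
next
  fix u :: "real^'n \<Rightarrow> real" assume "u \<in> {\<lambda>x. 0}"
  then have u: "u = (\<lambda>_. 0)" by simp
  have "u = test_fun \<beta> (int k) (\<lambda>_. 0) (\<lambda>_. 0)" by (simp add: u test_fun_def lincomb_def fun_eq_iff)
  then have "u \<in> test_space k a \<beta>"
    unfolding test_space_eq using coefs_zero by (auto simp: perp_coefs_def)
  then show "u \<in> test_space k a \<beta> \<inter> poly_space 0" using poly_space_const[of 0 0] u by simp
qed

lemma (in nondegenerate_element) crossing_time_eq: "crossing_time a \<beta> = 1 / (norm \<beta> / h)"
  by (simp add: crossing_time_def)

lemma (in nondegenerate_element) advected_linear:
  assumes "\<beta> \<noteq> 0" "coercive TYPE('n option) CARD('n) 1 \<kappa>"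
  shows "\<exists>I. advected_element a \<beta> 1 I (1 / (real CARD('n option))\<^sup>2 * (norm \<beta> / h)) \<kappa>"
proof -
  obtain i j where ij: "i \<noteq> j" "norm \<beta> / h / (real CARD('n option))\<^sup>2 \<le> \<bar>dlam i \<beta>\<bar>"
      "norm \<beta> / h / (real CARD('n option))\<^sup>2 \<le> \<bar>dlam j \<beta>\<bar>"
    using two_large_dlam[OF assms(1)] by blast
  have "advected_element a \<beta> 1 {i, j} (1 / (real CARD('n option))\<^sup>2 * (norm \<beta> / h)) \<kappa>"
  proof unfold_locales
    show "unisolvent (int 1) {i, j}" using ij(1) by (auto simp: unisolvent_def)
    show "0 < 1 / (real CARD('n option))\<^sup>2 * (norm \<beta> / h)"
      using assms(1) diameter_pos by (intro mult_pos_pos divide_pos_pos) (simp_all add: card_UNIV_option)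
  qed (use ij assms(2) in \<open>auto simp: mult.commute\<close>)
  then show ?thesis ..
qed

lemma (in nondegenerate_element) advected_nontangential:
  assumes "\<beta> \<noteq> 0" "\<theta> > 0" "\<And>i. \<bar>\<beta> \<bullet> normal a i\<bar> \<ge> \<theta> * norm \<beta>"
    and "coercive TYPE('n option) CARD('n) (int k) \<kappa>"
  shows "advected_element a \<beta> k UNIV (\<theta> * (norm \<beta> / h)) \<kappa>"
proof unfold_locales
  show "unisolvent (int k) UNIV" by (simp add: unisolvent_def)
  show "0 < \<theta> * (norm \<beta> / h)" using assms(1,2) diameter_pos by simp
  show "\<theta> * (norm \<beta> / h) \<le> \<bar>dlam i \<beta>\<bar>" for i using dlam_lower[OF assms(3)] assms(2) by simp
qed fact

lemma hypotheses_element: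
  assumes "hypotheses k p q \<kappa>0 \<theta>0 \<Omega> \<T> \<beta>" "K \<in> \<T>"
  shows "nondegenerate_element K" "\<beta> K \<noteq> 0" "1 < q" "0 < \<kappa>0" "0 < \<theta>0"
    "matrix_norm (elem_matrix K) * matrix_norm (matrix_inv (elem_matrix K)) \<le> \<kappa>0"
    "k = 1 \<or> (\<forall>i. \<theta>0 * norm (\<beta> K) \<le> \<bar>\<beta> K \<bullet> normal K i\<bar>)"
proof -
  have "1 < p" "q = p / (p - 1)" using assms(1) by (simp_all add: hypotheses_def)
  then show "1 < q" by (simp add: less_divide_eq)
qed (use assms in \<open>auto simp: hypotheses_def conforming_mesh_def shape_regular_def advection_field_def
      nontangential_def nondegenerate_element_def\<close>)

text \<open>Since \<open>coercive\<close> mentions no element, a constant obtained from one element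
  is valid for all. Fixing it as a function of \<open>k\<close> alone makes the final constants
  independent of the mesh.\<close>

lemma coercivity_constants:
  "\<exists>\<kappa> :: nat \<Rightarrow> real. \<forall>k. \<kappa> k > 0 \<and>
     (\<forall>a :: 'n::finite element. nondegenerate_element a \<longrightarrow> coercive TYPE('n option) CARD('n) (int k) (\<kappa> k))"
proof -
  have "\<exists>\<kappa>. \<kappa> > 0 \<and> (\<forall>a :: 'n element. nondegenerate_element a \<longrightarrow> coercive TYPE('n option) CARD('n) (int k) \<kappa>)" for k
  proof (cases "\<exists>a :: 'n element. nondegenerate_element a")
    case True
    then obtain \<kappa> where "coercive TYPE('n option) CARD('n) (int k) \<kappa>"
      using nondegenerate_element.coercive_exists by blast
    then show ?thesis by (auto simp: coercive_def)
  next
    case False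
    then show ?thesis by (intro exI[of _ 1]) simp
  qed
  then show ?thesis by (intro choice allI)
qed

lemma gen_const_nonneg: "\<rho>0 > 0 \<Longrightarrow> D0 \<ge> 0 \<Longrightarrow> \<kappa> > 0 \<Longrightarrow> gen_const N k \<rho>0 D0 \<kappa> \<ge> 0"
  unfolding gen_const_def Let_def
  by (intro add_nonneg_nonneg mult_nonneg_nonneg divide_nonneg_nonneg) auto

lemma (in nondegenerate_element) linear_case:
  assumes \<beta>: "\<beta> \<noteq> 0" and \<kappa>: "coercive TYPE('n option) CARD('n) 1 \<kappa>"
    and reg: "matrix_norm (elem_matrix a) * matrix_norm (matrix_inv (elem_matrix a)) \<le> \<kappa>0"
    and v: "v \<in> Wspace q \<beta> (cell a)" and q: "q > 1"
  defines "C \<equiv> lin_const CARD('n) (1 / (real CARD('n option))\<^sup>2) (2 * \<kappa>0 * real CARD('n option)) \<kappa>"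
  shows "Lnorm q (cell a) (fortin_plus 1 a \<beta> v) \<le> Lnorm q (cell a) v
        + C * (crossing_time a \<beta> * Lnorm q (cell a) (dir_deriv (cell a) \<beta> v))"
    "Lnorm q (cell a) (dir_deriv (cell a) \<beta> (fortin_plus 1 a \<beta> v))
        \<le> C * Lnorm q (cell a) (dir_deriv (cell a) \<beta> v)"
proof -
  obtain I where "advected_element a \<beta> 1 I (1 / (real CARD('n option))\<^sup>2 * (norm \<beta> / h)) \<kappa>"
    using advected_linear[OF \<beta> \<kappa>] by blast
  then interpret A: advected_element a \<beta> 1 I "1 / (real CARD('n option))\<^sup>2 * (norm \<beta> / h)" \<kappa> .
  have s: "norm \<beta> / h > 0" using \<beta> diameter_pos by simp
  note b = A.linear_bounds[OF v q refl s refl dlam_upper[OF reg]]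
  show "Lnorm q (cell a) (fortin_plus 1 a \<beta> v) \<le> Lnorm q (cell a) v
        + C * (crossing_time a \<beta> * Lnorm q (cell a) (dir_deriv (cell a) \<beta> v))"
    "Lnorm q (cell a) (dir_deriv (cell a) \<beta> (fortin_plus 1 a \<beta> v))
        \<le> C * Lnorm q (cell a) (dir_deriv (cell a) \<beta> v)"
    using b by (simp_all add: C_def crossing_time_def mult_ac del: card_UNIV_option)
qed

lemma powr_sum_scale_le:
  fixes f g :: "'b \<Rightarrow> real"
  assumes "\<And>s. s \<in> S \<Longrightarrow> 0 \<le> f s" "\<And>s. s \<in> S \<Longrightarrow> 0 \<le> g s" "\<And>s. s \<in> S \<Longrightarrow> f s \<le> C * g s"
    and "C \<ge> 0" "q > 1"
  shows "(\<Sum>s\<in>S. f s powr q) powr (1 / q) \<le> C * (\<Sum>s\<in>S. g s powr q) powr (1 / q)"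
proof -
  have "(\<Sum>s\<in>S. f s powr q) \<le> (\<Sum>s\<in>S. (C * g s) powr q)"
    using assms by (intro sum_mono powr_mono2) auto
  also have "\<dots> = C powr q * (\<Sum>s\<in>S. g s powr q)"
    using assms by (simp add: powr_mult sum_distrib_left)
  finally have "(\<Sum>s\<in>S. f s powr q) powr (1 / q) \<le> (C powr q * (\<Sum>s\<in>S. g s powr q)) powr (1 / q)"
    using assms by (intro powr_mono2 sum_nonneg) auto
  also have "\<dots> = C * (\<Sum>s\<in>S. g s powr q) powr (1 / q)"
    using assms by (simp add: powr_mult powr_powr sum_nonneg)
  finally show ?thesis .
qed

lemma (in nondegenerate_element) tnorm_nonneg: "tnorm q a \<beta> v \<ge> 0"
  unfolding tnorm_def crossing_time_def using diameter_pos
  by (intro add_nonneg_nonneg mult_nonneg_nonneg Lnorm_nonneg) simp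

text \<open>Division by \<open>s \<ge> a\<close> turns \<open>C * (a * G)\<close> into at most
  \<open>C * G\<close>, which joins the derivative bound for a total of \<open>2 * (C * G)\<close>.
  The derivative estimate must be free of \<open>V\<close> for this, since \<open>V\<close> without
  the factor \<open>inverse s\<close> could not be absorbed.\<close>

lemma weighted_estimate:
  fixes V G V' G' C a s :: real
  assumes "V' \<le> V + C * (a * G)" "G' \<le> C * G" "a \<le> s" "0 < a" "0 \<le> C" "0 \<le> G" "0 \<le> V"
  shows "inverse s * V' + G' \<le> 2 * (1 + C) * (inverse s * V + G)"
proof -
  have "s > 0" using assms by linarith
  have "inverse s * V' \<le> inverse s * (V + C * (a * G))"
    using assms \<open>s > 0\<close> by (intro mult_left_mono) auto
  also have "\<dots> = inverse s * V + C * G * (a / s)" by (simp add: distrib_left divide_inverse mult_ac)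
  also have "\<dots> \<le> inverse s * V + C * G * 1"
    using assms \<open>s > 0\<close> by (intro add_left_mono mult_left_mono) auto
  finally have "inverse s * V' + G' \<le> inverse s * V + 2 * (C * G)" using assms(2) by simp
  also have "\<dots> \<le> 2 * (1 + C) * (inverse s * V + G)"
  proof -
    have "0 \<le> inverse s * V" "0 \<le> C * (inverse s * V)" "0 \<le> C * G" using assms \<open>s > 0\<close> by auto
    then show ?thesis using assms(6) by (simp add: algebra_simps)
  qed
  finally show ?thesis .
qed

theorem theorem6p2:
  shows
  "(\<forall>k p q \<kappa>0 \<theta>0 (\<Omega> :: (real^'n) set) \<T> \<beta>. hypotheses k p q \<kappa>0 \<theta>0 \<Omega> \<T> \<beta> \<longrightarrow>
      (\<forall>K\<in>\<T>.
         (\<forall>v\<in>Wspace q (\<beta> K) (cell K).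
            fortin_plus k K (\<beta> K) v \<in> test_space_plus k K (\<beta> K) \<and>
            (\<forall>w\<in>poly_space_perp (int k) (cell K).
               Dpairing (cell K) (\<beta> K) w (\<lambda>x. fortin_plus k K (\<beta> K) v x - v x) = 0) \<and>
            (\<forall>z\<in>poly_space (int k - 2).
               pairing (cell K) z (\<lambda>x. fortin_plus k K (\<beta> K) v x - v x) = 0)) \<and>
         (\<forall>c\<in>poly_space 0. fortin_plus k K (\<beta> K) c = c) \<and>
         (CARD('n) \<ge> 2 \<longrightarrow> test_space k K (\<beta> K) \<inter> poly_space 0 = {\<lambda>x. 0})))
   \<and>
   (\<exists>C :: real \<Rightarrow> real \<Rightarrow> real.
      \<forall>p q \<kappa>0 \<theta>0 (\<Omega> :: (real^'n) set) \<T> \<beta>. hypotheses 1 p q \<kappa>0 \<theta>0 \<Omega> \<T> \<beta> \<longrightarrow>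
        (\<forall>K\<in>\<T>. \<forall>v\<in>Wspace q (\<beta> K) (cell K).
           Lnorm q (cell K) (fortin_plus 1 K (\<beta> K) v)
             \<le> C q \<kappa>0 * (Lnorm q (cell K) v
                 + crossing_time K (\<beta> K) * Lnorm q (cell K) (dir_deriv (cell K) (\<beta> K) v)) \<and>
           Lnorm q (cell K) (dir_deriv (cell K) (\<beta> K) (fortin_plus 1 K (\<beta> K) v))
             \<le> C q \<kappa>0 * Lnorm q (cell K) (dir_deriv (cell K) (\<beta> K) v)) \<and>
        (\<forall>\<sigma>. (\<forall>K\<in>\<T>. \<sigma> K \<ge> crossing_time K (\<beta> K)) \<longrightarrow>
           (\<forall>K\<in>\<T>. \<forall>v\<in>Wspace q (\<beta> K) (cell K).
              inverse (\<sigma> K) * Lnorm q (cell K) (fortin_plus 1 K (\<beta> K) v)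
                + Lnorm q (cell K) (dir_deriv (cell K) (\<beta> K) (fortin_plus 1 K (\<beta> K) v))
              \<le> C q \<kappa>0 * (inverse (\<sigma> K) * Lnorm q (cell K) v
                  + Lnorm q (cell K) (dir_deriv (cell K) (\<beta> K) v)))))
   \<and>
   (\<exists>C :: nat \<Rightarrow> real \<Rightarrow> real \<Rightarrow> real \<Rightarrow> real.
      (\<forall>q \<theta> \<theta>' \<kappa>. C 1 q \<theta> \<kappa> = C 1 q \<theta>' \<kappa>) \<and>
      (\<forall>k p q \<kappa>0 \<theta>0 (\<Omega> :: (real^'n) set) \<T> \<beta>. hypotheses k p q \<kappa>0 \<theta>0 \<Omega> \<T> \<beta> \<longrightarrow>
        (\<forall>K\<in>\<T>. \<forall>v\<in>Wspace q (\<beta> K) (cell K).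
           tnorm q K (\<beta> K) (fortin_plus k K (\<beta> K) v) \<le> C k q \<theta>0 \<kappa>0 * tnorm q K (\<beta> K) v) \<and>
        (\<forall>v\<in>Wspace_mesh q \<beta> \<T>.
           tnorm_mesh q \<beta> \<T> (fortin_plus_mesh k \<beta> v) \<le> C k q \<theta>0 \<kappa>0 * tnorm_mesh q \<beta> \<T> v)))"
proof -
  obtain \<kappa> :: "nat \<Rightarrow> real" where \<kappa>: "\<And>k. \<kappa> k > 0"
    "\<And>k (a :: 'n element). nondegenerate_element a \<Longrightarrow> coercive TYPE('n option) CARD('n) (int k) (\<kappa> k)"
    using coercivity_constants by blast
  define M where "M = real CARD('n option)"
  have "M > 0" by (simp add: M_def)
  define L where "L \<kappa>0 = lin_const CARD('n) (1 / M\<^sup>2) (2 * \<kappa>0 * M) (\<kappa> 1)" for \<kappa>0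
  have L: "0 \<le> L \<kappa>0" if "0 < \<kappa>0" for \<kappa>0
    unfolding L_def using that \<open>M > 0\<close> \<kappa>(1) by (intro lin_const_nonneg) auto
  have adv: "\<exists>I \<rho>. advected_element K (\<beta> K) k I \<rho> (\<kappa> k)"
    if "hypotheses k p q \<kappa>0 \<theta>0 \<Omega> \<T> \<beta>" "K \<in> \<T>"
    for k p q \<kappa>0 \<theta>0 and \<Omega> :: "(real^'n) set" and \<T> \<beta> K
  proof -
    note H = hypotheses_element[OF that]
    interpret nondegenerate_element K by (rule H)
    show ?thesis
    proof (cases "k = 1")
      case True
      then show ?thesis using advected_linear[OF H(2), of "\<kappa> 1"] \<kappa>(2)[OF H(1), of 1] by auto
    next
      case False
      then show ?thesis using advected_nontangential[OF H(2) H(5) _ \<kappa>(2)[OF H(1)]] H(7) by blast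
    qed
  qed
  have lin: "Lnorm q (cell K) (fortin_plus 1 K (\<beta> K) v) \<le> Lnorm q (cell K) v
        + L \<kappa>0 * (crossing_time K (\<beta> K) * Lnorm q (cell K) (dir_deriv (cell K) (\<beta> K) v))"
    "Lnorm q (cell K) (dir_deriv (cell K) (\<beta> K) (fortin_plus 1 K (\<beta> K) v))
        \<le> L \<kappa>0 * Lnorm q (cell K) (dir_deriv (cell K) (\<beta> K) v)"
    "0 < crossing_time K (\<beta> K)"
    if "hypotheses 1 p q \<kappa>0 \<theta>0 \<Omega> \<T> \<beta>" "K \<in> \<T>" "v \<in> Wspace q (\<beta> K) (cell K)"
    for p q \<kappa>0 \<theta>0 and \<Omega> :: "(real^'n) set" and \<T> \<beta> K v
  proof -
    note H = hypotheses_element[OF that(1,2)]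
    interpret nondegenerate_element K by (rule H)
    have "coercive TYPE('n option) CARD('n) 1 (\<kappa> 1)" using \<kappa>(2)[OF H(1), of 1] by simp
    note linear_case[OF H(2) this H(6) that(3) H(3)]
    then show "Lnorm q (cell K) (fortin_plus 1 K (\<beta> K) v) \<le> Lnorm q (cell K) v
        + L \<kappa>0 * (crossing_time K (\<beta> K) * Lnorm q (cell K) (dir_deriv (cell K) (\<beta> K) v))"
      "Lnorm q (cell K) (dir_deriv (cell K) (\<beta> K) (fortin_plus 1 K (\<beta> K) v))
        \<le> L \<kappa>0 * Lnorm q (cell K) (dir_deriv (cell K) (\<beta> K) v)"
      by (simp_all only: L_def M_def)
    show "0 < crossing_time K (\<beta> K)" using diameter_pos H(2) by (simp add: crossing_time_def)
  qed
  \<comment> \<open>For k = 1 the constant comes from the linear case, where \<open>\<theta>\<close>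
    does not occur.\<close>
  define C where "C k q \<theta> \<kappa>0 = (if k = 1 then 2 * (1 + L \<kappa>0) else gen_const CARD('n) k \<theta> (2 * \<kappa>0 * M) (\<kappa> k))"
    for k :: nat and q \<theta> \<kappa>0 :: real
  have tn: "tnorm q K (\<beta> K) (fortin_plus k K (\<beta> K) v) \<le> C k q \<theta>0 \<kappa>0 * tnorm q K (\<beta> K) v"
    if hyp: "hypotheses k p q \<kappa>0 \<theta>0 \<Omega> \<T> \<beta>" "K \<in> \<T>" and v: "v \<in> Wspace q (\<beta> K) (cell K)"
    for k p q \<kappa>0 \<theta>0 and \<Omega> :: "(real^'n) set" and \<T> \<beta> K v
  proof -
    note H = hypotheses_element[OF hyp]
    interpret nondegenerate_element K by (rule H)
    show ?thesis
    proof (cases "k = 1")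
      case True
      note l = lin[OF hyp(1)[unfolded True] hyp(2) v]
      \<comment> \<open>With the crossing time itself as weight, multiplication by it turns the
        weighted sum into \<open>tnorm\<close>.\<close>
      define s where "s = crossing_time K (\<beta> K)"
      have "s > 0" using l(3) by (simp add: s_def)
      have "inverse s * Lnorm q (cell K) (fortin_plus 1 K (\<beta> K) v)
                + Lnorm q (cell K) (dir_deriv (cell K) (\<beta> K) (fortin_plus 1 K (\<beta> K) v))
              \<le> 2 * (1 + L \<kappa>0) * (inverse s * Lnorm q (cell K) v
                  + Lnorm q (cell K) (dir_deriv (cell K) (\<beta> K) v))"
        using l L[OF H(4)] by (intro weighted_estimate) (auto simp: s_def Lnorm_nonneg)
      then have "s * (inverse s * Lnorm q (cell K) (fortin_plus 1 K (\<beta> K) v)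
                + Lnorm q (cell K) (dir_deriv (cell K) (\<beta> K) (fortin_plus 1 K (\<beta> K) v)))
              \<le> s * (2 * (1 + L \<kappa>0) * (inverse s * Lnorm q (cell K) v
                  + Lnorm q (cell K) (dir_deriv (cell K) (\<beta> K) v)))"
        using \<open>s > 0\<close> by (intro mult_left_mono) auto
      moreover have "s * (inverse s * x + y) = x + s * y" for x y using \<open>s > 0\<close> by (simp add: distrib_left)
      ultimately show ?thesis
        using True by (simp add: tnorm_def C_def s_def[symmetric] mult.left_commute[of s])
    next
      case False
      then interpret A: advected_element K "\<beta> K" k UNIV "\<theta>0 * (norm (\<beta> K) / h)" "\<kappa> k"
        using H(7) by (intro advected_nontangential H(2,5) \<kappa>(2)[OF H(1)]) auto
      have "norm (\<beta> K) / h > 0" using H(2) diameter_pos by simp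
      from A.general_bound[OF v H(3) this refl crossing_time_eq dlam_upper[OF H(6)]] False
      show ?thesis by (simp only: C_def M_def if_False)
    qed
  qed
  show ?thesis
  proof (intro conjI, goal_cases)
    case 1
    show ?case
    proof (intro allI impI ballI, goal_cases)
      case (1 k p q \<kappa>0 \<theta>0 \<Omega> \<T> \<beta> K)
      note H = hypotheses_element[OF 1]
      obtain I \<rho> where "advected_element K (\<beta> K) k I \<rho> (\<kappa> k)" using adv[OF 1] by blast
      then interpret advected_element K "\<beta> K" k I \<rho> "\<kappa> k" .
      show ?case
        using fortin_plus_conditions[OF _ H(3)] fortin_plus_const test_space_constants by blast
    qed
  next
    case 2
    show ?case
    \<comment> \<open>One constant for all three inequalities, taken from the weighted one; it
      dominates both 1 and \<open>L \<kappa>0\<close>, as the other two require.\<close>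
    proof (intro exI[of _ "\<lambda>q \<kappa>0. 2 * (1 + L \<kappa>0)"] allI impI conjI ballI, goal_cases)
      case hyp: (1 p q \<kappa>0 \<theta>0 \<Omega> \<T> \<beta> K v)
      note l = lin[OF hyp]
      have "0 \<le> L \<kappa>0" using L hypotheses_element(4)[OF hyp(1,2)] .
      define V where "V = Lnorm q (cell K) v"
      define G where "G = Lnorm q (cell K) (dir_deriv (cell K) (\<beta> K) v)"
      have VG: "0 \<le> V" "0 \<le> G" by (simp_all add: V_def G_def Lnorm_nonneg)
      have aG: "0 \<le> crossing_time K (\<beta> K) * G" "0 \<le> L \<kappa>0 * V" "0 \<le> L \<kappa>0 * (crossing_time K (\<beta> K) * G)" "0 \<le> L \<kappa>0 * G"
        using VG l(3) \<open>0 \<le> L \<kappa>0\<close> by auto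
      have exp: "2 * (1 + L \<kappa>0) * (V + t) = 2 * V + 2 * t + 2 * (L \<kappa>0 * V) + 2 * (L \<kappa>0 * t)" for t
        by (simp add: algebra_simps)
      show ?case
        using l(1) aG VG unfolding V_def[symmetric] G_def[symmetric] exp by linarith
    next
      case hyp: (2 p q \<kappa>0 \<theta>0 \<Omega> \<T> \<beta> K v)
      define G where "G = Lnorm q (cell K) (dir_deriv (cell K) (\<beta> K) v)"
      have "0 \<le> G" "0 \<le> L \<kappa>0 * G"
        using L[OF hypotheses_element(4)[OF hyp(1,2)]] by (simp_all add: G_def Lnorm_nonneg)
      moreover have "2 * (1 + L \<kappa>0) * G = 2 * G + 2 * (L \<kappa>0 * G)" by (simp add: algebra_simps)
      ultimately show ?case using lin(2)[OF hyp] unfolding G_def[symmetric] by linarith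
    next
      case hyp: (3 p q \<kappa>0 \<theta>0 \<Omega> \<T> \<beta> \<sigma> K v)
      have "0 \<le> L \<kappa>0" using L hypotheses_element(4)[OF hyp(1,3)] .
      then show ?case
        using lin[OF hyp(1,3,4)] hyp(2,3) by (intro weighted_estimate) (auto simp: Lnorm_nonneg)
    qed
  next
    case 3
    show ?case
    proof (intro exI[of _ C] conjI allI impI ballI, goal_cases)
      case 1
      show ?case by (simp add: C_def)
    next
      case (2 k p q \<kappa>0 \<theta>0 \<Omega> \<T> \<beta> K v)
      then show ?case by (rule tn)
    next
      case (3 k p q \<kappa>0 \<theta>0 \<Omega> \<T> \<beta> v)
      note hyp = 3(1)
      have "1 < p" "q = p / (p - 1)" "0 < \<kappa>0" "0 < \<theta>0" using hyp by (simp_all add: hypotheses_def)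
      then have q: "1 < q" by (simp add: less_divide_eq)
      have "0 \<le> C k q \<theta>0 \<kappa>0"
        unfolding C_def using L[OF \<open>0 < \<kappa>0\<close>] \<open>0 < \<kappa>0\<close> \<open>0 < \<theta>0\<close> \<kappa>(1) \<open>M > 0\<close> by (auto intro!: gen_const_nonneg)
      moreover have "v K \<in> Wspace q (\<beta> K) (cell K)" if "K \<in> \<T>" for K
        using 3(2) that by (auto simp: Wspace_mesh_def)
      ultimately show ?case
        unfolding tnorm_mesh_def fortin_plus_mesh_def
        using nondegenerate_element.tnorm_nonneg[OF hypotheses_element(1)[OF hyp]] tn[OF hyp] q
        by (intro powr_sum_scale_le) auto
    qed
  qed
qed

end
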